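(* Let $n\ge 2$ and $d\in\{3,4\}$. Let $H\subset\mathbb{P}^n_{\mathbb{C}}$ be a singular hypersurface of degree $d$ all of whose singular points are isolated and of multiplicity $2$, and let $r$ be the minimum, over the singular points $p$ of $H$, of the rank of the Hessian of $H$ at $p$. If $r>\frac{2(n+1)}{d}$ then $H$ is stable; if $r\ge\frac{2(n+1)}{d}$ then $H$ is semi-stable.
   Context: $\mathrm{SL}(n+1)$ acts on $\mathbb{P}(\mathbb{C}[x_0,\dots,x_n]_d)$ by linear change of coordinates; $H=V(f)$ is called stable (resp. semi-stable) if $[f]$ is GIT stable (resp. semi-stable) for this action with respect to $\mathcal{O}(1)$. Multiplicity means order of vanishing of $f$. For a singular point $p$ of $H$, take an affine chart $\mathbb{A}^n$ containing $p$ with affine coordinates $y_1,\dots,y_n$ centered at $p$, and write the local equation as $g=g_2+g_3+\cdots$ with $g_k$ homogeneous of degree $k$; the rank of the Hessian of $H$ at $p$ is the rank of the quadratic form $g_2$ in $n$ variables (equivalently, the rank of the $(n+1)\times(n+1)$ Hessian matrix of $f$ at a representative of $p$). Its corank is $n$ minus this rank. *)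

theory Defs
  imports "HOL-Analysis.Analysis"
begin

text \<open>Homogeneous forms of degree d in the CARD('n) = n+1 variables x_i (i :: 'n),
  represented by their coefficient vectors: functions from exponent vectors
  (monomials) to complex numbers, vanishing outside the degree-d monomials.\<close>

definition dmonos :: "nat \<Rightarrow> ('n::finite \<Rightarrow> nat) set" where
  "dmonos d = {\<alpha>. sum \<alpha> UNIV = d}"

definition hform :: "nat \<Rightarrow> (('n::finite \<Rightarrow> nat) \<Rightarrow> complex) set" where
  "hform d = {c. \<forall>\<alpha>. \<alpha> \<notin> dmonos d \<longrightarrow> c \<alpha> = 0}"

definition feval :: "nat \<Rightarrow> (('n::finite \<Rightarrow> nat) \<Rightarrow> complex) \<Rightarrow> complex^'n \<Rightarrow> complex" where
  "feval d c x = (\<Sum>\<alpha>\<in>dmonos d. c \<alpha> * (\<Prod>j\<in>UNIV. (x $ j) ^ (\<alpha> j)))"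

text \<open>Value at x of the partial derivative d^beta f of the form f (formal derivative;
  the falling factorial a(a-1)...(a-b+1) is written (a choose b) * b!).\<close>
definition fderiv_eval :: "nat \<Rightarrow> (('n::finite \<Rightarrow> nat) \<Rightarrow> complex) \<Rightarrow> ('n \<Rightarrow> nat) \<Rightarrow> complex^'n \<Rightarrow> complex" where
  "fderiv_eval d c \<beta> x =
     (\<Sum>\<alpha>\<in>dmonos d. c \<alpha> *
        (\<Prod>j\<in>UNIV. of_nat ((\<alpha> j choose \<beta> j) * fact (\<beta> j)) * (x $ j) ^ (\<alpha> j - \<beta> j)))"

definition unitv :: "'n \<Rightarrow> ('n \<Rightarrow> nat)" where
  "unitv i = (\<lambda>j. if j = i then 1 else 0)"

definition hessian :: "nat \<Rightarrow> (('n::finite \<Rightarrow> nat) \<Rightarrow> complex) \<Rightarrow> complex^'n \<Rightarrow> complex^'n^'n" where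
  "hessian d c x = (\<chi> i j. fderiv_eval d c (\<lambda>k. unitv i k + unitv j k) x)"

definition fmult :: "nat \<Rightarrow> (('n::finite \<Rightarrow> nat) \<Rightarrow> complex) \<Rightarrow> complex^'n \<Rightarrow> nat" where
  "fmult d c x = (LEAST k. \<exists>\<beta>. sum \<beta> UNIV = k \<and> fderiv_eval d c \<beta> x \<noteq> 0)"

text \<open>Nonzero representatives of the singular points of H = V(f) in P^n.\<close>
definition sing_pts :: "nat \<Rightarrow> (('n::finite \<Rightarrow> nat) \<Rightarrow> complex) \<Rightarrow> (complex^'n) set" where
  "sing_pts d c = {x. x \<noteq> 0 \<and> feval d c x = 0 \<and> (\<forall>i. fderiv_eval d c (unitv i) x = 0)}"

text \<open>The point [x] is isolated in the singular locus of H (in P^n): some neighbourhood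
  of x in C^(n+1) contains no singular representatives except multiples of x.\<close>
definition isolated_sing :: "nat \<Rightarrow> (('n::finite \<Rightarrow> nat) \<Rightarrow> complex) \<Rightarrow> complex^'n \<Rightarrow> bool" where
  "isolated_sing d c x \<longleftrightarrow>
     (\<exists>e>0. \<forall>y\<in>sing_pts d c. norm (y - x) < e \<longrightarrow> (\<exists>t::complex. y = t *s x))"

definition SL :: "(complex^'n::finite^'n) set" where
  "SL = {g. det g = 1}"

definition forbit :: "nat \<Rightarrow> (('n::finite \<Rightarrow> nat) \<Rightarrow> complex) \<Rightarrow> (('n \<Rightarrow> nat) \<Rightarrow> complex) set" where
  "forbit d c = {c' \<in> hform d. \<exists>g\<in>SL. \<forall>x. feval d c' x = feval d c (g *v x)}"

definition fstab :: "nat \<Rightarrow> (('n::finite \<Rightarrow> nat) \<Rightarrow> complex) \<Rightarrow> (complex^'n^'n) set" where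
  "fstab d c = {g\<in>SL. \<forall>x. feval d c (g *v x) = feval d c x}"

text \<open>GIT (semi)stability of [f] for SL(n+1) acting on P(C[x]_d) w.r.t. O(1), via the
  affine cone: semi-stable iff 0 is not in the orbit closure of f; stable iff the orbit
  of f is closed and the stabilizer of f is finite (f nonzero).\<close>
definition semistable :: "nat \<Rightarrow> (('n::finite \<Rightarrow> nat) \<Rightarrow> complex) \<Rightarrow> bool" where
  "semistable d c \<longleftrightarrow> c \<in> hform d \<and> c \<noteq> (\<lambda>_. 0) \<and> (\<lambda>_. 0) \<notin> closure (forbit d c)"

definition stable :: "nat \<Rightarrow> (('n::finite \<Rightarrow> nat) \<Rightarrow> complex) \<Rightarrow> bool" where
  "stable d c \<longleftrightarrow> c \<in> hform d \<and> c \<noteq> (\<lambda>_. 0) \<and> closed (forbit d c) \<and> finite (fstab d c)"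

end

theory Submission
  imports Defs
    "HOL-Complex_Analysis.Cauchy_Integral_Formula"
    "HOL-Computational_Algebra.Fundamental_Theorem_Algebra"
    "HOL-Library.Function_Algebras"
begin

text \<open>Complete pivoting writes every $g \in SL$ as $k\,t\,l$ with $t$ diagonal and $k, l$ in a fixed
  compact set, so a failure of semi-stability or of properness of the orbit map yields, in some
  linear coordinate system, real weights $u \neq 0$ of sum 0 that are negative (resp. nonpositive) on
  all monomials of the form; real weights suffice, no one-parameter subgroup is needed.  Suppose such $u$
  exist, and let $a > 0$ be the largest weight.  If a singular point has support in the coordinates of
  weight $a$, a nonzero Hessian entry $(i,j)$ there forces $u_i + u_j + (d-2)a \le 0$; summing this over
  a nonzero generalised diagonal of length $r$ gives $dr \le 2(n+1)$.  If there is no such point,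
  singularities are produced as common zeros: the partial derivatives not vanishing identically on the
  span of the coordinates of weight at least $\tau$ belong to weights at most $-(d-1)\tau$, and fewer than
  $m$ forms in $m$ variables have a common zero.  As the singularities are isolated, some hyperplane
  misses them all, so the former weights outnumber the latter by at most one, which is incompatible
  with a vanishing sum of the weights.\<close>


section \<open>Forms and linear substitutions\<close>

text \<open>The Hessian bounds the weights only at a singular point supported on the coordinates of
  maximal weight. Such a point is not part of the data, so singular points have to be produced by an
  existence theorem for common zeros. The number -(d-1)\<tau> arises as follows: a monomial
  contributing to the partial derivative by x_j on the span of the coordinates of weight at least
  \<tau> has total weight at least u_j + (d-1)\<tau>, and this may not exceed 0. Adding a linear
  form that misses all singular points costs one in the count of equations. The comparison of
  weights still contradicts a vanishing sum because d - 1 >= 2, which is where d >= 3 enters. Both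
  requirements of stability come from one properness statement: those g in SL for which the
  coefficients of f(gx) stay below a given bound form a bounded set. Compactness then closes the
  orbit, and the stabiliser is bounded. Forms appear as coefficient vectors where topology matters
  and as functions where algebra matters; \<open>coefx\<close> leads from the latter to the
  former.\<close>

definition mon :: "('n::finite \<Rightarrow> nat) \<Rightarrow> complex^'n \<Rightarrow> complex" where
  "mon \<alpha> x = (\<Prod>j\<in>UNIV. (x $ j) ^ \<alpha> j)"

lemma feval_mon: "feval d c x = (\<Sum>\<alpha>\<in>dmonos d. c \<alpha> * mon \<alpha> x)"
  by (simp add: feval_def mon_def)

lemma le_of_dmonos: "\<alpha> \<in> dmonos d \<Longrightarrow> \<alpha> j \<le> d"
  for \<alpha> :: "'n::finite \<Rightarrow> nat"
  unfolding dmonos_def using member_le_sum[of j UNIV \<alpha>] by auto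

lemma finite_bounded_exps: "finite {\<alpha> :: 'n::finite \<Rightarrow> nat. \<forall>j. \<alpha> j \<le> d}"
proof -
  have "{\<alpha> :: 'n \<Rightarrow> nat. \<forall>j. \<alpha> j \<le> d} = PiE UNIV (\<lambda>_. {..d})"
    by (auto simp: PiE_def Pi_def)
  then show ?thesis by (simp add: finite_PiE)
qed

lemma finite_dmonos [simp]: "finite (dmonos d :: ('n::finite \<Rightarrow> nat) set)"
  by (rule finite_subset[OF _ finite_bounded_exps[of d]]) (auto dest: le_of_dmonos)

section \<open>Recovering coefficients by finite Fourier analysis\<close>

definition rou :: "nat \<Rightarrow> complex" where
  "rou M = cis (2 * pi / real M)"

lemma rou_power_eq_1_iff:
  assumes "M > 0" shows "rou M ^ e = 1 \<longleftrightarrow> M dvd e"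
proof -
  have "rou M ^ e = exp (2 * of_real pi * \<i> * of_nat e / of_nat M)"
    unfolding rou_def cis_conv_exp exp_of_nat_mult[symmetric] by (simp add: mult_ac)
  then show ?thesis
    using complex_root_unity_eq_1[of M e] assms by simp
qed

text \<open>Orthogonality of the characters of Z/M. The exponent \<open>M - b\<close> stands for -b,
  so that only natural powers occur.\<close>

lemma rou_power_sum:
  assumes "a < M" "b < M"
  shows "(\<Sum>s<M. (rou M ^ s) ^ a * (rou M ^ s) ^ (M - b)) = (if a = b then of_nat M else 0)"
proof -
  have M: "M > 0" using assms by simp
  let ?q = "rou M ^ (a + (M - b))"
  have eq: "(rou M ^ s) ^ a * (rou M ^ s) ^ (M - b) = ?q ^ s" for s
    by (simp add: power_add power_mult_distrib flip: power_mult)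
       (simp add: mult.commute)
  show ?thesis
  proof (cases "a = b")
    case True
    then have "?q = 1" using assms by (simp add: rou_power_eq_1_iff M)
    then show ?thesis unfolding eq using True by simp
  next
    case False
    have "\<not> M dvd a + (M - b)"
    proof
      assume "M dvd a + (M - b)"
      then obtain k where k: "a + (M - b) = M * k" by (auto simp: dvd_def)
      \<comment> \<open>As a, b < M, the exponent lies strictly between 0 and 2M, so it could only
        be M itself, which means a = b.\<close>
      have "M * k < M * 2" "M * k > 0" using assms by (simp_all flip: k)
      then have "k = 1" by auto
      then show False using k assms False by simp
    qed
    then have q1: "?q \<noteq> 1" by (simp add: rou_power_eq_1_iff M)
    have "rou M ^ M = 1" by (simp add: rou_power_eq_1_iff M)
    then have "?q ^ M = 1" by (simp flip: power_mult) (metis mult.commute power_mult power_one)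
    then show ?thesis unfolding eq using False q1 by (simp add: sum_gp_strict)
  qed
qed

text \<open>Discrete Fourier inversion on the torus of roots of unity recovers the coefficients of a
  polynomial with all exponents below M, as fixed linear combinations of its values.\<close>
definition coefx :: "nat \<Rightarrow> (complex^'n::finite \<Rightarrow> complex) \<Rightarrow> ('n \<Rightarrow> nat) \<Rightarrow> complex" where
  "coefx M F \<beta> = (\<Sum>s\<in>PiE UNIV (\<lambda>_. {..<M}).
      F (\<chi> j. rou M ^ s j) * (\<Prod>j\<in>UNIV. (rou M ^ s j) ^ (M - \<beta> j))) / of_nat M ^ CARD('n)"

text \<open>The sum over the torus factors into one character sum per variable, and orthogonality
  applies to each.\<close>

lemma coefx_mon:
  fixes \<alpha> \<beta> :: "'n::finite \<Rightarrow> nat"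
  assumes "\<And>j. \<alpha> j < M" "\<And>j. \<beta> j < M"
  shows "coefx M (mon \<alpha>) \<beta> = (if \<alpha> = \<beta> then 1 else 0)"
proof -
  have M: "M > 0" using assms(1)[of undefined] by simp
  have "(\<Sum>s\<in>PiE UNIV (\<lambda>_. {..<M}).
      mon \<alpha> (\<chi> j. rou M ^ s j) * (\<Prod>j\<in>UNIV. (rou M ^ s j) ^ (M - \<beta> j)))
      = (\<Sum>s\<in>PiE UNIV (\<lambda>_. {..<M}). \<Prod>j\<in>UNIV. (rou M ^ s j) ^ \<alpha> j * (rou M ^ s j) ^ (M - \<beta> j))"
    by (simp add: mon_def prod.distrib)
  also have "\<dots> = (\<Prod>j\<in>UNIV. \<Sum>s<M. (rou M ^ s) ^ \<alpha> j * (rou M ^ s) ^ (M - \<beta> j))"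
    by (rule prod_sum_PiE[symmetric]) auto
  also have "\<dots> = (\<Prod>j\<in>(UNIV::'n set). if \<alpha> j = \<beta> j then of_nat M else 0)"
    by (intro prod.cong refl rou_power_sum assms)
  also have "\<dots> = (if \<alpha> = \<beta> then of_nat M ^ CARD('n) else 0)"
    by (auto simp: fun_eq_iff)
  finally show ?thesis using M by (simp add: coefx_def)
qed

lemma coefx_sum: "coefx M (\<lambda>x. \<Sum>a\<in>A. c a * F a x) \<beta> = (\<Sum>a\<in>A. c a * coefx M (F a) \<beta>)"
  unfolding coefx_def
  by (simp add: sum_distrib_right sum_distrib_left sum_divide_distrib)
     (subst sum.swap, simp add: mult_ac)

lemma coefx_lincomb:
  fixes A :: "('n::finite \<Rightarrow> nat) set"
  assumes "finite A" "\<And>\<alpha> j. \<alpha> \<in> A \<Longrightarrow> \<alpha> j < M" "\<And>j. \<beta> j < M"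
  shows "coefx M (\<lambda>x. \<Sum>\<alpha>\<in>A. c \<alpha> * mon \<alpha> x) \<beta> = (if \<beta> \<in> A then c \<beta> else 0)"
proof -
  have "coefx M (\<lambda>x. \<Sum>\<alpha>\<in>A. c \<alpha> * mon \<alpha> x) \<beta> = (\<Sum>\<alpha>\<in>A. c \<alpha> * (if \<alpha> = \<beta> then 1 else 0))"
    unfolding coefx_sum by (intro sum.cong refl) (simp add: coefx_mon assms)
  also have "\<dots> = (\<Sum>\<alpha>\<in>A. if \<alpha> = \<beta> then c \<alpha> else 0)"
    by (intro sum.cong refl) simp
  also have "\<dots> = (if \<beta> \<in> A then c \<beta> else 0)"
    using assms(1) by (simp add: sum.delta')
  finally show ?thesis .
qed

lemma coefx_feval:
  fixes c :: "('n::finite \<Rightarrow> nat) \<Rightarrow> complex"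
  assumes "\<alpha> \<in> dmonos d"
  shows "coefx (Suc d) (feval d c) \<alpha> = c \<alpha>"
proof -
  have "coefx (Suc d) (\<lambda>x. \<Sum>\<alpha>\<in>dmonos d. c \<alpha> * mon \<alpha> x) \<alpha> = c \<alpha>"
    using assms by (subst coefx_lincomb) (auto simp: less_Suc_eq_le le_of_dmonos)
  then show ?thesis by (simp add: feval_mon[abs_def])
qed

lemma feval_inject:
  assumes "c \<in> hform d" "c' \<in> hform d" "\<And>x. feval d c x = feval d c' x"
  shows "c = c'"
proof
  fix \<alpha>
  have "feval d c = feval d c'" using assms(3) by auto
  then show "c \<alpha> = c' \<alpha>"
    using coefx_feval[of \<alpha> d c] coefx_feval[of \<alpha> d c'] assms(1,2)
    by (cases "\<alpha> \<in> dmonos d") (auto simp: hform_def)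
qed

text \<open>On functions, closure under linear substitution can be proved by multiplying one linear
  form at a time, without a multinomial expansion of the coefficients.\<close>

definition PF :: "nat \<Rightarrow> (complex^'n::finite \<Rightarrow> complex) set" where
  "PF d = {feval d c | c. c \<in> hform d}"

lemma PF_lincomb:
  assumes "finite A" "\<And>a. a \<in> A \<Longrightarrow> F a \<in> PF d"
  shows "(\<lambda>x. \<Sum>a\<in>A. (k a) * F a x) \<in> PF d"
proof -
  have "\<forall>a\<in>A. \<exists>c. c \<in> hform d \<and> F a = feval d c" using assms(2) by (auto simp: PF_def)
  then obtain C where C: "\<And>a. a \<in> A \<Longrightarrow> C a \<in> hform d" "\<And>a. a \<in> A \<Longrightarrow> F a = feval d (C a)"
    by metis
  have "(\<lambda>x. \<Sum>a\<in>A. (k a) * F a x) = feval d (\<lambda>\<alpha>. \<Sum>a\<in>A. k a * C a \<alpha>)"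
    by (rule ext) (simp add: C(2) feval_def sum_distrib_left sum_distrib_right mult.assoc sum.swap[of _ A])
  moreover have "(\<lambda>\<alpha>. \<Sum>a\<in>A. k a * C a \<alpha>) \<in> hform d"
    using C(1) by (auto simp: hform_def intro!: sum.neutral)
  ultimately show ?thesis by (auto simp: PF_def)
qed

lemma mon_in_PF: "mon \<alpha> \<in> PF (sum \<alpha> UNIV)"
proof -
  let ?c = "\<lambda>\<gamma>. if \<gamma> = \<alpha> then 1 else (0::complex)"
  have "mon \<alpha> = feval (sum \<alpha> UNIV) ?c"
  proof
    fix x
    have "feval (sum \<alpha> UNIV) ?c x = (\<Sum>\<gamma>\<in>dmonos (sum \<alpha> UNIV). if \<gamma> = \<alpha> then mon \<gamma> x else 0)"
      unfolding feval_mon by (intro sum.cong) auto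
    also have "\<dots> = mon \<alpha> x"
      by (subst sum.delta) (auto simp: dmonos_def finite_dmonos[unfolded dmonos_def])
    finally show "mon \<alpha> x = feval (sum \<alpha> UNIV) ?c x" by simp
  qed
  moreover have "?c \<in> hform (sum \<alpha> UNIV)" by (auto simp: hform_def dmonos_def)
  ultimately show ?thesis by (auto simp: PF_def)
qed

lemma mon_add: "mon (\<lambda>j. \<alpha> j + \<beta> j) x = mon \<alpha> x * mon \<beta> x"
  by (simp add: mon_def power_add prod.distrib)

lemma mon_unitv: "mon (unitv i) x = x $ i"
proof -
  have "mon (unitv i) x = (\<Prod>j\<in>UNIV. if j = i then x $ j else 1)"
    unfolding mon_def unitv_def by (intro prod.cong) auto
  then show ?thesis by simp
qed

lemma sum_unitv: "sum (unitv i) UNIV = 1" for i :: "'n::finite"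
  by (simp add: unitv_def)

lemma PF_mult_coord:
  assumes "F \<in> PF d" shows "(\<lambda>x. F x * x $ i) \<in> PF (Suc d)"
proof -
  from assms obtain c where c: "F = feval d c" by (auto simp: PF_def)
  have "(\<lambda>x. F x * x $ i) = (\<lambda>x. \<Sum>\<alpha>\<in>dmonos d. c \<alpha> * mon (\<lambda>j. \<alpha> j + unitv i j) x)"
    by (simp add: fun_eq_iff c feval_mon mon_add mon_unitv sum_distrib_right mult.assoc)
  moreover have "mon (\<lambda>j. \<alpha> j + unitv i j) \<in> PF (Suc d)" if "\<alpha> \<in> dmonos d" for \<alpha> :: "'a \<Rightarrow> nat"
    using mon_in_PF[of "\<lambda>j. \<alpha> j + unitv i j"] that by (simp add: sum.distrib sum_unitv dmonos_def)
  ultimately show ?thesis using PF_lincomb[of "dmonos d"] by force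
qed

lemma PF_mult_linear:
  assumes "F \<in> PF d" shows "(\<lambda>x. F x * (\<Sum>i\<in>UNIV. a i * x $ i)) \<in> PF (Suc d)"
  using PF_lincomb[of UNIV "\<lambda>i x. F x * x $ i" "Suc d" a] PF_mult_coord[OF assms]
  by (simp add: sum_distrib_left mult_ac)

lemma PF_mult_linear_power:
  assumes "F \<in> PF d" shows "(\<lambda>x. F x * (\<Sum>i\<in>UNIV. a i * x $ i) ^ m) \<in> PF (d + m)"
proof (induction m)
  case 0
  then show ?case using assms by simp
next
  case (Suc m)
  then show ?case using PF_mult_linear[OF Suc, of a] by (simp add: mult_ac)
qed

lemma PF_prod_linear:
  assumes "finite S"
  shows "(\<lambda>x. \<Prod>j\<in>S. (\<Sum>i\<in>UNIV. a j i * x $ i) ^ \<alpha> j) \<in> PF (sum \<alpha> S)"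
  using assms
proof (induction S)
  case empty
  have "(\<lambda>x. 1) = mon (\<lambda>_::'b. 0)" by (simp add: mon_def fun_eq_iff)
  then show ?case using mon_in_PF[of "\<lambda>_::'b. 0"] by simp
next
  case (insert j S)
  then show ?case using PF_mult_linear_power[OF insert.IH, of "a j" "\<alpha> j"]
    by (simp add: mult_ac add_ac)
qed

lemma feval_comp_PF: "(\<lambda>x. feval d c (g *v x)) \<in> PF d"
proof -
  have "(\<lambda>x. mon \<alpha> (g *v x)) \<in> PF d" if "\<alpha> \<in> dmonos d" for \<alpha>
    using PF_prod_linear[of UNIV "\<lambda>j i. g $ j $ i" \<alpha>] that
    by (simp add: mon_def matrix_vector_mult_def dmonos_def)
  then show ?thesis unfolding feval_mon by (intro PF_lincomb) auto
qed

text \<open>The Fourier formula makes the new coefficients finite combinations of values of the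
  form, so their joint continuity in form and matrix, and a uniform bound on them, reduce to
  evaluation.\<close>

definition fsubst :: "nat \<Rightarrow> (('n::finite \<Rightarrow> nat) \<Rightarrow> complex) \<Rightarrow> complex^'n^'n \<Rightarrow> ('n \<Rightarrow> nat) \<Rightarrow> complex" where
  "fsubst d c g = (\<lambda>\<alpha>. if \<alpha> \<in> dmonos d then coefx (Suc d) (\<lambda>x. feval d c (g *v x)) \<alpha> else 0)"

lemma fsubst_hform [simp]: "fsubst d c g \<in> hform d"
  by (simp add: fsubst_def hform_def)

lemma feval_fsubst [simp]: "feval d (fsubst d c g) x = feval d c (g *v x)"
proof -
  from feval_comp_PF[of d c g] obtain c' where c': "c' \<in> hform d"
    "(\<lambda>x. feval d c (g *v x)) = feval d c'" by (auto simp: PF_def)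
  have "fsubst d c g = c'"
    using c' by (auto simp: fsubst_def coefx_feval hform_def)
  then show ?thesis using c'(2) by metis
qed

lemma fsubst_eqI: "c' \<in> hform d \<Longrightarrow> (\<And>x. feval d c' x = feval d c (g *v x)) \<Longrightarrow> fsubst d c g = c'"
  by (rule feval_inject[of _ d]) auto

lemma fsubst_fsubst: "fsubst d (fsubst d c g) h = fsubst d c (g ** h)"
  by (rule fsubst_eqI) (auto simp: matrix_vector_mul_assoc)

lemma tendsto_feval:
  assumes "\<And>\<alpha>. ((\<lambda>m. C m \<alpha>) \<longlongrightarrow> c \<alpha>) F" "(X \<longlongrightarrow> x) F"
  shows "((\<lambda>m. feval d (C m) (X m)) \<longlongrightarrow> feval d c x) F"
  unfolding feval_def by (intro tendsto_intros assms)

lemma tendsto_fsubst: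
  assumes "\<And>\<alpha>. ((\<lambda>m. C m \<alpha>) \<longlongrightarrow> c \<alpha>) F" "(G \<longlongrightarrow> g) F"
  shows "((\<lambda>m. fsubst d (C m) (G m) \<alpha>) \<longlongrightarrow> fsubst d c g \<alpha>) F"
proof (cases "\<alpha> \<in> dmonos d")
  case True
  have "((\<lambda>m. feval d (C m) (G m *v x)) \<longlongrightarrow> feval d c (g *v x)) F" for x
    unfolding matrix_vector_mult_def
    by (intro tendsto_feval assms tendsto_vec_lambda tendsto_intros)
  then show ?thesis using True unfolding fsubst_def coefx_def divide_inverse
    by simp (intro tendsto_intros)
qed (simp add: fsubst_def)

section \<open>Derivatives under substitution and ranks\<close>

lemma fderiv_term_deriv:
  fixes x y :: "complex^'n::finite"
  shows "((\<lambda>t. \<Prod>j\<in>UNIV. of_nat ((\<alpha> j choose \<beta> j) * fact (\<beta> j)) * ((x + t *s y) $ j) ^ (\<alpha> j - \<beta> j))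
     has_field_derivative
     (\<Sum>i\<in>UNIV. y $ i * (\<Prod>j\<in>UNIV. of_nat ((\<alpha> j choose (\<beta> j + unitv i j)) * fact (\<beta> j + unitv i j))
        * (x $ j) ^ (\<alpha> j - (\<beta> j + unitv i j))))) (at 0)"
proof -
  let ?f = "\<lambda>j t. of_nat ((\<alpha> j choose \<beta> j) * fact (\<beta> j)) * ((x + t *s y) $ j) ^ (\<alpha> j - \<beta> j) :: complex"
  let ?f' = "\<lambda>j. of_nat ((\<alpha> j choose Suc (\<beta> j)) * fact (Suc (\<beta> j))) * (x $ j) ^ (\<alpha> j - Suc (\<beta> j)) * y $ j"
  \<comment> \<open>Recurrence of the falling factorial. For \<alpha> j <= \<beta> j both sides are
    0, through the binomial on the left and truncated subtraction on the right.\<close>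
  have fall: "(\<alpha> j choose Suc (\<beta> j)) * fact (Suc (\<beta> j)) = (\<alpha> j - \<beta> j) * ((\<alpha> j choose \<beta> j) * fact (\<beta> j))" for j
  proof (cases "\<beta> j < \<alpha> j")
    case True
    have "Suc (\<beta> j) * (\<alpha> j choose Suc (\<beta> j)) = (\<alpha> j - \<beta> j) * (\<alpha> j choose \<beta> j)"
      using binomial_absorb_comp[of "\<alpha> j" "\<beta> j"] binomial_absorption[of "\<beta> j" "\<alpha> j"] True
      by (metis binomial_absorption Suc_pred' bot_nat_0.not_eq_extremum less_nat_zero_code)
    then have "Suc (\<beta> j) * (\<alpha> j choose Suc (\<beta> j)) * fact (\<beta> j) = (\<alpha> j - \<beta> j) * (\<alpha> j choose \<beta> j) * fact (\<beta> j)" by (rule arg_cong)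
    then show ?thesis by (simp only: fact_Suc of_nat_id mult_ac)
  qed (auto simp: binomial_eq_0)
  have d: "(?f j has_field_derivative ?f' j) (at 0)" for j
  proof -
    have "(?f j has_field_derivative of_nat ((\<alpha> j choose \<beta> j) * fact (\<beta> j)) *
        (of_nat (\<alpha> j - \<beta> j) * (y $ j * ((x + 0 *s y) $ j) ^ (\<alpha> j - \<beta> j - Suc 0)))) (at 0)"
      by (auto intro!: derivative_eq_intros)
    also have "of_nat ((\<alpha> j choose \<beta> j) * fact (\<beta> j)) *
        (of_nat (\<alpha> j - \<beta> j) * (y $ j * ((x + 0 *s y) $ j) ^ (\<alpha> j - \<beta> j - Suc 0))) = ?f' j"
      unfolding fall by (simp add: mult_ac)
    finally show ?thesis .
  qed
  have "((\<lambda>t. \<Prod>j\<in>UNIV. ?f j t) has_field_derivative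
      (\<Sum>i\<in>UNIV. ?f' i * (\<Prod>j\<in>UNIV - {i}. ?f j 0))) (at 0)"
    by (rule has_field_derivative_prod) (rule d)
  also have "(\<Sum>i\<in>UNIV. ?f' i * (\<Prod>j\<in>UNIV - {i}. ?f j 0)) =
     (\<Sum>i\<in>UNIV. y $ i * (\<Prod>j\<in>UNIV. of_nat ((\<alpha> j choose (\<beta> j + unitv i j)) * fact (\<beta> j + unitv i j))
        * (x $ j) ^ (\<alpha> j - (\<beta> j + unitv i j))))"
  proof (intro sum.cong refl)
    fix i :: 'n
    have "(\<Prod>j\<in>UNIV - {i}. ?f j 0) = (\<Prod>j\<in>UNIV - {i}. of_nat ((\<alpha> j choose (\<beta> j + unitv i j)) * fact (\<beta> j + unitv i j))
        * (x $ j) ^ (\<alpha> j - (\<beta> j + unitv i j)))"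
      by (intro prod.cong) (auto simp: unitv_def)
    then show "?f' i * (\<Prod>j\<in>UNIV - {i}. ?f j 0) = y $ i * (\<Prod>j\<in>UNIV. of_nat ((\<alpha> j choose (\<beta> j + unitv i j)) * fact (\<beta> j + unitv i j))
        * (x $ j) ^ (\<alpha> j - (\<beta> j + unitv i j)))"
      by (subst prod.remove[of UNIV i]) (auto simp: unitv_def mult_ac)
  qed
  finally show ?thesis .
qed

text \<open>Ties the formal partial derivatives to analytic derivatives along lines; the chain rules
  below then follow from uniqueness of derivatives.\<close>

lemma fderiv_eval_deriv:
  "((\<lambda>t. fderiv_eval d c \<beta> (x + t *s y)) has_field_derivative
     (\<Sum>i\<in>UNIV. y $ i * fderiv_eval d c (\<lambda>k. \<beta> k + unitv i k) x)) (at 0)"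
proof -
  have "((\<lambda>t. fderiv_eval d c \<beta> (x + t *s y)) has_field_derivative
     (\<Sum>\<alpha>\<in>dmonos d. c \<alpha> * (\<Sum>i\<in>UNIV. y $ i * (\<Prod>j\<in>UNIV. of_nat ((\<alpha> j choose (\<beta> j + unitv i j)) * fact (\<beta> j + unitv i j))
        * (x $ j) ^ (\<alpha> j - (\<beta> j + unitv i j)))))) (at 0)"
    unfolding fderiv_eval_def by (intro DERIV_sum DERIV_cmult fderiv_term_deriv)
  also have "(\<Sum>\<alpha>\<in>dmonos d. c \<alpha> * (\<Sum>i\<in>UNIV. y $ i * (\<Prod>j\<in>UNIV. of_nat ((\<alpha> j choose (\<beta> j + unitv i j)) * fact (\<beta> j + unitv i j))
        * (x $ j) ^ (\<alpha> j - (\<beta> j + unitv i j)))))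
     = (\<Sum>i\<in>UNIV. y $ i * fderiv_eval d c (\<lambda>k. \<beta> k + unitv i k) x)"
    unfolding fderiv_eval_def by (simp only: sum_distrib_left) (subst sum.swap, simp only: mult_ac)
  finally show ?thesis .
qed

lemma feval_fderiv: "feval d c = fderiv_eval d c (\<lambda>_. 0)"
  by (simp add: fun_eq_iff feval_def fderiv_eval_def)

lemma feval_deriv:
  "((\<lambda>t. feval d c (x + t *s y)) has_field_derivative
     (\<Sum>i\<in>UNIV. y $ i * fderiv_eval d c (unitv i) x)) (at 0)"
  using fderiv_eval_deriv[of d c "\<lambda>_. 0" x y] by (simp add: feval_fderiv)

lemma mv_line: "g *v (x + t *s y) = g *v x + t *s (g *v y)" for g :: "complex^'n::finite^'m"
  by (simp add: matrix_vector_right_distrib vector_scalar_commute)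

lemma mv_axis: "(g *v axis i 1) $ l = g $ l $ i" for g :: "complex^'n::finite^'m"
  by (simp add: matrix_vector_mult_def axis_def if_distrib[of "\<lambda>x. _ * x"] cong: if_cong)

lemma fderiv1_fsubst:
  "fderiv_eval d (fsubst d c g) (unitv i) x = (\<Sum>l\<in>UNIV. g $ l $ i * fderiv_eval d c (unitv l) (g *v x))"
proof -
  have "((\<lambda>t. feval d (fsubst d c g) (x + t *s axis i 1)) has_field_derivative
      (\<Sum>l\<in>UNIV. (g *v axis i 1) $ l * fderiv_eval d c (unitv l) (g *v x))) (at 0)"
    unfolding feval_fsubst mv_line by (rule feval_deriv)
  moreover have "(\<Sum>l\<in>UNIV. axis i 1 $ l * fderiv_eval d (fsubst d c g) (unitv l) x)
      = fderiv_eval d (fsubst d c g) (unitv i) x"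
    by (simp add: axis_def if_distrib[of "\<lambda>x. x * _"] cong: if_cong)
  ultimately show ?thesis
    using DERIV_unique[OF feval_deriv[of d "fsubst d c g" x "axis i 1"]]
    by (simp only: mv_axis)
qed

text \<open>The gradient rule \<open>fderiv1_fsubst\<close>, differentiated once more along a
  coordinate axis.\<close>

lemma hessian_fsubst:
  "hessian d (fsubst d c g) x = transpose g ** hessian d c (g *v x) ** g"
proof -
  have "fderiv_eval d (fsubst d c g) (\<lambda>k. unitv i k + unitv j k) x
      = (\<Sum>l\<in>UNIV. g $ l $ i * (\<Sum>m\<in>UNIV. g $ m $ j * fderiv_eval d c (\<lambda>k. unitv l k + unitv m k) (g *v x)))" for i j
  proof -
    have "((\<lambda>t. fderiv_eval d (fsubst d c g) (unitv i) (x + t *s axis j 1)) has_field_derivative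
      (\<Sum>l\<in>UNIV. g $ l $ i * (\<Sum>m\<in>UNIV. (g *v axis j 1) $ m * fderiv_eval d c (\<lambda>k. unitv l k + unitv m k) (g *v x)))) (at 0)"
      unfolding fderiv1_fsubst mv_line by (intro DERIV_sum DERIV_cmult fderiv_eval_deriv)
    moreover have "(\<Sum>l\<in>UNIV. axis j 1 $ l * fderiv_eval d (fsubst d c g) (\<lambda>k. unitv i k + unitv l k) x)
        = fderiv_eval d (fsubst d c g) (\<lambda>k. unitv i k + unitv j k) x"
      by (simp add: axis_def if_distrib[of "\<lambda>x. x * _"] cong: if_cong)
    ultimately show ?thesis
      using DERIV_unique[OF fderiv_eval_deriv[of d "fsubst d c g" "unitv i" x "axis j 1"]]
      by (simp only: mv_axis)
  qed
  note * = this
  show ?thesis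
  proof (simp only: vec_eq_iff, intro allI)
    fix i j
    let ?H = "hessian d c (g *v x)"
    have "hessian d (fsubst d c g) x $ i $ j = (\<Sum>l\<in>UNIV. \<Sum>m\<in>UNIV. g $ l $ i * ?H $ l $ m * g $ m $ j)"
      by (simp add: hessian_def * sum_distrib_left mult_ac)
    also have "\<dots> = (\<Sum>m\<in>UNIV. \<Sum>l\<in>UNIV. g $ l $ i * ?H $ l $ m * g $ m $ j)"
      by (rule sum.swap)
    also have "\<dots> = (transpose g ** ?H ** g) $ i $ j"
      by (simp add: matrix_matrix_mult_def transpose_def sum_distrib_right)
    finally show "hessian d (fsubst d c g) x $ i $ j = (transpose g ** ?H ** g) $ i $ j" .
  qed
qed

lemma fderiv_eval_scale:
  "fderiv_eval d c \<beta> (t *s x) = t ^ (d - sum \<beta> UNIV) * fderiv_eval d c \<beta> x"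
proof -
  have "c \<alpha> * (\<Prod>j\<in>UNIV. of_nat ((\<alpha> j choose \<beta> j) * fact (\<beta> j)) * ((t *s x) $ j) ^ (\<alpha> j - \<beta> j))
      = t ^ (d - sum \<beta> UNIV) * (c \<alpha> * (\<Prod>j\<in>UNIV. of_nat ((\<alpha> j choose \<beta> j) * fact (\<beta> j)) * (x $ j) ^ (\<alpha> j - \<beta> j)))"
    if \<alpha>: "\<alpha> \<in> dmonos d" for \<alpha> :: "'a \<Rightarrow> nat"
  proof (cases "\<forall>j. \<beta> j \<le> \<alpha> j")
    case True
    then have "(\<Sum>j\<in>UNIV. \<alpha> j - \<beta> j) = d - sum \<beta> UNIV"
      using \<alpha> by (simp add: sum_subtractf_nat dmonos_def)
    then have "t ^ (d - sum \<beta> UNIV) = (\<Prod>j\<in>UNIV. t ^ (\<alpha> j - \<beta> j))" by (simp flip: power_sum)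
    then show ?thesis by (simp add: power_mult_distrib prod.distrib mult_ac)
  next
    case False
    \<comment> \<open>Terms not divisible by the monomial of \<beta> are killed by a vanishing
      binomial, so the exponent of t does not matter for them.\<close>
    then obtain j where "\<alpha> j < \<beta> j" by (auto simp: not_le)
    then have "of_nat ((\<alpha> j choose \<beta> j) * fact (\<beta> j)) = (0::complex)" by (simp add: binomial_eq_0)
    then have "(\<Prod>j\<in>UNIV. of_nat ((\<alpha> j choose \<beta> j) * fact (\<beta> j)) * z j) = 0" for z :: "'a \<Rightarrow> complex"
      by (intro prod_zero) auto
    then show ?thesis by (simp only: mult_zero_right)
  qed
  then show ?thesis unfolding fderiv_eval_def sum_distrib_left by (intro sum.cong refl) auto
qed

text \<open>Differentiate f((1+t)x) = (1+t)^d f(x) at t = 0.\<close>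

lemma euler:
  "of_nat d * feval d c x = (\<Sum>i\<in>UNIV. x $ i * fderiv_eval d c (unitv i) x)"
proof -
  have "((\<lambda>t. feval d c (x + t *s x)) has_field_derivative
     (\<Sum>i\<in>UNIV. x $ i * fderiv_eval d c (unitv i) x)) (at 0)" by (rule feval_deriv)
  moreover have "(\<lambda>t. feval d c (x + t *s x)) = (\<lambda>t. (1 + t) ^ d * feval d c x)"
  proof
    fix t
    have "x + t *s x = (1 + t) *s x" by (simp add: vec_eq_iff algebra_simps)
    then show "feval d c (x + t *s x) = (1 + t) ^ d * feval d c x"
      by (simp only: feval_fderiv fderiv_eval_scale) simp
  qed
  moreover have "((\<lambda>t. (1 + t) ^ d * feval d c x) has_field_derivative of_nat d * feval d c x) (at 0)"
    by (auto intro!: derivative_eq_intros)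
  ultimately show ?thesis using DERIV_unique by metis
qed

lemma sing_pts_fsubst:
  assumes "invertible g"
  shows "x \<in> sing_pts d (fsubst d c g) \<longleftrightarrow> g *v x \<in> sing_pts d c"
proof -
  obtain h where h: "g ** h = mat 1" "h ** g = mat 1" using assms by (auto simp: invertible_def)
  have inv: "fsubst d (fsubst d c g) h = fsubst d c (mat 1)" by (simp add: fsubst_fsubst h)
  have x: "x \<noteq> 0 \<longleftrightarrow> g *v x \<noteq> 0"
    by (metis h(2) matrix_vector_mul_assoc matrix_vector_mul_lid matrix_vector_mult_0_right)
  have "(\<forall>i. fderiv_eval d (fsubst d c g) (unitv i) x = 0) \<longleftrightarrow> (\<forall>i. fderiv_eval d c (unitv i) (g *v x) = 0)"
  proof -
    \<comment> \<open>The gradient of the new form at x is \<open>transpose g\<close> applied to the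
      old gradient at gx, so the two vanish together.\<close>
    let ?v = "\<chi> l. fderiv_eval d c (unitv l) (g *v x)"
    have "(\<chi> i. fderiv_eval d (fsubst d c g) (unitv i) x) = transpose g *v ?v"
      by (simp add: vec_eq_iff fderiv1_fsubst matrix_vector_mult_def transpose_def)
    moreover have "transpose g *v ?v = 0 \<longleftrightarrow> ?v = 0"
      using h(1) by (metis matrix_vector_mul_assoc matrix_vector_mul_lid matrix_vector_mult_0_right matrix_transpose_mul transpose_mat)
    ultimately show ?thesis by (simp add: vec_eq_iff)
  qed
  then show ?thesis using x by (auto simp: sing_pts_def)
qed

section \<open>Rank of the Hessian under substitution, and nonzero generalised diagonals\<close>

lemma rank_mult_right:
  fixes A :: "complex^'n::finite^'m::finite" and B :: "complex^'n^'n"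
  assumes "invertible B" shows "rank (A ** B) = rank A"
proof -
  have "rows (A ** B) = (\<lambda>v. v v* B) ` rows A"
    by (auto simp: rows_def row_def vec_eq_iff matrix_matrix_mult_def vector_matrix_mult_def image_def mult.commute)
  moreover have "Vector_Spaces.linear (*s) (*s) (\<lambda>v. v v* B)"
    by unfold_locales (auto simp: vector_matrix_mult_def vec_eq_iff algebra_simps sum.distrib sum_distrib_left)
  moreover have "inj (\<lambda>v. v v* B)"
  proof (rule injI)
    fix v w assume eq: "v v* B = w v* B"
    obtain B' where B': "B ** B' = mat 1" using assms by (auto simp: invertible_def)
    have "v v* B v* B' = w v* B v* B'" using eq by simp
    then show "v = w" by (simp add: vector_matrix_mul_assoc B')
  qed
  ultimately show ?thesis unfolding row_rank_def_gen by (simp add: vec.dim_image_eq inj_on_subset)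
qed

lemma span_rows_mult: "vec.span (rows (P ** A)) \<subseteq> vec.span (rows A)"
  for A :: "complex^'n::finite^'m::finite" and P :: "complex^'m^'m"
proof (rule vec.span_minimal)
  show "rows (P ** A) \<subseteq> vec.span (rows A)"
  proof
    fix v assume "v \<in> rows (P ** A)"
    then obtain i where "v = row i (P ** A)" by (auto simp: rows_def)
    then have "v = (\<Sum>k\<in>UNIV. P $ i $ k *s row k A)"
      by (simp add: vec_eq_iff row_def matrix_matrix_mult_def)
    moreover have "row k A \<in> rows A" for k by (auto simp: rows_def)
    ultimately show "v \<in> vec.span (rows A)"
      by (metis (no_types, lifting) vec.span_base vec.span_scale vec.span_sum)
  qed
qed simp

lemma rank_mult_left:
  fixes A :: "complex^'n::finite^'m::finite" and P :: "complex^'m^'m"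
  assumes "invertible P" shows "rank (P ** A) = rank A"
proof -
  obtain P' where "P' ** P = mat 1" using assms by (auto simp: invertible_def)
  then have "P' ** (P ** A) = A" by (simp add: matrix_mul_assoc)
  then have "vec.span (rows (P ** A)) = vec.span (rows A)"
    using span_rows_mult[of P A] span_rows_mult[of P' "P ** A"] by auto
  then show ?thesis unfolding row_rank_def_gen by (metis vec.dim_span)
qed

lemma rank_hessian_fsubst:
  assumes "invertible g"
  shows "rank (hessian d (fsubst d c g) x) = rank (hessian d c (g *v x))"
proof -
  have "invertible (transpose g)" using assms by (simp add: invertible_det_nz det_transpose)
  then show ?thesis unfolding hessian_fsubst using assms by (simp add: rank_mult_left rank_mult_right)
qed

text \<open>Completing a maximal independent set of rows to a basis gives an invertible matrix, whose
  Leibniz expansion has a nonzero term.\<close>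
lemma rank_generalized_diagonal:
  fixes A :: "complex^'n::finite^'n"
  obtains I p where "card I = rank A" "p permutes (UNIV :: 'n set)" "\<And>i. i \<in> I \<Longrightarrow> A $ i $ p i \<noteq> 0"
proof -
  obtain B where B: "B \<subseteq> rows A" "vec.independent B" "card B = rank A"
    using vec.basis_exists[of "rows A"] unfolding row_rank_def_gen by metis
  have "\<forall>b\<in>B. \<exists>i. row i A = b" using B(1) by (auto simp: rows_def)
  then obtain \<rho> where \<rho>: "\<And>b. b \<in> B \<Longrightarrow> row (\<rho> b) A = b" by metis
  define I where "I = \<rho> ` B"
  have inj: "inj_on \<rho> B" using \<rho> by (metis inj_onI)
  have cI: "card I = rank A" using B(3) by (simp add: I_def card_image inj)
  have rowI: "(\<lambda>i. row i A) ` I = B" using \<rho> by (force simp: I_def)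
  obtain B' where B': "B \<subseteq> B'" "vec.independent B'" "UNIV \<subseteq> vec.span B'"
    using vec.maximal_independent_subset_extend[of B UNIV] B(2) by auto
  have "card B' = CARD('n)"
    using vec.basis_card_eq_dim[of B' UNIV] B' by (simp add: card_cart_basis)
  moreover have "finite B'" using B'(2) by (rule vec.finiteI_independent)
  ultimately have "card (B' - B) = CARD('n) - card I"
    using B'(1) B(3) cI by (metis card_Diff_subset finite_subset)
  also have "\<dots> = card (- I)" by (simp add: Compl_eq_Diff_UNIV card_Diff_subset)
  finally obtain \<phi> where \<phi>: "bij_betw \<phi> (- I) (B' - B)"
    using finite_same_card_bij[of "- I" "B' - B"] \<open>finite B'\<close> by auto
  define M where "M = (\<chi> i. if i \<in> I then row i A else \<phi> i)"
  have "B' \<subseteq> rows M"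
  proof
    fix b assume b: "b \<in> B'"
    show "b \<in> rows M"
    proof (cases "b \<in> B")
      case True
      then obtain i where "i \<in> I" "row i A = b" using rowI by auto
      then have "row i M = b" by (simp add: M_def row_def vec_eq_iff)
      then show ?thesis by (auto simp: rows_def)
    next
      case False
      then obtain i where "i \<notin> I" "\<phi> i = b" using \<phi> b by (force simp: bij_betw_def)
      then have "row i M = b" by (simp add: M_def row_def vec_eq_iff)
      then show ?thesis by (auto simp: rows_def)
    qed
  qed
  then have "vec.span (rows M) = UNIV" using B'(3) vec.span_mono by blast
  then have "invertible M"
    using matrix_left_invertible_span_rows_gen[of M] invertible_left_inverse by blast
  then have "det M \<noteq> 0" by (simp add: invertible_det_nz)
  then obtain p where p: "p permutes (UNIV::'n set)" "of_int (sign p) * (\<Prod>i\<in>UNIV. M $ i $ p i) \<noteq> 0"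
    unfolding det_def by (metis (no_types, lifting) mem_Collect_eq sum.neutral)
  then have "M $ i $ p i \<noteq> 0" for i by (auto simp: prod_zero_iff)
  then have "A $ i $ p i \<noteq> 0" if "i \<in> I" for i 
  proof -
    have "M $ i $ p i = A $ i $ p i" using that by (simp add: M_def row_def)
    then show ?thesis using \<open>M $ i $ p i \<noteq> 0\<close> by simp
  qed
  then show ?thesis using that cI p(1) by blast
qed

section \<open>Nullstellensatz\<close>

text \<open>Polynomials are modelled as functions, which is faithful over an infinite field; this
  vector space carries the dimension counts.\<close>

interpretation cfun: vector_space "\<lambda>(c::complex) (f::'a \<Rightarrow> complex) x. c * f x"
  by unfold_locales (auto simp: fun_eq_iff algebra_simps)

text \<open>The same functions as \<open>PF D\<close>, but given as a span, which suits span
  induction and dimension bounds.\<close>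

definition homog :: "nat \<Rightarrow> (complex^'n::finite \<Rightarrow> complex) set" where
  "homog D = cfun.span (mon ` dmonos D)"

definition pdeg :: "nat \<Rightarrow> (complex^'n::finite \<Rightarrow> complex) set" where
  "pdeg D = cfun.span (mon ` {\<alpha>. sum \<alpha> UNIV \<le> D})"

inductive_set pring :: "(complex^'n::finite \<Rightarrow> complex) set" where
  const: "(\<lambda>_. k) \<in> pring"
| coord: "(\<lambda>x. x $ i) \<in> pring"
| add: "f \<in> pring \<Longrightarrow> g \<in> pring \<Longrightarrow> f + g \<in> pring"
| mult: "f \<in> pring \<Longrightarrow> g \<in> pring \<Longrightarrow> f * g \<in> pring"

lemma pring_scale: "f \<in> pring \<Longrightarrow> (\<lambda>x. k * f x) \<in> pring"
  using pring.mult[OF pring.const[of k], of f] by (simp add: times_fun_def)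

lemma pring_diff: "f \<in> pring \<Longrightarrow> g \<in> pring \<Longrightarrow> f - g \<in> pring"
  using pring.add[OF _ pring_scale[of g "-1"], of f] by (simp add: fun_diff_def plus_fun_def)

lemma pring_sum: "(\<And>a. a \<in> A \<Longrightarrow> F a \<in> pring) \<Longrightarrow> sum F A \<in> pring"
  by (induction A rule: infinite_finite_induct)
     (auto simp: pring.add zero_fun_def intro: pring.const)

lemma pring_prod: "(\<And>a. a \<in> A \<Longrightarrow> F a \<in> pring) \<Longrightarrow> prod F A \<in> pring"
  by (induction A rule: infinite_finite_induct)
     (auto simp: pring.mult one_fun_def intro: pring.const)

lemma pring_power: "f \<in> pring \<Longrightarrow> f ^ m \<in> pring"
  by (induction m) (auto simp: pring.mult one_fun_def intro: pring.const)

lemma prod_fun_apply: "prod F A x = (\<Prod>a\<in>A. (F a x :: complex))"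
  by (induction A rule: infinite_finite_induct) auto

lemma sum_fun_apply: "sum F A x = (\<Sum>a\<in>A. (F a x :: complex))"
  by (induction A rule: infinite_finite_induct) auto

lemma power_fun_apply: "(f ^ m) x = (f x :: complex) ^ m"
  by (induction m) auto

lemma mon_pring: "mon \<alpha> \<in> pring"
proof -
  have "mon \<alpha> = (\<Prod>j\<in>UNIV. (\<lambda>x. x $ j) ^ \<alpha> j)"
    by (simp add: fun_eq_iff mon_def prod_fun_apply power_fun_apply)
  then show ?thesis by (auto intro: pring_prod pring_power pring.coord)
qed

lemma span_pring: "S \<subseteq> pring \<Longrightarrow> cfun.span S \<subseteq> pring"
proof (rule cfun.span_minimal)
  show "cfun.subspace (pring :: (complex^'a \<Rightarrow> complex) set)"
    unfolding cfun.subspace_def using pring.add pring_scale pring.const[of 0]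
    by (auto simp: zero_fun_def)
qed

text \<open>By bilinearity it suffices to multiply generators: the second factor is extended to its
  span first, then the first factor.\<close>

lemma span_mult:
  assumes f: "f \<in> cfun.span A" and g: "g \<in> cfun.span B"
    and AB: "\<And>a b. a \<in> A \<Longrightarrow> b \<in> B \<Longrightarrow> a * b \<in> cfun.span C"
  shows "f * g \<in> cfun.span C"
proof -
  have 1: "a * g \<in> cfun.span C" if "a \<in> A" for a
    using g
  proof (induction g rule: cfun.span_induct)
    case base
    have "a * (x + y) \<in> cfun.span C" if "a * x \<in> cfun.span C" "a * y \<in> cfun.span C" for x y
      using cfun.span_add[OF that] by (simp add: distrib_left)
    moreover have "a * (\<lambda>t. k * x t) \<in> cfun.span C" if "a * x \<in> cfun.span C" for x k
      using cfun.span_scale[OF that, of k] by (simp add: times_fun_def mult_ac)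
    moreover have "a * 0 \<in> cfun.span C" using cfun.span_zero by simp
    ultimately show ?case unfolding cfun.subspace_def by auto
  next
    case (step x)
    show ?case using AB[OF that step] .
  qed
  show ?thesis using f
  proof (induction f rule: cfun.span_induct)
    case base
    have "(x + y) * g \<in> cfun.span C" if "x * g \<in> cfun.span C" "y * g \<in> cfun.span C" for x y
      using cfun.span_add[OF that] by (simp add: distrib_right)
    moreover have "(\<lambda>t. k * x t) * g \<in> cfun.span C" if "x * g \<in> cfun.span C" for x k
      using cfun.span_scale[OF that, of k] by (simp add: times_fun_def mult_ac)
    moreover have "0 * g \<in> cfun.span C" using cfun.span_zero by simp
    ultimately show ?case unfolding cfun.subspace_def by auto
  next
    case (step x)
    show ?case using 1[OF step] .
  qed
qed

lemma mon_times: "mon \<alpha> * mon \<beta> = mon (\<lambda>j. \<alpha> j + \<beta> j)"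
  by (simp add: fun_eq_iff mon_add)

lemma pdeg_mult: "f \<in> pdeg D \<Longrightarrow> g \<in> pdeg D' \<Longrightarrow> f * g \<in> pdeg (D + D')"
  unfolding pdeg_def
  by (erule (1) span_mult)
     (auto simp: mon_times sum.distrib intro!: cfun.span_base imageI add_mono)

lemma homog_mult: "f \<in> homog D \<Longrightarrow> g \<in> homog D' \<Longrightarrow> f * g \<in> homog (D + D')"
  unfolding homog_def
  by (erule (1) span_mult)
     (auto simp: mon_times dmonos_def sum.distrib intro!: cfun.span_base imageI add_mono)

lemma pdeg_mono: "D \<le> D' \<Longrightarrow> pdeg D \<subseteq> pdeg D'"
  unfolding pdeg_def by (intro cfun.span_mono) auto

lemma pring_pdeg: "f \<in> pring \<Longrightarrow> \<exists>D. f \<in> pdeg D"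
proof (induction rule: pring.induct)
  case (const k)
  have "(\<lambda>x. k * mon (\<lambda>_. 0) x) \<in> pdeg 0"
    unfolding pdeg_def by (intro cfun.span_scale cfun.span_base) auto
  then show ?case by (auto simp: mon_def)
next
  case (coord i)
  have "mon (unitv i) \<in> pdeg 1"
    unfolding pdeg_def by (intro cfun.span_base) (auto simp: sum_unitv)
  then show ?case by (auto simp: mon_unitv[abs_def])
next
  case (add f g)
  then obtain D D' where "f \<in> pdeg D" "g \<in> pdeg D'" by auto
  then have "f \<in> pdeg (max D D')" "g \<in> pdeg (max D D')"
    using pdeg_mono[of D "max D D'"] pdeg_mono[of D' "max D D'"] by auto
  then show ?case unfolding pdeg_def using cfun.span_add by blast
next
  case (mult f g)
  then show ?case using pdeg_mult by blast
qed

section \<open>Maximal ideals and the weak Nullstellensatz\<close>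

definition is_ideal :: "(complex^'n::finite \<Rightarrow> complex) set \<Rightarrow> bool" where
  "is_ideal J \<longleftrightarrow> J \<subseteq> pring \<and> 0 \<in> J \<and> (\<forall>f\<in>J. \<forall>g\<in>J. f + g \<in> J) \<and> (\<forall>f\<in>pring. \<forall>g\<in>J. f * g \<in> J)"

lemma ideal_diff: "is_ideal J \<Longrightarrow> f \<in> J \<Longrightarrow> g \<in> J \<Longrightarrow> f - g \<in> J"
proof -
  assume J: "is_ideal J" "f \<in> J" "g \<in> J"
  then have "(\<lambda>_. -1) * g \<in> J" using pring.const[of "-1"] unfolding is_ideal_def by blast
  then have "f + (\<lambda>_. -1) * g \<in> J" using J unfolding is_ideal_def by blast
  moreover have "f + (\<lambda>_. -1) * g = f - g" by (simp add: fun_eq_iff)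
  ultimately show ?thesis by simp
qed

lemma ideal_sum: "is_ideal J \<Longrightarrow> (\<And>a. a \<in> A \<Longrightarrow> F a \<in> J) \<Longrightarrow> sum F A \<in> J"
  by (induction A rule: infinite_finite_induct) (auto simp: is_ideal_def)

lemma maximal_ideal_exists:
  assumes J: "is_ideal J" "1 \<notin> J"
  obtains M where "is_ideal M" "1 \<notin> M" "J \<subseteq> M"
    "\<And>N. is_ideal N \<Longrightarrow> 1 \<notin> N \<Longrightarrow> M \<subseteq> N \<Longrightarrow> N = M"
proof -
  let ?S = "{M. is_ideal M \<and> 1 \<notin> M \<and> J \<subseteq> M}"
  have "\<exists>M\<in>?S. \<forall>X\<in>?S. M \<subseteq> X \<longrightarrow> X = M"
  proof (rule subset_Zorn_nonempty)
    show "?S \<noteq> {}" using J by auto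
    fix C assume C: "C \<noteq> {}" "subset.chain ?S C"
    then have CS: "C \<subseteq> ?S" by (auto simp: subset.chain_def)
    have tot: "X \<subseteq> Y \<or> Y \<subseteq> X" if "X \<in> C" "Y \<in> C" for X Y
      using C(2) that by (auto simp: subset.chain_def)
    have "f + g \<in> \<Union>C" if fg: "f \<in> \<Union>C" "g \<in> \<Union>C" for f g
    proof -
      obtain X Y where XY: "X \<in> C" "f \<in> X" "Y \<in> C" "g \<in> Y" using fg by auto
      then obtain Z where "Z \<in> C" "f \<in> Z" "g \<in> Z" using tot[of X Y] by blast
      then have "f + g \<in> Z" using CS unfolding is_ideal_def by fast
      then show ?thesis using \<open>Z \<in> C\<close> by blast
    qed
    moreover have "\<Union>C \<subseteq> pring" "0 \<in> \<Union>C" "1 \<notin> \<Union>C" "J \<subseteq> \<Union>C"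
      using CS C(1) by (auto simp: is_ideal_def)
    moreover have "f * g \<in> \<Union>C" if "f \<in> pring" "g \<in> \<Union>C" for f g
      using CS that unfolding is_ideal_def by fast
    ultimately show "\<Union>C \<in> ?S" by (simp add: is_ideal_def)
  qed
  then obtain M where M: "M \<in> ?S" and max: "\<forall>X\<in>?S. M \<subseteq> X \<longrightarrow> X = M" by (rule bexE)
  show ?thesis
  proof (rule that)
    show "N = M" if "is_ideal N" "1 \<notin> N" "M \<subseteq> N" for N
      using max[rule_format, of N] M that by auto
  qed (use M in auto)
qed

text \<open>The quotient by M is a field: the ideal generated by M and f is strictly larger than M,
  hence contains 1.\<close>

lemma maximal_ideal_inverse:
  fixes M :: "(complex^'n::finite \<Rightarrow> complex) set"
  assumes M: "is_ideal M" "1 \<notin> M"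
    and max: "\<And>N. is_ideal N \<Longrightarrow> 1 \<notin> N \<Longrightarrow> M \<subseteq> N \<Longrightarrow> N = M"
    and f: "f \<in> pring" "f \<notin> M"
  shows "\<exists>g\<in>pring. 1 - f * g \<in> M"
proof -
  let ?N = "{h. \<exists>g\<in>pring. \<exists>m\<in>M. h = f * g + m}"
  have zero: "0 \<in> pring" using pring.const[of 0] by (simp add: zero_fun_def)
  have one: "1 \<in> pring" using pring.const[of 1] by (simp add: one_fun_def)
  have MN: "M \<subseteq> ?N"
  proof
    fix m assume "m \<in> M"
    moreover have "m = f * 0 + m" by simp
    ultimately show "m \<in> ?N" using zero by blast
  qed
  have "f = f * 1 + 0" by simp
  then have fN: "f \<in> ?N" using one M(1) unfolding is_ideal_def by blast
  have "is_ideal ?N"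
    unfolding is_ideal_def
  proof (intro conjI ballI)
    show "?N \<subseteq> pring" using M(1) f(1) by (auto simp: is_ideal_def intro!: pring.add pring.mult)
    show "0 \<in> ?N" using MN M(1) unfolding is_ideal_def by blast
  next
    fix a b assume "a \<in> ?N" "b \<in> ?N"
    then obtain g m g' m' where "g \<in> pring" "g' \<in> pring" "m \<in> M" "m' \<in> M"
      "a = f * g + m" "b = f * g' + m'" by blast
    then have "a + b = f * (g + g') + (m + m')" "g + g' \<in> pring" "m + m' \<in> M"
      using M(1) by (auto simp: algebra_simps is_ideal_def intro: pring.add)
    then show "a + b \<in> ?N" by blast
  next
    fix a b :: "complex^'n \<Rightarrow> complex" assume a: "a \<in> pring" and "b \<in> ?N"
    then obtain g m where "g \<in> pring" "m \<in> M" "b = f * g + m" by blast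
    then have "a * b = f * (a * g) + a * m" "a * g \<in> pring" "a * m \<in> M"
      using M(1) a by (auto simp: algebra_simps is_ideal_def intro: pring.mult)
    then show "a * b \<in> ?N" by blast
  qed
  then have "1 \<in> ?N" using max[of ?N] MN fN f(2) by blast
  then obtain g m where "g \<in> pring" "m \<in> M" "1 = f * g + m" by blast
  then show ?thesis by (metis add_diff_cancel_left')
qed


lemma pring_minus_const: "(\<lambda>x. x $ i - k) \<in> pring"
  using pring_diff[OF pring.coord[of i] pring.const[of k]] by (simp add: fun_diff_def)

lemma poly_coord_pring: "(\<lambda>x. poly h (x $ i)) \<in> pring"
proof (induction h)
  case 0
  then show ?case using pring.const[of 0] by simp
next
  case (pCons a h)
  have "(\<lambda>x. poly (pCons a h) (x $ i)) = (\<lambda>_. a) + (\<lambda>x. x $ i) * (\<lambda>x. poly h (x $ i))"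
    by (simp add: fun_eq_iff)
  then show ?case using pCons by (simp add: pring.intros)
qed

text \<open>The polynomial h splits over the complex numbers, and the quotient by M is a field, so
  one of its linear factors dies there. The induction removes one root at a time.\<close>

lemma maximal_ideal_linear_factor:
  fixes M :: "(complex^'n::finite \<Rightarrow> complex) set"
  assumes M: "is_ideal M" "1 \<notin> M"
    and max: "\<And>N. is_ideal N \<Longrightarrow> 1 \<notin> N \<Longrightarrow> M \<subseteq> N \<Longrightarrow> N = M"
    and h: "h \<noteq> 0" "(\<lambda>x. poly h (x $ i)) \<in> M"
  shows "\<exists>c. (\<lambda>x. x $ i - c) \<in> M"
  using h
proof (induction "degree h" arbitrary: h rule: less_induct)
  case less
  show ?case
  proof (cases "degree h = 0")
    case True
    then obtain k where k: "h = [:k:]" by (rule degree_eq_zeroE)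
    then have "(\<lambda>_. inverse k) * (\<lambda>x. poly h (x $ i)) \<in> M"
      using less.prems(2) M(1) pring.const[of "inverse k"] unfolding is_ideal_def by blast
    moreover have "(\<lambda>_. inverse k) * (\<lambda>x. poly h (x $ i)) = 1"
      using k less.prems(1) by (simp add: fun_eq_iff)
    ultimately show ?thesis using M(2) by simp
  next
    case False
    then obtain c where "poly h c = 0"
      using fundamental_theorem_of_algebra[of h] by (auto simp: constant_degree)
    then obtain h' where h': "h = [:-c, 1:] * h'" by (auto simp: poly_eq_0_iff_dvd dvd_def)
    let ?y = "\<lambda>x. x $ i - c" and ?h' = "\<lambda>x. poly h' (x $ i)"
    have yh: "?y * ?h' \<in> M"
    proof -
      have "?y * ?h' = (\<lambda>x. poly h (x $ i))" by (simp add: fun_eq_iff h' algebra_simps)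
      then show ?thesis using less.prems(2) by simp
    qed
    show ?thesis
    proof (cases "?y \<in> M")
      case False
      obtain g where g: "g \<in> pring" "1 - ?y * g \<in> M"
        using maximal_ideal_inverse[OF M max pring_minus_const False] by blast
      \<comment> \<open>If x_i - c is invertible modulo M with inverse g, multiplying the product by
        g puts the cofactor into M.\<close>
      have "?h' * (1 - ?y * g) + g * (?y * ?h') \<in> M"
        using g yh M(1) poly_coord_pring[of h' i] unfolding is_ideal_def by blast
      moreover have "?h' * (1 - ?y * g) + g * (?y * ?h') = ?h'"
        by (simp add: algebra_simps)
      moreover have "h' \<noteq> 0" using h' less.prems(1) by auto
      moreover have "degree h' < degree h" unfolding h' using \<open>h' \<noteq> 0\<close> by (subst degree_mult_eq) auto
      ultimately show ?thesis using less.hyps by metis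
    qed blast
  qed
qed

text \<open>An uncountable field leaves no room for transcendental residues: if no $x_i - a$ lay in the
  maximal ideal, the inverses of the $x_i - a$ would be uncountably many vectors in a space of
  countable dimension, and a linear relation among them is an algebraic equation for $x_i$.\<close>
lemma maximal_ideal_coord:
  fixes M :: "(complex^'n::finite \<Rightarrow> complex) set"
  assumes M: "is_ideal M" "1 \<notin> M"
    and max: "\<And>N. is_ideal N \<Longrightarrow> 1 \<notin> N \<Longrightarrow> M \<subseteq> N \<Longrightarrow> N = M"
  shows "\<exists>c. (\<lambda>x. x $ i - c) \<in> M"
proof (rule ccontr)
  assume no: "\<not> ?thesis"
  \<comment> \<open>Real values of a already give uncountably many candidates.\<close>
  define y where "y t = (\<lambda>x::complex^'n. x $ i - complex_of_real t)" for t
  have yring: "y t \<in> pring" for t unfolding y_def by (rule pring_minus_const)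
  have "\<exists>g\<in>pring. 1 - y t * g \<in> M" for t
    using maximal_ideal_inverse[OF M max yring[of t]] no unfolding y_def by blast
  then obtain g where g: "\<And>t. g t \<in> pring" "\<And>t. 1 - y t * g t \<in> M" by metis
  \<comment> \<open>A common inverse of x_i - s and x_i - t would satisfy (s - t) g \<in> M, so it
    would lie in M and not be invertible.\<close>
  have inj: "inj g"
  proof (rule injI, rule ccontr)
    fix s t assume st: "g s = g t" "s \<noteq> t"
    have "(1 - y s * g s) - (1 - y t * g t) \<in> M" by (intro ideal_diff M g)
    moreover have "(1 - y s * g s) - (1 - y t * g t) = (\<lambda>_. of_real (s - t)) * g t"
      unfolding st(1) y_def by (simp add: fun_eq_iff algebra_simps)
    ultimately have "(\<lambda>_. of_real (s - t)) * g t \<in> M" by simp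
    moreover have "y t * (\<lambda>_. inverse (of_real (s - t))) \<in> pring"
      by (intro pring.mult yring pring.const)
    ultimately have "(y t * (\<lambda>_. inverse (of_real (s - t)))) * ((\<lambda>_. of_real (s - t)) * g t) \<in> M"
      using M(1) unfolding is_ideal_def by blast
    moreover have "(y t * (\<lambda>_. inverse (of_real (s - t)))) * ((\<lambda>_. of_real (s - t)) * g t) = y t * g t"
      using st(2) by (simp add: fun_eq_iff)
    ultimately have "1 - y t * g t + y t * g t \<in> M"
      using g(2) M(1) unfolding is_ideal_def by metis
    then show False using M(2) by simp
  qed
  \<comment> \<open>Pigeonhole: uncountably many inverses are spread over countably many degrees, so
    infinitely many of them lie in one finite-dimensional space.\<close>
  obtain D where D: "infinite {t. g t \<in> pdeg D}"
  proof (rule ccontr)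
    assume "\<not> thesis"
    then have "finite {t. g t \<in> pdeg D}" for D using that by blast
    then have "countable (\<Union>D. {t. g t \<in> pdeg D})" by (intro countable_UN) (auto intro: countable_finite)
    moreover have "(\<Union>D. {t. g t \<in> pdeg D}) = UNIV" using pring_pdeg[OF g(1)] by auto
    ultimately show False using uncountable_UNIV_real by simp
  qed
  define B where "B = mon ` {\<alpha>::'n \<Rightarrow> nat. sum \<alpha> UNIV \<le> D}"
  have "\<alpha> j \<le> sum \<alpha> UNIV" for \<alpha> :: "'n \<Rightarrow> nat" and j by (rule member_le_sum) auto
  then have "{\<alpha>::'n \<Rightarrow> nat. sum \<alpha> UNIV \<le> D} \<subseteq> {\<alpha>. \<forall>j. \<alpha> j \<le> D}"
    by (auto intro: order_trans)
  then have finB: "finite B" unfolding B_def using finite_bounded_exps finite_subset by blast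
  obtain A where A: "finite A" "card A = Suc (card B)" "A \<subseteq> {t. g t \<in> pdeg D}"
    using infinite_arbitrarily_large[OF D] by blast
  have "g ` A \<subseteq> cfun.span B" using A(3) unfolding B_def pdeg_def by auto
  moreover have "card (g ` A) = Suc (card B)"
    using A(2) inj by (metis card_image inj_on_subset subset_UNIV)
  ultimately have "cfun.dependent (g ` A)"
    using cfun.independent_span_bound[OF finB] by fastforce
  then obtain u v where u: "v \<in> g ` A" "u v \<noteq> 0" "(\<Sum>v\<in>g ` A. (\<lambda>x. u v * v x)) = 0"
    unfolding cfun.dependent_finite[OF finite_imageI[OF A(1)]] by blast
  define l where "l t = u (g t)" for t
  have l: "(\<Sum>t\<in>A. l t * g t x) = 0" for x
  proof -
    have "(\<Sum>v\<in>g ` A. (\<lambda>x. u v * v x)) x = 0" using u(3) by simp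
    then show ?thesis using inj
      by (simp add: sum_fun_apply l_def sum.reindex inj_on_subset)
  qed
  obtain t0 where t0: "t0 \<in> A" "l t0 \<noteq> 0" using u by (auto simp: l_def)
  \<comment> \<open>The numerator left after clearing denominators in the relation between the
    1/(x_i - t). At \<open>t0\<close> every other summand contains the factor x_i - t0, so h does
    not vanish there.\<close>
  define h where "h = (\<Sum>t\<in>A. smult (l t) (\<Prod>b\<in>A - {t}. [:- of_real b, 1:]))"
  have "poly h (of_real t0) = (\<Sum>t\<in>A. l t * (\<Prod>b\<in>A - {t}. of_real t0 - of_real b))"
    by (simp add: h_def poly_sum poly_prod)
  also have "\<dots> = (\<Sum>t\<in>{t0}. l t * (\<Prod>b\<in>A - {t}. of_real t0 - of_real b))"
    using t0 A(1) by (intro sum.mono_neutral_right) (auto simp: prod_zero_iff)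
  also have "\<dots> \<noteq> 0" using t0 A(1) by (auto simp: prod_zero_iff)
  finally have "h \<noteq> 0" by auto
  moreover have "(\<lambda>x. poly h (x $ i)) \<in> M"
  proof -
    \<comment> \<open>Modulo M each y_t g_t is 1. Written exactly, this sum is h(x_i) minus the
      product of all y_b times the relation, and the relation is 0.\<close>
    have "(\<Sum>t\<in>A. ((\<lambda>_. l t) * (\<Prod>b\<in>A - {t}. y b)) * (1 - y t * g t)) \<in> M"
    proof (rule ideal_sum[OF M(1)])
      fix t assume "t \<in> A"
      have "(\<lambda>_. l t) * (\<Prod>b\<in>A - {t}. y b) \<in> pring"
        by (intro pring.mult pring.const pring_prod yring)
      then show "((\<lambda>_. l t) * (\<Prod>b\<in>A - {t}. y b)) * (1 - y t * g t) \<in> M"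
        using g(2) M(1) unfolding is_ideal_def by blast
    qed
    moreover have "(\<Sum>t\<in>A. ((\<lambda>_. l t) * (\<Prod>b\<in>A - {t}. y b)) * (1 - y t * g t)) x = poly h (x $ i)" for x
    proof -
      have "(\<Sum>t\<in>A. ((\<lambda>_. l t) * (\<Prod>b\<in>A - {t}. y b)) * (1 - y t * g t)) x
          = (\<Sum>t\<in>A. l t * (\<Prod>b\<in>A - {t}. y b x)) - (\<Sum>t\<in>A. l t * ((y t x * (\<Prod>b\<in>A - {t}. y b x)) * g t x))"
        by (simp add: sum_fun_apply prod_fun_apply algebra_simps sum_subtractf)
      also have "(\<Sum>t\<in>A. l t * ((y t x * (\<Prod>b\<in>A - {t}. y b x)) * g t x))
          = (\<Sum>t\<in>A. l t * ((\<Prod>b\<in>A. y b x) * g t x))"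
        by (intro sum.cong refl) (simp add: prod.remove[OF A(1)])
      also have "\<dots> = (\<Prod>b\<in>A. y b x) * (\<Sum>t\<in>A. l t * g t x)"
        by (simp add: sum_distrib_left mult_ac)
      also have "(\<Sum>t\<in>A. l t * (\<Prod>b\<in>A - {t}. y b x)) - (\<Prod>b\<in>A. y b x) * (\<Sum>t\<in>A. l t * g t x)
          = poly h (x $ i)"
        by (simp add: l h_def poly_sum poly_prod y_def)
      finally show ?thesis .
    qed
    ultimately show ?thesis by (metis (no_types, lifting) ext)
  qed
  ultimately show False using maximal_ideal_linear_factor[OF M max] no by blast
qed

text \<open>A maximal ideal above J contains all x_i - c_i, so every polynomial is congruent to its
  value at c. A nonzero value of some f \<in> J would be a unit inside the maximal ideal.\<close>

lemma weak_nullstellensatz: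
  fixes J :: "(complex^'n::finite \<Rightarrow> complex) set"
  assumes "is_ideal J" "1 \<notin> J"
  shows "\<exists>a. \<forall>f\<in>J. f a = 0"
proof -
  obtain M where M: "is_ideal M" "1 \<notin> M" "J \<subseteq> M"
    and max: "\<And>N. is_ideal N \<Longrightarrow> 1 \<notin> N \<Longrightarrow> M \<subseteq> N \<Longrightarrow> N = M"
    using maximal_ideal_exists[OF assms] by blast
  obtain c where c: "\<And>i. (\<lambda>x. x $ i - c i) \<in> M"
    using maximal_ideal_coord[OF M(1,2) max] by metis
  define a where "a = (\<chi> i. c i)"
  have *: "f - (\<lambda>_. f a) \<in> M" if "f \<in> pring" for f
    using that
  proof (induction rule: pring.induct)
    case (const k)
    have "(\<lambda>_. k) - (\<lambda>_. k) = (0 :: complex^'n \<Rightarrow> complex)" by simp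
    moreover have "0 \<in> M" using M(1) by (simp add: is_ideal_def)
    ultimately show ?case by metis
  next
    case (coord i)
    then show ?case using c[of i] by (simp add: a_def fun_diff_def)
  next
    case (add f g)
    have "(f - (\<lambda>_. f a)) + (g - (\<lambda>_. g a)) \<in> M" using add M(1) unfolding is_ideal_def by blast
    moreover have "(f - (\<lambda>_. f a)) + (g - (\<lambda>_. g a)) = f + g - (\<lambda>_. (f + g) a)"
      by (simp add: fun_eq_iff)
    ultimately show ?case by (simp only:)
  next
    case (mult f g)
    have "f * (g - (\<lambda>_. g a)) + (\<lambda>_. g a) * (f - (\<lambda>_. f a)) \<in> M"
      using mult M(1) pring.const[of "g a"] unfolding is_ideal_def by blast
    moreover have "f * (g - (\<lambda>_. g a)) + (\<lambda>_. g a) * (f - (\<lambda>_. f a)) = f * g - (\<lambda>_. (f * g) a)"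
      by (simp add: fun_eq_iff algebra_simps)
    ultimately show ?case by (simp only:)
  qed
  have "f a = 0" if "f \<in> J" for f
  proof (rule ccontr)
    assume fa: "f a \<noteq> 0"
    have fM: "f \<in> M" "f \<in> pring" using that M by (auto simp: is_ideal_def)
    have "f - (f - (\<lambda>_. f a)) \<in> M" by (intro ideal_diff M fM *)
    then have "(\<lambda>_. inverse (f a)) * (\<lambda>_. f a) \<in> M"
      using M(1) pring.const[of "inverse (f a)"] unfolding is_ideal_def by auto
    moreover have "(\<lambda>_. inverse (f a)) * (\<lambda>_. f a) = (1 :: complex^'n \<Rightarrow> complex)"
      using fa by (simp add: fun_eq_iff)
    ultimately show False using M(2) by simp
  qed
  then show ?thesis by blast
qed

section \<open>Common zeros of homogeneous polynomials\<close>

lemma homog_pring: "homog D \<subseteq> pring"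
  unfolding homog_def by (rule span_pring) (auto intro: mon_pring)

lemma mon_scale: "mon \<alpha> (t *s x) = t ^ sum \<alpha> UNIV * mon \<alpha> x"
  by (simp add: mon_def power_mult_distrib prod.distrib power_sum)

lemma homog_scale: "f \<in> homog D \<Longrightarrow> f (t *s x) = t ^ D * f x"
  unfolding homog_def
proof (induction f rule: cfun.span_induct)
  case base
  show ?case unfolding cfun.subspace_def by (auto simp: algebra_simps)
next
  case (step f)
  then show ?case by (auto simp: mon_scale dmonos_def)
qed

lemma homogenize:
  fixes A :: "complex^'n::finite \<Rightarrow> complex"
  assumes "A \<in> pdeg D"
  shows "\<exists>A'\<in>homog D. \<forall>x. x $ i \<noteq> 0 \<longrightarrow> A' x = (x $ i) ^ D * A (inverse (x $ i) *s x)"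
  using assms unfolding pdeg_def
proof (induction A rule: cfun.span_induct)
  case base
  have "\<exists>A'\<in>homog D. \<forall>x. x $ i \<noteq> 0 \<longrightarrow> A' x = (x $ i) ^ D * 0 (inverse (x $ i) *s x)"
    by (rule bexI[of _ 0]) (auto simp: homog_def cfun.span_zero)
  moreover have "\<exists>A'\<in>homog D. \<forall>x. x $ i \<noteq> 0 \<longrightarrow> A' x = (x $ i) ^ D * (f + g) (inverse (x $ i) *s x)"
    if "\<exists>A'\<in>homog D. \<forall>x. x $ i \<noteq> 0 \<longrightarrow> A' x = (x $ i) ^ D * f (inverse (x $ i) *s x)"
      "\<exists>A'\<in>homog D. \<forall>x. x $ i \<noteq> 0 \<longrightarrow> A' x = (x $ i) ^ D * g (inverse (x $ i) *s x)" for f g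
  proof -
    from that obtain f' g' where "f' \<in> homog D" "g' \<in> homog D"
      "\<forall>x. x $ i \<noteq> 0 \<longrightarrow> f' x = (x $ i) ^ D * f (inverse (x $ i) *s x)"
      "\<forall>x. x $ i \<noteq> 0 \<longrightarrow> g' x = (x $ i) ^ D * g (inverse (x $ i) *s x)" by blast
    then show ?thesis
      by (intro bexI[of _ "f' + g'"]) (auto simp: distrib_left homog_def intro: cfun.span_add)
  qed
  moreover have "\<exists>A'\<in>homog D. \<forall>x. x $ i \<noteq> 0 \<longrightarrow> A' x = (x $ i) ^ D * (k * f (inverse (x $ i) *s x))"
    if "\<exists>A'\<in>homog D. \<forall>x. x $ i \<noteq> 0 \<longrightarrow> A' x = (x $ i) ^ D * f (inverse (x $ i) *s x)" for f k
  proof -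
    from that obtain f' where "f' \<in> homog D"
      "\<forall>x. x $ i \<noteq> 0 \<longrightarrow> f' x = (x $ i) ^ D * f (inverse (x $ i) *s x)" by blast
    then show ?thesis
      by (intro bexI[of _ "\<lambda>x. k * f' x"]) (auto simp: homog_def intro: cfun.span_scale)
  qed
  ultimately show ?case unfolding cfun.subspace_def by simp
next
  case (step f)
  then obtain \<alpha> where \<alpha>: "f = mon \<alpha>" "sum \<alpha> UNIV \<le> D" by auto
  \<comment> \<open>The missing degree is filled up with powers of x_i.\<close>
  let ?\<gamma> = "\<lambda>j. \<alpha> j + (D - sum \<alpha> UNIV) * unitv i j"
  have "sum ?\<gamma> UNIV = D"
    using \<alpha>(2) by (simp add: sum.distrib sum_unitv flip: sum_distrib_left)
  then have "mon ?\<gamma> \<in> homog D" unfolding homog_def dmonos_def by (auto intro: cfun.span_base)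
  moreover have "mon ?\<gamma> x = (x $ i) ^ D * mon \<alpha> (inverse (x $ i) *s x)" if "x $ i \<noteq> 0" for x :: "complex^'n"
  proof -
    have "mon ?\<gamma> x = mon \<alpha> x * (\<Prod>j\<in>UNIV. if j = i then (x $ j) ^ (D - sum \<alpha> UNIV) else 1)"
      unfolding mon_add mon_def by (intro arg_cong2[where f="(*)"] prod.cong) (auto simp: unitv_def)
    then have "mon ?\<gamma> x = mon \<alpha> x * (x $ i) ^ (D - sum \<alpha> UNIV)" by simp
    then show ?thesis using that \<alpha>(2)
      by (simp add: mon_scale power_inverse power_diff field_simps)
  qed
  ultimately show ?case using \<alpha>(1) by blast
qed

lemma pdeg_family:
  assumes "finite J" "\<And>j. j \<in> J \<Longrightarrow> A j \<in> pring"
  obtains D where "\<And>j. j \<in> J \<Longrightarrow> A j \<in> pdeg D"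
proof -
  have "\<forall>j\<in>J. \<exists>d. A j \<in> pdeg d" using pring_pdeg assms(2) by blast
  then obtain d where d: "\<And>j. j \<in> J \<Longrightarrow> A j \<in> pdeg (d j)" by metis
  have "A j \<in> pdeg (\<Sum>j\<in>J. d j)" if "j \<in> J" for j
    using d[OF that] pdeg_mono[of "d j" "\<Sum>j\<in>J. d j"] member_le_sum[OF that, of d] assms(1) by auto
  then show ?thesis using that by blast
qed

text \<open>Projective Nullstellensatz with homogeneous cofactors. The forms together with x_i - 1
  have no common zero at all, so 1 is a combination of them; setting x_i = 1 and homogenising gives
  the power of x_i.\<close>

lemma coord_power_in_ideal:
  fixes Q :: "'k \<Rightarrow> complex^'n::finite \<Rightarrow> complex"
  assumes J: "finite J" and Q: "\<And>j. j \<in> J \<Longrightarrow> Q j \<in> homog e"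
    and nz: "\<And>x. x \<noteq> 0 \<Longrightarrow> \<exists>j\<in>J. Q j x \<noteq> 0"
  shows "\<exists>D A. (\<forall>j\<in>J. A j \<in> homog D) \<and> (\<forall>x. (x $ i) ^ (D + e) = (\<Sum>j\<in>J. Q j x * A j x))"
proof -
  let ?y = "\<lambda>x::complex^'n. x $ i - 1"
  define I where "I = {h. \<exists>A B. (\<forall>j\<in>J. A j \<in> pring) \<and> B \<in> pring \<and> h = (\<Sum>j\<in>J. Q j * A j) + ?y * B}"
  have Qr: "Q j \<in> pring" if "j \<in> J" for j using Q[OF that] homog_pring by blast
  have yr: "?y \<in> pring" by (rule pring_minus_const)
  have zero: "0 \<in> pring" using pring.const[of 0] by (simp add: zero_fun_def)
  have one: "1 \<in> pring" using pring.const[of 1] by (simp add: one_fun_def)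
  have II: "(\<Sum>j\<in>J. Q j * A j) + ?y * B \<in> I" if "\<And>j. j \<in> J \<Longrightarrow> A j \<in> pring" "B \<in> pring" for A B
    using that unfolding I_def by blast
  have "is_ideal I"
    unfolding is_ideal_def
  proof (intro conjI ballI)
    show "I \<subseteq> pring"
      unfolding I_def by (auto intro!: pring.add pring.mult pring_sum Qr yr)
    show "0 \<in> I" using II[of "\<lambda>_. 0" 0] zero by simp
  next
    fix f g assume "f \<in> I" "g \<in> I"
    then obtain A B A' B' where *: "\<And>j. j \<in> J \<Longrightarrow> A j \<in> pring" "\<And>j. j \<in> J \<Longrightarrow> A' j \<in> pring"
      "B \<in> pring" "B' \<in> pring" "f = (\<Sum>j\<in>J. Q j * A j) + ?y * B" "g = (\<Sum>j\<in>J. Q j * A' j) + ?y * B'"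
      unfolding I_def by blast
    have "f + g = (\<Sum>j\<in>J. Q j * (A j + A' j)) + ?y * (B + B')"
      unfolding *(5,6) by (simp only: sum.distrib distrib_left) (simp only: add_ac)
    then show "f + g \<in> I" using II[of "\<lambda>j. A j + A' j" "B + B'"] * by (simp add: pring.add)
  next
    fix f g :: "complex^'n \<Rightarrow> complex" assume f: "f \<in> pring" and "g \<in> I"
    then obtain A B where *: "\<And>j. j \<in> J \<Longrightarrow> A j \<in> pring"
      "B \<in> pring" "g = (\<Sum>j\<in>J. Q j * A j) + ?y * B"
      unfolding I_def by blast
    have "f * g = (\<Sum>j\<in>J. Q j * (f * A j)) + ?y * (f * B)"
      unfolding *(3) by (simp only: distrib_left sum_distrib_left) (simp only: mult_ac)
    then show "f * g \<in> I" using II[of "\<lambda>j. f * A j" "f * B"] * f by (simp add: pring.mult)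
  qed
  moreover have "\<not> (\<exists>a. \<forall>f\<in>I. f a = 0)"
  proof
    assume "\<exists>a. \<forall>f\<in>I. f a = 0"
    then obtain a where a: "\<And>f. f \<in> I \<Longrightarrow> f a = 0" by blast
    have "?y a = 0" using a[OF II[of "\<lambda>_. 0" 1]] zero one by simp
    then have "a \<noteq> 0" by auto
    then obtain j where j: "j \<in> J" "Q j a \<noteq> 0" using nz by blast
    have "(\<Sum>k\<in>J. Q k * (if k = j then 1 else 0)) + ?y * 0 \<in> I"
      using one zero by (intro II) auto
    then have "(\<Sum>k\<in>J. Q k a * ((if k = j then 1 else 0) :: complex^'n \<Rightarrow> complex) a) = 0"
      using a by (force simp: sum_fun_apply)
    also have "(\<Sum>k\<in>J. Q k a * ((if k = j then 1 else 0) :: complex^'n \<Rightarrow> complex) a)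
        = (\<Sum>k\<in>J. if k = j then Q k a else 0)"
      by (intro sum.cong) auto
    finally show False using j J by simp
  qed
  ultimately have "1 \<in> I" using weak_nullstellensatz by blast
  then obtain A B where A: "\<And>j. j \<in> J \<Longrightarrow> A j \<in> pring"
      and 1: "1 = (\<Sum>j\<in>J. Q j * A j) + ?y * B" unfolding I_def by blast
  obtain D where "\<And>j. j \<in> J \<Longrightarrow> A j \<in> pdeg D" using pdeg_family[where A=A, OF J A] by blast
  then have "\<forall>j\<in>J. \<exists>A'\<in>homog D. \<forall>x. x $ i \<noteq> 0 \<longrightarrow> A' x = (x $ i) ^ D * A j (inverse (x $ i) *s x)"
    using homogenize by blast
  then obtain A' where A': "\<And>j. j \<in> J \<Longrightarrow> A' j \<in> homog D"
    "\<And>j x. j \<in> J \<Longrightarrow> x $ i \<noteq> 0 \<Longrightarrow> A' j x = (x $ i) ^ D * A j (inverse (x $ i) *s x)" by metis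
  \<comment> \<open>Homogenisation says nothing where x_i = 0. The extra factor x_i makes both sides
    vanish there, at the price of raising the degree D by one.\<close>
  have "mon (unitv i) * A' j \<in> homog (1 + D)" if "j \<in> J" for j
    by (intro homog_mult A'(1) that) (auto simp: homog_def dmonos_def sum_unitv intro!: cfun.span_base)
  moreover have "(x $ i) ^ (1 + D + e) = (\<Sum>j\<in>J. Q j x * (mon (unitv i) * A' j) x)" for x
  proof (cases "x $ i = 0")
    case True
    then show ?thesis by (simp add: mon_unitv)
  next
    case False
    define z where "z = inverse (x $ i) *s x"
    have xz: "x = x $ i *s z" using False by (simp add: z_def vec_eq_iff)
    have "1 = (\<Sum>j\<in>J. Q j z * A j z)"
      using fun_cong[OF 1, of z] False by (simp add: sum_fun_apply z_def)
    then have "(x $ i) ^ (1 + D + e) = (x $ i) ^ (1 + D + e) * (\<Sum>j\<in>J. Q j z * A j z)" by simp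
    also have "\<dots> = (\<Sum>j\<in>J. ((x $ i) ^ e * Q j z) * ((x $ i) * ((x $ i) ^ D * A j z)))"
      by (simp add: sum_distrib_left power_add mult_ac)
    also have "\<dots> = (\<Sum>j\<in>J. Q j x * (mon (unitv i) * A' j) x)"
    proof (intro sum.cong refl)
      fix j assume j: "j \<in> J"
      have "Q j x = (x $ i) ^ e * Q j z" by (subst xz, rule homog_scale[OF Q[OF j]])
      then show "((x $ i) ^ e * Q j z) * ((x $ i) * ((x $ i) ^ D * A j z)) = Q j x * (mon (unitv i) * A' j) x"
        using A'(2)[OF j False] by (simp add: mon_unitv z_def)
    qed
    finally show ?thesis .
  qed
  ultimately show ?thesis by (intro exI[of _ "1 + D"] exI[of _ "\<lambda>j. mon (unitv i) * A' j"]) auto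
qed


text \<open>Finiteness of the polynomial ring over the subring generated by the Q_j. A monomial with
  an exponent above B is divisible by some x_i^(D i + e); replacing that power by its expression in
  the Q_j splits off one Q_j and leaves a cofactor of degree d - e.\<close>

lemma homog_spanned:
  fixes Q :: "'k \<Rightarrow> complex^'n::finite \<Rightarrow> complex"
  assumes J: "finite J" and Q: "\<And>j. j \<in> J \<Longrightarrow> Q j \<in> homog e" and e: "e \<ge> 1"
    and pow: "\<And>i. (\<forall>j\<in>J. A i j \<in> homog (D i)) \<and> (\<forall>x. (x $ i) ^ (D i + e) = (\<Sum>j\<in>J. Q j x * A i j x))"
    and B: "\<And>i. D i + e \<le> B"
  shows "homog d \<subseteq> cfun.span ((\<lambda>(\<beta>, \<alpha>). (\<Prod>j\<in>J. Q j ^ \<beta> j) * mon \<alpha>) `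
     (PiE J (\<lambda>_. {..d}) \<times> {\<alpha>. \<forall>j. \<alpha> j \<le> B}))" (is "_ \<subseteq> cfun.span (?G d)")
proof (induction d rule: less_induct)
  case (less d)
  have "mon \<gamma> \<in> cfun.span (?G d)" if \<gamma>: "sum \<gamma> UNIV = d" for \<gamma> :: "'n \<Rightarrow> nat"
  proof (cases "\<forall>j. \<gamma> j \<le> B")
    case True
    have "mon \<gamma> \<in> ?G d"
      by (rule image_eqI[where x="(restrict (\<lambda>_. 0) J, \<gamma>)"]) (use True in auto)
    then show ?thesis by (rule cfun.span_base)
  next
    case False
    then obtain i where i: "\<gamma> i > B" by (auto simp: not_le)
    define m where "m = D i + e"
    have mi: "m \<le> \<gamma> i" using B[of i] i by (simp add: m_def)
    define \<gamma>' where "\<gamma>' = (\<lambda>j. \<gamma> j - m * unitv i j)"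
    have \<gamma>\<gamma>': "\<gamma> = (\<lambda>j. \<gamma>' j + m * unitv i j)"
      using mi by (auto simp: \<gamma>'_def unitv_def)
    have "sum \<gamma> UNIV = sum \<gamma>' UNIV + m"
      by (subst \<gamma>\<gamma>') (simp add: sum.distrib sum_unitv flip: sum_distrib_left)
    then have s': "sum \<gamma>' UNIV + m = d" using \<gamma> by simp
    have "mon (\<lambda>j. m * unitv i j) x = (x $ i) ^ m" for x :: "complex^'n"
    proof -
      have "mon (\<lambda>j. m * unitv i j) x = (\<Prod>j\<in>UNIV. if j = i then (x $ j) ^ m else 1)"
        unfolding mon_def by (intro prod.cong) (auto simp: unitv_def)
      then show ?thesis by simp
    qed
    then have "mon \<gamma> x = mon \<gamma>' x * (\<Sum>j\<in>J. Q j x * A i j x)" for x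
      using pow[of i] by (subst \<gamma>\<gamma>') (simp add: mon_add m_def)
    then have eq: "mon \<gamma> = (\<Sum>j\<in>J. Q j * (mon \<gamma>' * A i j))"
      by (simp add: fun_eq_iff sum_fun_apply sum_distrib_left mult_ac)
    have de: "d - e < d" using e s' by (simp add: m_def)
    have "Q j * (mon \<gamma>' * A i j) \<in> cfun.span (?G d)" if j: "j \<in> J" for j
    proof -
      have "mon \<gamma>' \<in> homog (sum \<gamma>' UNIV)"
        by (auto simp: homog_def dmonos_def intro!: cfun.span_base)
      then have "mon \<gamma>' * A i j \<in> homog (sum \<gamma>' UNIV + D i)"
        using pow[of i] j by (intro homog_mult) auto
      moreover have "sum \<gamma>' UNIV + D i = d - e" using s' by (simp add: m_def)
      ultimately have h1: "mon \<gamma>' * A i j \<in> cfun.span (?G (d - e))"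
        using less.IH[OF de] by auto
      have h2: "Q j \<in> cfun.span {Q j}" by (rule cfun.span_base) simp
      have h3: "a * b \<in> cfun.span (?G d)" if a: "a \<in> {Q j}" and b: "b \<in> ?G (d - e)" for a b
      proof -
        from b obtain z where z: "z \<in> PiE J (\<lambda>_. {..d - e}) \<times> {\<alpha>. \<forall>j. \<alpha> j \<le> B}"
          and bz: "b = (\<Prod>j\<in>J. Q j ^ fst z j) * mon (snd z)" unfolding split_beta by (rule imageE)
        define \<beta> \<alpha> where "\<beta> = fst z" and "\<alpha> = snd z"
        have \<beta>\<alpha>: "\<beta> \<in> PiE J (\<lambda>_. {..d - e})" "\<forall>j. \<alpha> j \<le> B"
          "b = (\<Prod>j\<in>J. Q j ^ \<beta> j) * mon \<alpha>"
          using z bz by (auto simp: \<beta>_def \<alpha>_def)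
        let ?\<beta> = "\<beta>(j := Suc (\<beta> j))"
        have "(\<Prod>k\<in>J. Q k ^ ?\<beta> k) = Q j ^ Suc (\<beta> j) * (\<Prod>k\<in>J - {j}. Q k ^ \<beta> k)"
          by (subst prod.remove[OF J j]) (auto intro!: arg_cong2[where f="(*)"] prod.cong)
        also have "\<dots> = Q j * (\<Prod>k\<in>J. Q k ^ \<beta> k)"
          unfolding prod.remove[OF J j, of "\<lambda>k. Q k ^ \<beta> k"] by (simp add: mult_ac)
        finally have "a * b = (\<Prod>k\<in>J. Q k ^ ?\<beta> k) * mon \<alpha>" using a \<beta>\<alpha>(3) by (simp add: mult_ac)
        \<comment> \<open>The induction hypothesis gives exponents at most d - e, and e >= 1 leaves
          room for one more factor Q_j.\<close>
        moreover have "?\<beta> \<in> PiE J (\<lambda>_. {..d})"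
          using \<beta>\<alpha>(1) j de e by (fastforce simp: PiE_iff extensional_def)
        ultimately have "a * b \<in> ?G d"
          using \<beta>\<alpha>(2) unfolding split_beta by (intro image_eqI[where x="(?\<beta>, \<alpha>)"]) auto
        then show ?thesis by (rule cfun.span_base)
      qed
      show ?thesis by (rule span_mult[OF h2 h1 h3])
    qed
    then show ?thesis unfolding eq by (rule cfun.span_sum)
  qed
  then show ?case unfolding homog_def dmonos_def by (intro cfun.span_minimal cfun.subspace_span) auto
qed

section \<open>Independence of monomials and the dimension count\<close>

lemma inj_mon: "inj mon"
proof (rule injI)
  fix \<alpha> \<beta> :: "'n::finite \<Rightarrow> nat" assume eq: "mon \<alpha> = mon \<beta>"
  define M where "M = Suc (sum \<alpha> UNIV + sum \<beta> UNIV)"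
  have "\<alpha> j \<le> sum \<alpha> UNIV" "\<beta> j \<le> sum \<beta> UNIV" for j by (auto intro: member_le_sum)
  then have "\<alpha> j < M" "\<beta> j < M" for j unfolding M_def by (metis le_imp_less_Suc trans_le_add1 trans_le_add2)+
  then show "\<alpha> = \<beta>" using coefx_mon[of \<alpha> M \<beta>] coefx_mon[of \<beta> M \<beta>] eq by (metis zero_neq_one)
qed

lemma independent_mon:
  assumes S: "finite S" shows "cfun.independent (mon ` S)"
proof
  assume "cfun.dependent (mon ` S)"
  then obtain u v where u: "v \<in> mon ` S" "u v \<noteq> 0" "(\<Sum>v\<in>mon ` S. (\<lambda>x. u v * v x)) = 0"
    unfolding cfun.dependent_finite[OF finite_imageI[OF S]] by blast
  have inj: "inj_on mon S" using inj_mon by (rule inj_on_subset) simp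
  have 0: "(\<Sum>\<alpha>\<in>S. u (mon \<alpha>) * mon \<alpha> x) = 0" for x
  proof -
    have "(\<Sum>v\<in>mon ` S. (\<lambda>x. u v * v x)) x = 0" using u(3) by simp
    then show ?thesis by (simp add: sum_fun_apply sum.reindex[OF inj])
  qed
  define M where "M = Suc (\<Sum>\<alpha>\<in>S. sum \<alpha> UNIV)"
  have M: "\<alpha> j < M" if "\<alpha> \<in> S" for \<alpha> :: "'a \<Rightarrow> nat" and j
  proof -
    have "\<alpha> j \<le> sum \<alpha> UNIV" by (auto intro: member_le_sum)
    also have "\<dots> \<le> (\<Sum>\<alpha>\<in>S. sum \<alpha> UNIV)" using that S by (intro member_le_sum) auto
    finally show ?thesis by (simp add: M_def)
  qed
  from u(1) obtain \<alpha> where \<alpha>: "\<alpha> \<in> S" "v = mon \<alpha>" by auto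
  have "u (mon \<alpha>) = coefx M (\<lambda>x. \<Sum>\<alpha>\<in>S. u (mon \<alpha>) * mon \<alpha> x) \<alpha>"
    by (subst coefx_lincomb[where M=M, OF S]) (auto simp: M \<alpha>(1))
  also have "\<dots> = 0" unfolding 0 by (simp add: coefx_def)
  finally show False using u(2) \<alpha> by simp
qed

lemma card_bounded_exps: "card {\<alpha> :: 'n::finite \<Rightarrow> nat. \<forall>j. \<alpha> j \<le> d} = (d + 1) ^ CARD('n)"
proof -
  have "{\<alpha> :: 'n \<Rightarrow> nat. \<forall>j. \<alpha> j \<le> d} = PiE UNIV (\<lambda>_. {..d})"
    by (auto simp: PiE_def Pi_def)
  then show ?thesis by (simp add: card_PiE)
qed

text \<open>If the forms had no common zero, Hilbert's Nullstellensatz would make the polynomial ring a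
  finite module over $\mathbb{C}[Q_j]$, which has too few elements of bounded degree.\<close>
theorem common_zero:
  fixes Q :: "'k \<Rightarrow> complex^'n::finite \<Rightarrow> complex"
  assumes J: "finite J" and card: "card J < CARD('n)" and Q: "\<And>j. j \<in> J \<Longrightarrow> Q j \<in> homog e" and e: "e \<ge> 1"
  shows "\<exists>x. x \<noteq> 0 \<and> (\<forall>j\<in>J. Q j x = 0)"
proof (rule ccontr)
  assume "\<not> ?thesis"
  then have nz: "\<And>x. x \<noteq> 0 \<Longrightarrow> \<exists>j\<in>J. Q j x \<noteq> 0" by blast
  have "\<forall>i. \<exists>D A. (\<forall>j\<in>J. A j \<in> homog D) \<and> (\<forall>x. (x $ i) ^ (D + e) = (\<Sum>j\<in>J. Q j x * A j x))"
    using coord_power_in_ideal[OF J Q nz] by blast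
  then obtain D A where DA: "\<And>i. (\<forall>j\<in>J. A i j \<in> homog (D i)) \<and> (\<forall>x. (x $ i) ^ (D i + e) = (\<Sum>j\<in>J. Q j x * A i j x))"
    by metis
  define B where "B = (\<Sum>i\<in>UNIV. D i + e)"
  have B: "D i + e \<le> B" for i unfolding B_def by (rule member_le_sum) auto
  define N where "N = CARD('n)"
  define k where "k = card J"
  define C where "C = (B + 1) ^ N"
  \<comment> \<open>Chosen so that the spanning set has at most (T+1)^k * T elements, just too few
    for the (T+1)^N independent monomials with exponents at most T, as k < N.\<close>
  define T where "T = C * N ^ k"
  define G where "G d = (\<lambda>(\<beta>, \<alpha>). (\<Prod>j\<in>J. Q j ^ \<beta> j) * mon \<alpha>) `
     (PiE J (\<lambda>_. {..d}) \<times> {\<alpha>. \<forall>j. \<alpha> j \<le> B})" for d :: nat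
  have finG: "finite (G d)" for d
    unfolding G_def by (intro finite_imageI finite_cartesian_product finite_PiE finite_bounded_exps J) auto
  have cardG: "card (G d) \<le> (d + 1) ^ k * C" for d
  proof -
    have "card (G d) \<le> card (PiE J (\<lambda>_. {..d}) \<times> {\<alpha> :: 'n \<Rightarrow> nat. \<forall>j. \<alpha> j \<le> B})"
      unfolding G_def by (intro card_image_le finite_cartesian_product finite_PiE finite_bounded_exps J) auto
    also have "\<dots> = (d + 1) ^ k * C"
      using card_bounded_exps[where 'n='n, of B]
      by (simp add: card_cartesian_product card_PiE[OF J] k_def C_def N_def)
    finally show ?thesis .
  qed
  let ?S = "{\<alpha> :: 'n \<Rightarrow> nat. \<forall>j. \<alpha> j \<le> T}"
  have "mon ` ?S \<subseteq> cfun.span (G (N * T))"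
  proof
    fix f assume "f \<in> mon ` ?S"
    then obtain \<alpha> where \<alpha>: "\<forall>j. \<alpha> j \<le> T" "f = mon \<alpha>" by auto
    have "sum \<alpha> UNIV \<le> N * T" using sum_bounded_above[of UNIV \<alpha> T] \<alpha>(1) by (simp add: N_def)
    then have "G (sum \<alpha> UNIV) \<subseteq> G (N * T)"
      unfolding G_def by (intro image_mono Sigma_mono PiE_mono) auto
    moreover have "f \<in> homog (sum \<alpha> UNIV)"
      using \<alpha>(2) by (auto simp: homog_def dmonos_def intro!: cfun.span_base)
    ultimately show "f \<in> cfun.span (G (N * T))"
      using homog_spanned[OF J Q e DA B, of "sum \<alpha> UNIV"] cfun.span_mono unfolding G_def by blast
  qed
  then have "card (mon ` ?S) \<le> card (G (N * T))"
    using cfun.independent_span_bound[OF finG independent_mon[OF finite_bounded_exps]] by blast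
  also have "card (mon ` ?S) = (T + 1) ^ N"
    unfolding N_def card_bounded_exps[symmetric]
    by (rule card_image) (rule inj_on_subset[OF inj_mon], simp)
  also note cardG[of "N * T"]
  also have "(N * T + 1) ^ k * C \<le> (N * (T + 1)) ^ k * C"
    using N_def by (intro mult_right_mono power_mono) auto
  also have "\<dots> = (T + 1) ^ k * (C * N ^ k)" by (simp only: power_mult_distrib mult_ac)
  also have "\<dots> = (T + 1) ^ k * T" by (simp only: T_def)
  also have "\<dots> < (T + 1) ^ k * (T + 1)" by simp
  also have "\<dots> = (T + 1) ^ Suc k" by simp
  also have "\<dots> \<le> (T + 1) ^ N" using card by (intro power_increasing) (auto simp: k_def N_def)
  finally show False by simp
qed

section \<open>Weights and singular points\<close>

text \<open>A nonzero derivative has a nonzero term. Its monomial is \<beta> times factors x_j that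
  do not vanish at x, each of weight at least \<tau>. Order 1 gives the gradient estimate, order 2
  the Hessian estimate.\<close>

lemma fderiv_eval_weight:
  fixes u :: "'n::finite \<Rightarrow> real"
  assumes nz: "fderiv_eval d c \<beta> x \<noteq> 0" and supp: "\<And>i. x $ i \<noteq> 0 \<Longrightarrow> u i \<ge> \<tau>"
  obtains \<alpha> where "\<alpha> \<in> dmonos d" "c \<alpha> \<noteq> 0"
    "(\<Sum>i\<in>UNIV. \<beta> i * u i) + (real d - real (sum \<beta> UNIV)) * \<tau> \<le> (\<Sum>i\<in>UNIV. \<alpha> i * u i)"
proof -
  obtain \<alpha> where \<alpha>: "\<alpha> \<in> dmonos d" "c \<alpha> *
      (\<Prod>j\<in>UNIV. of_nat ((\<alpha> j choose \<beta> j) * fact (\<beta> j)) * (x $ j) ^ (\<alpha> j - \<beta> j)) \<noteq> 0"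
    using nz unfolding fderiv_eval_def by (meson sum.neutral)
  then have c: "c \<alpha> \<noteq> 0" and f: "\<And>j. of_nat ((\<alpha> j choose \<beta> j) * fact (\<beta> j)) * (x $ j) ^ (\<alpha> j - \<beta> j) \<noteq> 0"
    by (auto simp: prod_zero_iff)
  have le: "\<beta> j \<le> \<alpha> j" for j
    using f[of j] by (metis binomial_eq_0 linorder_not_le mult_zero_left of_nat_0)
  have "real (\<alpha> j - \<beta> j) * \<tau> \<le> real (\<alpha> j - \<beta> j) * u j" for j
  proof (cases "\<alpha> j = \<beta> j")
    case False
    then have "x $ j \<noteq> 0" using f[of j] le[of j] by (auto simp: power_0_left)
    then show ?thesis using supp by (intro mult_left_mono) auto
  qed simp
  then have "(\<Sum>j\<in>UNIV. real (\<alpha> j - \<beta> j) * \<tau>) \<le> (\<Sum>j\<in>UNIV. real (\<alpha> j - \<beta> j) * u j)"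
    by (intro sum_mono)
  moreover have "(\<Sum>j\<in>UNIV. real (\<alpha> j - \<beta> j) * \<tau>) = (real d - real (sum \<beta> UNIV)) * \<tau>"
    using \<alpha>(1) le by (simp add: of_nat_diff sum_subtractf dmonos_def flip: sum_distrib_right of_nat_sum)
  moreover have "(\<Sum>j\<in>UNIV. real (\<alpha> j - \<beta> j) * u j) = (\<Sum>i\<in>UNIV. \<alpha> i * u i) - (\<Sum>i\<in>UNIV. \<beta> i * u i)"
    using le by (simp add: of_nat_diff left_diff_distrib sum_subtractf)
  ultimately show ?thesis using that[OF \<alpha>(1) c] by linarith
qed

lemma fderiv_unitv_homog:
  assumes "d \<ge> 1"
  shows "fderiv_eval d c (unitv j) \<in> homog (d - 1)"
proof -
  have "fderiv_eval d c (unitv j) =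
      (\<Sum>\<alpha>\<in>dmonos d. (\<lambda>x. (c \<alpha> * of_nat (\<alpha> j)) * mon (\<lambda>k. \<alpha> k - unitv j k) x))"
  proof
    fix x
    have "(\<Prod>k\<in>UNIV. of_nat ((\<alpha> k choose unitv j k) * fact (unitv j k)) * (x $ k) ^ (\<alpha> k - unitv j k))
        = of_nat (\<alpha> j) * mon (\<lambda>k. \<alpha> k - unitv j k) x" for \<alpha> :: "'a \<Rightarrow> nat"
    proof -
      have "(\<Prod>k\<in>UNIV. of_nat ((\<alpha> k choose unitv j k) * fact (unitv j k))) = (\<Prod>k\<in>UNIV. if k = j then of_nat (\<alpha> k) else (1::complex))"
        by (intro prod.cong) (auto simp: unitv_def)
      then show ?thesis by (simp add: prod.distrib mon_def)
    qed
    then show "fderiv_eval d c (unitv j) x =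
      (\<Sum>\<alpha>\<in>dmonos d. (\<lambda>x. (c \<alpha> * of_nat (\<alpha> j)) * mon (\<lambda>k. \<alpha> k - unitv j k) x)) x"
      unfolding fderiv_eval_def sum_fun_apply by (simp add: mult_ac)
  qed
  also have "\<dots> \<in> homog (d - 1)"
    unfolding homog_def
  proof (rule cfun.span_sum)
    fix \<alpha> :: "'a \<Rightarrow> nat" assume \<alpha>: "\<alpha> \<in> dmonos d"
    show "(\<lambda>x. (c \<alpha> * of_nat (\<alpha> j)) * mon (\<lambda>k. \<alpha> k - unitv j k) x) \<in> cfun.span (mon ` dmonos (d - 1))"
    proof (cases "\<alpha> j = 0")
      case True
      then show ?thesis using cfun.span_zero by (simp add: zero_fun_def)
    next
      case False
      then have "unitv j k \<le> \<alpha> k" for k by (auto simp: unitv_def)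
      then have "(\<Sum>k\<in>UNIV. \<alpha> k - unitv j k) = d - 1"
        using \<alpha> by (simp add: sum_subtractf_nat sum_unitv dmonos_def)
      then show ?thesis by (intro cfun.span_scale cfun.span_base imageI) (simp add: dmonos_def)
    qed
  qed
  finally show ?thesis .
qed

lemma homog_one: "(\<lambda>_. 1) \<in> homog 0"
proof -
  have "(\<lambda>_. 1) = mon (\<lambda>_::'a. 0)" by (simp add: mon_def fun_eq_iff)
  then show ?thesis unfolding homog_def by (auto intro!: cfun.span_base simp: dmonos_def)
qed

lemma homog_power: "f \<in> homog D \<Longrightarrow> f ^ m \<in> homog (m * D)"
  using homog_one by (induction m) (auto simp: one_fun_def intro: homog_mult)

lemma homog_linear: "(\<lambda>x. \<Sum>i\<in>UNIV. l i * x $ i) \<in> homog 1"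
proof -
  have "(\<lambda>x. \<Sum>i\<in>UNIV. l i * x $ i) = (\<Sum>i\<in>UNIV. (\<lambda>x. l i * mon (unitv i) x))"
    by (simp add: fun_eq_iff sum_fun_apply mon_unitv)
  also have "\<dots> \<in> homog 1"
    unfolding homog_def by (intro cfun.span_sum cfun.span_scale cfun.span_base) (auto simp: dmonos_def sum_unitv)
  finally show ?thesis .
qed

lemma homog_coord: "(\<lambda>x. x $ i) \<in> homog 1"
proof -
  have "mon (unitv i) \<in> homog 1"
    unfolding homog_def by (intro cfun.span_base) (auto simp: dmonos_def sum_unitv)
  then show ?thesis by (simp add: mon_unitv[abs_def])
qed

lemma common_zero_supported:
  fixes Q :: "'k \<Rightarrow> complex^'n::finite \<Rightarrow> complex"
  assumes J: "finite J" and card: "card J < card I" and Q: "\<And>j. j \<in> J \<Longrightarrow> Q j \<in> homog e" and e: "e \<ge> 1"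
  shows "\<exists>x. x \<noteq> 0 \<and> (\<forall>i. i \<notin> I \<longrightarrow> x $ i = 0) \<and> (\<forall>j\<in>J. Q j x = 0)"
proof -
  \<comment> \<open>The support condition is imposed by further equations; the coordinates are
    raised to the power e because \<open>common_zero\<close> wants a common degree.\<close>
  define Q' where "Q' = case_sum Q (\<lambda>i. (\<lambda>x::complex^'n. x $ i) ^ e)"
  have "\<exists>x. x \<noteq> 0 \<and> (\<forall>j\<in>Inl ` J \<union> Inr ` (- I). Q' j x = 0)"
  proof (rule common_zero)
    show "finite (Inl ` J \<union> Inr ` (- I))" using J by simp
    have "card (Inl ` J \<union> Inr ` (- I)) = card J + card (- I)"
      using J by (subst card_Un_disjoint) (auto simp: card_image)
    also have "card (- I) = CARD('n) - card I" by (simp add: Compl_eq_Diff_UNIV card_Diff_subset)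
    finally show "card (Inl ` J \<union> Inr ` (- I)) < CARD('n)"
      using card card_mono[of UNIV I] by simp
    show "Q' j \<in> homog e" if "j \<in> Inl ` J \<union> Inr ` (- I)" for j
      using that Q homog_power[OF homog_coord, where m=e] by (auto simp: Q'_def)
  qed (rule e)
  then obtain x where x: "x \<noteq> 0" "\<And>j. j \<in> Inl ` J \<union> Inr ` (- I) \<Longrightarrow> Q' j x = 0" by blast
  have "x $ i = 0" if "i \<notin> I" for i using x(2)[of "Inr i"] that by (simp add: Q'_def power_fun_apply)
  moreover have "Q j x = 0" if "j \<in> J" for j using x(2)[of "Inl j"] that by (simp add: Q'_def)
  ultimately show ?thesis using x(1) by blast
qed

lemma sing_of_gradient:
  assumes "d \<ge> 1" "x \<noteq> 0" "\<And>j. fderiv_eval d c (unitv j) x = 0"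
  shows "x \<in> sing_pts d c"
  using euler[of d c x] assms by (simp add: sing_pts_def)

lemma gradient_zero:
  fixes u :: "'n::finite \<Rightarrow> real"
  assumes w: "\<And>\<alpha>. \<alpha> \<in> dmonos d \<Longrightarrow> c \<alpha> \<noteq> 0 \<Longrightarrow> (\<Sum>i\<in>UNIV. \<alpha> i * u i) \<le> 0"
    and supp: "\<And>i. x $ i \<noteq> 0 \<Longrightarrow> u i \<ge> \<tau>" and j: "\<not> u j \<le> - ((real d - 1) * \<tau>)"
  shows "fderiv_eval d c (unitv j) x = 0"
proof (rule ccontr)
  assume "fderiv_eval d c (unitv j) x \<noteq> 0"
  then obtain \<alpha> where \<alpha>: "\<alpha> \<in> dmonos d" "c \<alpha> \<noteq> 0"
    "(\<Sum>i\<in>UNIV. unitv j i * u i) + (real d - real (sum (unitv j) UNIV)) * \<tau> \<le> (\<Sum>i\<in>UNIV. \<alpha> i * u i)"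
    by (rule fderiv_eval_weight[OF _ supp])
  have "(\<Sum>i\<in>UNIV. real (unitv j i) * u i) = u j"
    by (simp add: unitv_def if_distrib[of real] if_distrib[of "\<lambda>x. x * _"] cong: if_cong)
  then show False using \<alpha>(3) w[OF \<alpha>(1,2)] j by (simp add: sum_unitv)
qed

text \<open>Otherwise the partial derivatives that can be nonzero on the span of the coordinates of
  weight at least \<tau> would be fewer than its dimension. A common zero in that span has zero
  gradient, so it is a singular point excluded by \<open>no\<close>.\<close>

lemma card_superlevel_le_sing:
  fixes u :: "'n::finite \<Rightarrow> real"
  assumes d: "d \<ge> 2" and w: "\<And>\<alpha>. \<alpha> \<in> dmonos d \<Longrightarrow> c \<alpha> \<noteq> 0 \<Longrightarrow> (\<Sum>i\<in>UNIV. \<alpha> i * u i) \<le> 0"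
    and no: "\<And>x. x \<in> sing_pts d c \<Longrightarrow> \<exists>i. x $ i \<noteq> 0 \<and> u i < \<tau>"
  shows "card {i. u i \<ge> \<tau>} \<le> card {j. u j \<le> - ((real d - 1) * \<tau>)}"
proof (rule ccontr)
  assume contr: "\<not> ?thesis"
  have "\<exists>x. x \<noteq> 0 \<and> (\<forall>i. i \<notin> {i. u i \<ge> \<tau>} \<longrightarrow> x $ i = 0) \<and>
      (\<forall>j\<in>{j. u j \<le> - ((real d - 1) * \<tau>)}. fderiv_eval d c (unitv j) x = 0)"
    by (rule common_zero_supported[where e="d - 1"]) (use contr d fderiv_unitv_homog[of d c] in auto)
  then obtain x where x: "x \<noteq> 0" "\<forall>i. i \<notin> {i. u i \<ge> \<tau>} \<longrightarrow> x $ i = 0"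
    "\<forall>j\<in>{j. u j \<le> - ((real d - 1) * \<tau>)}. fderiv_eval d c (unitv j) x = 0" by blast
  have "fderiv_eval d c (unitv j) x = 0" for j
    using gradient_zero[OF w, where x=x and \<tau>=\<tau> and j=j] x by blast
  then have "x \<in> sing_pts d c" using sing_of_gradient[of d x c] x(1) d by simp
  then show False using no x(2) by force
qed

text \<open>Same count with the linear form as an additional equation: a common zero would be a
  singular point on the hyperplane. That equation is the origin of the defect 1.\<close>

lemma card_superlevel_le:
  fixes u :: "'n::finite \<Rightarrow> real"
  assumes d: "d \<ge> 2" and w: "\<And>\<alpha>. \<alpha> \<in> dmonos d \<Longrightarrow> c \<alpha> \<noteq> 0 \<Longrightarrow> (\<Sum>i\<in>UNIV. \<alpha> i * u i) \<le> 0"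
    and l: "\<And>x. x \<in> sing_pts d c \<Longrightarrow> (\<Sum>i\<in>UNIV. l i * x $ i) \<noteq> 0"
  shows "card {i. u i \<ge> \<tau>} \<le> card {j. u j \<le> - ((real d - 1) * \<tau>)} + 1"
proof (rule ccontr)
  assume contr: "\<not> ?thesis"
  let ?N = "{j. u j \<le> - ((real d - 1) * \<tau>)}"
  \<comment> \<open>\<open>None\<close> indexes the added form, raised to the power d - 1 to match
    the degree of the partial derivatives.\<close>
  define Q where "Q = case_option ((\<lambda>x. \<Sum>i\<in>UNIV. l i * x $ i) ^ (d - 1)) (\<lambda>j. fderiv_eval d c (unitv j))"
  have "\<exists>x. x \<noteq> 0 \<and> (\<forall>i. i \<notin> {i. u i \<ge> \<tau>} \<longrightarrow> x $ i = 0) \<and> (\<forall>j\<in>insert None (Some ` ?N). Q j x = 0)"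
  proof (rule common_zero_supported)
    show "card (insert None (Some ` ?N)) < card {i. u i \<ge> \<tau>}"
      using contr by (subst card_insert_disjoint) (auto simp: card_image)
    show "Q j \<in> homog (d - 1)" for j
      using homog_power[OF homog_linear[of l], where m="d - 1"] fderiv_unitv_homog[of d c] d
      by (cases j) (auto simp: Q_def)
  qed (use d in auto)
  then obtain x where x: "x \<noteq> 0" "\<forall>i. i \<notin> {i. u i \<ge> \<tau>} \<longrightarrow> x $ i = 0"
    "\<forall>j\<in>insert None (Some ` ?N). Q j x = 0" by blast
  have "fderiv_eval d c (unitv j) x = 0" if "j \<in> ?N" for j using x(3) that by (force simp: Q_def)
  then have "fderiv_eval d c (unitv j) x = 0" for j
    using gradient_zero[OF w, where x=x and \<tau>=\<tau> and j=j] x(2) by blast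
  then have "x \<in> sing_pts d c" using sing_of_gradient[of d x c] x(1) d by simp
  moreover have "(\<Sum>i\<in>UNIV. l i * x $ i) = 0" using x(3) d by (auto simp: Q_def power_fun_apply)
  ultimately show False using l by blast
qed

section \<open>Comparing weights through the sizes of their superlevel sets\<close>

lemma finite_ex_max:
  fixes f :: "'a \<Rightarrow> real"
  assumes "finite A" "A \<noteq> {}"
  shows "\<exists>i\<in>A. \<forall>k\<in>A. f k \<le> f i"
proof -
  have "Max (f ` A) \<in> f ` A" using assms by (intro Max_in) auto
  then obtain i where "i \<in> A" "f i = Max (f ` A)" by (metis imageE)
  moreover have "f k \<le> Max (f ` A)" if "k \<in> A" for k using assms(1) that by simp
  ultimately show ?thesis by metis
qed

text \<open>Greedy matching: pair the largest p i with some q j at least as large and remove both.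
  Up to level p i both counts drop by exactly one, and above it the left one is already 0.\<close>

lemma sum_le_of_card_superlevel:
  fixes p :: "'a \<Rightarrow> real" and q :: "'b \<Rightarrow> real"
  assumes "finite A" "finite B" "\<And>i. i \<in> A \<Longrightarrow> p i > 0" "\<And>j. j \<in> B \<Longrightarrow> q j \<ge> 0"
    and "\<And>\<tau>. \<tau> > 0 \<Longrightarrow> card {i\<in>A. p i \<ge> \<tau>} \<le> card {j\<in>B. q j \<ge> \<tau>}"
  shows "sum p A \<le> sum q B"
  using assms
proof (induction "card A" arbitrary: A B)
  case 0
  then show ?case by (simp add: sum_nonneg)
next
  case (Suc n)
  then have "A \<noteq> {}" by auto
  then obtain i where i: "i \<in> A" "\<And>k. k \<in> A \<Longrightarrow> p k \<le> p i"
    using finite_ex_max[OF Suc.prems(1), of p] by blast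
  have "i \<in> {k\<in>A. p k \<ge> p i}" using i by simp
  then have "card {k\<in>A. p k \<ge> p i} > 0" using Suc.prems(1) by (subst card_gt_0_iff) auto
  then have "card {j\<in>B. q j \<ge> p i} > 0" using Suc.prems(5)[of "p i"] Suc.prems(3) i(1) by fastforce
  then have "{j\<in>B. q j \<ge> p i} \<noteq> {}" by (metis card.empty less_irrefl)
  then obtain j where j: "j \<in> B" "q j \<ge> p i" by blast
  have "sum p (A - {i}) \<le> sum q (B - {j})"
  proof (rule Suc.hyps(1))
    show "n = card (A - {i})" using Suc.hyps(2) i(1) Suc.prems(1) by simp
    fix \<tau> :: real assume \<tau>: "\<tau> > 0"
    show "card {k\<in>A - {i}. p k \<ge> \<tau>} \<le> card {k\<in>B - {j}. q k \<ge> \<tau>}"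
    proof (cases "\<tau> \<le> p i")
      case True
      have "{k\<in>A - {i}. p k \<ge> \<tau>} = {k\<in>A. p k \<ge> \<tau>} - {i}" "{k\<in>B - {j}. q k \<ge> \<tau>} = {k\<in>B. q k \<ge> \<tau>} - {j}" by auto
      moreover have "i \<in> {k\<in>A. p k \<ge> \<tau>}" "j \<in> {k\<in>B. q k \<ge> \<tau>}" using True i j by auto
      ultimately show ?thesis using Suc.prems(1,2) Suc.prems(5)[OF \<tau>]
        by (simp add: card_Diff_singleton diff_le_mono)
    next
      case False
      then have "{k\<in>A - {i}. p k \<ge> \<tau>} = {}" using i(2) by force
      then show ?thesis by (metis card.empty le0)
    qed
  qed (use Suc.prems in auto)
  moreover have "sum p A = p i + sum p (A - {i})" "sum q B = q j + sum q (B - {j})"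
    using i j Suc.prems(1,2) by (simp_all add: sum.remove)
  ultimately show ?case using j(2) by linarith
qed

text \<open>Let k carry the largest weight below $a$ (if a positive one exists).  Dropping k from the
  positive weights absorbs the defect 1 in the cardinality bound, and comparing superlevel sets gives
  $K (P - u_k) \le P$ for the sum $P$ of the positive weights, whereas $P \ge a + u_k > 2 u_k$.\<close>
lemma superlevel_contradiction:
  fixes u :: "'n::finite \<Rightarrow> real"
  assumes s0: "sum u UNIV = 0" and a: "\<And>i. u i \<le> a" "u e = a" "a > 0" and K: "K \<ge> 2"
    and 1: "\<And>\<tau>. \<tau> > 0 \<Longrightarrow> card {i. u i \<ge> \<tau>} \<le> card {j. u j \<le> - (K * \<tau>)} + 1"
    and 2: "card {i. u i \<ge> a} \<le> card {j. u j \<le> - (K * a)}"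
  shows False
proof -
  define Pos where "Pos = {i. u i > 0}"
  define Neg where "Neg = {i. u i < 0}"
  define P where "P = sum u Pos"
  have "sum u UNIV = sum u Pos + sum u Neg"
  proof -
    have "sum u UNIV = sum u (Pos \<union> Neg)"
      by (intro sum.mono_neutral_right) (auto simp: Pos_def Neg_def)
    also have "\<dots> = sum u Pos + sum u Neg"
      by (rule sum.union_disjoint) (auto simp: Pos_def Neg_def)
    finally show ?thesis .
  qed
  then have neg: "(\<Sum>j\<in>Neg. - u j) = P" using s0 by (simp add: P_def sum_negf)
  have key: "K * sum u A \<le> P" if A: "A \<subseteq> Pos"
    "\<And>\<tau>. \<tau> > 0 \<Longrightarrow> card {i\<in>A. u i \<ge> \<tau>} \<le> card {j. u j \<le> - (K * \<tau>)}" for A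
  proof -
    have "(\<Sum>i\<in>A. K * u i) \<le> (\<Sum>j\<in>Neg. - u j)"
    proof (rule sum_le_of_card_superlevel)
      show "K * u i > 0" if "i \<in> A" for i using that A(1) K by (auto simp: Pos_def)
      fix \<tau> :: real assume \<tau>: "\<tau> > 0"
      have "{i\<in>A. K * u i \<ge> \<tau>} = {i\<in>A. u i \<ge> \<tau> / K}" using K by (auto simp: field_simps)
      moreover have "{j\<in>Neg. - u j \<ge> \<tau>} = {j. u j \<le> - (K * (\<tau> / K))}" using K \<tau> by (auto simp: Neg_def)
      ultimately show "card {i\<in>A. K * u i \<ge> \<tau>} \<le> card {j\<in>Neg. - u j \<ge> \<tau>}"
        using A(2)[of "\<tau> / K"] \<tau> K by simp
    qed (auto simp: Neg_def)
    then show ?thesis using neg by (simp add: sum_distrib_left)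
  qed
  \<comment> \<open>If no weight lies in the gap from \<tau> up to a, the sharper hypothesis at
    level a serves level \<tau> as well, without the defect.\<close>
  have Ka: "card {i. u i \<ge> \<tau>} \<le> card {j. u j \<le> - (K * \<tau>)}" if "\<tau> > 0" "{i. u i \<ge> \<tau>} \<subseteq> {i. u i \<ge> a}" "\<tau> \<le> a" for \<tau>
  proof -
    have "card {i. u i \<ge> \<tau>} \<le> card {i. u i \<ge> a}" using that(2) by (intro card_mono) auto
    also note 2
    also have "card {j. u j \<le> - (K * a)} \<le> card {j. u j \<le> - (K * \<tau>)}"
    proof (intro card_mono subsetI)
      fix j assume "j \<in> {j. u j \<le> - (K * a)}"
      moreover have "K * \<tau> \<le> K * a" using that K by (intro mult_left_mono) auto
      ultimately show "j \<in> {j. u j \<le> - (K * \<tau>)}" by simp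
    qed simp
    finally show ?thesis .
  qed
  have eP: "e \<in> Pos" using a by (simp add: Pos_def)
  have Ppos: "P \<ge> a"
    using member_le_sum[of e Pos u] eP a by (auto simp: P_def Pos_def)
  show False
  proof (cases "\<exists>k\<in>Pos. u k < a")
    case False
    then have all: "\<And>k. k \<in> Pos \<Longrightarrow> u k \<ge> a" by (auto simp: not_less)
    \<comment> \<open>Every positive weight equals a in this case, so the bound at level a alone
      controls all of them.\<close>
    have "K * P \<le> P" unfolding P_def
    proof (rule key[unfolded P_def])
      fix \<tau> :: real assume \<tau>: "\<tau> > 0"
      show "card {i\<in>Pos. u i \<ge> \<tau>} \<le> card {j. u j \<le> - (K * \<tau>)}"
      proof (cases "\<tau> \<le> a")
        case True
        have "{i\<in>Pos. u i \<ge> \<tau>} = {i. u i \<ge> \<tau>}" using \<tau> by (auto simp: Pos_def)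
        moreover have "u i \<ge> a" if "u i \<ge> \<tau>" for i
          using all[of i] that \<tau> by (simp add: Pos_def)
        then have "{i. u i \<ge> \<tau>} \<subseteq> {i. u i \<ge> a}" by blast
        ultimately show ?thesis using Ka[OF \<tau> _ True] by simp
      next
        case False
        have "\<not> u i \<ge> \<tau>" for i using False a(1)[of i] by linarith
          then have "{i\<in>Pos. u i \<ge> \<tau>} = {}" by simp
        then show ?thesis by (metis card.empty le0)
      qed
    qed simp
    moreover have "2 * P \<le> K * P" using K Ppos a by (intro mult_right_mono) auto
    ultimately show False using Ppos a by linarith
  next
    case True
    define R where "R = {k\<in>Pos. u k < a}"
    have "R \<noteq> {}" "finite R" using True by (auto simp: R_def)
    then obtain k where k: "k \<in> R" "\<And>i. i \<in> R \<Longrightarrow> u i \<le> u k"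
      using finite_ex_max[of R u] by blast
    have kP: "k \<in> Pos" "u k < a" "u k > 0" using k(1) by (auto simp: R_def Pos_def)
    have "K * sum u (Pos - {k}) \<le> P"
    proof (rule key)
      fix \<tau> :: real assume \<tau>: "\<tau> > 0"
      show "card {i\<in>Pos - {k}. u i \<ge> \<tau>} \<le> card {j. u j \<le> - (K * \<tau>)}"
      \<comment> \<open>Three ranges: up to u_k the removed index k pays for the defect, between u_k
        and a the gap bound \<open>Ka\<close> applies, and above a the set is empty.\<close>
      proof (cases "\<tau> \<le> u k")
        case True
        have "{i\<in>Pos - {k}. u i \<ge> \<tau>} = {i. u i \<ge> \<tau>} - {k}" using \<tau> by (auto simp: Pos_def)
        moreover have "k \<in> {i. u i \<ge> \<tau>}" using True by simp
        ultimately show ?thesis using 1[OF \<tau>] by (simp add: card_Diff_singleton)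
      next
        case False
        have sub: "{i. u i \<ge> \<tau>} \<subseteq> {i. u i \<ge> a}"
        proof safe
          fix i assume i: "u i \<ge> \<tau>"
          show "u i \<ge> a"
          proof (rule ccontr)
            assume "\<not> u i \<ge> a"
            then have "i \<in> R" using i \<tau> by (simp add: R_def Pos_def)
            then show False using k(2) i False by fastforce
          qed
        qed
        show ?thesis
        proof (cases "\<tau> \<le> a")
          case True
          have "card {i\<in>Pos - {k}. u i \<ge> \<tau>} \<le> card {i. u i \<ge> \<tau>}" by (intro card_mono) auto
          then show ?thesis using Ka[OF \<tau> sub True] by simp
        next
          case False
          have "\<not> u i \<ge> \<tau>" for i using False a(1)[of i] by linarith
          then have "{i\<in>Pos - {k}. u i \<ge> \<tau>} = {}" by simp
          then show ?thesis by (metis card.empty le0)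
        qed
      qed
    qed auto
    moreover have "sum u Pos = u k + sum u (Pos - {k})" using kP by (simp add: sum.remove)
    ultimately have KP: "K * (P - u k) \<le> P" by (simp add: P_def)
    have "e \<in> Pos - {k}" using eP kP a by auto
    then have "u e \<le> sum u (Pos - {k})" by (intro member_le_sum) (auto simp: Pos_def)
    then have Pa: "P - u k \<ge> a" using \<open>sum u Pos = _\<close> a by (simp add: P_def)
    then have "2 * (P - u k) \<le> K * (P - u k)" using K a by (intro mult_right_mono) auto
    then have "2 * (P - u k) \<le> P" using KP by (rule order_trans)
    then have "2 * P - 2 * u k \<le> P" by (simp only: right_diff_distrib)
    then show False using Pa kP(2) by linarith
  qed
qed

text \<open>The two conclusions are the numerical obstructions to failing stability and
  semi-stability. Nonpositive weights on the monomials of the form give the weak inequality,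
  negative ones the strict inequality.\<close>

lemma rank_bound_of_weights:
  fixes u :: "'n::finite \<Rightarrow> real"
  assumes d: "d \<ge> 3" and s0: "sum u UNIV = 0" and unz: "\<exists>i. u i \<noteq> 0"
    and w: "\<And>\<alpha>. \<alpha> \<in> dmonos d \<Longrightarrow> c \<alpha> \<noteq> 0 \<Longrightarrow> (\<Sum>i\<in>UNIV. \<alpha> i * u i) \<le> 0"
    and l: "\<And>x. x \<in> sing_pts d c \<Longrightarrow> (\<Sum>i\<in>UNIV. l i * x $ i) \<noteq> 0"
    and r: "\<And>x. x \<in> sing_pts d c \<Longrightarrow> rank (hessian d c x) \<ge> r" "r > 0"
  shows "d * r \<le> 2 * CARD('n)"
    "(\<And>\<alpha>. \<alpha> \<in> dmonos d \<Longrightarrow> c \<alpha> \<noteq> 0 \<Longrightarrow> (\<Sum>i\<in>UNIV. \<alpha> i * u i) < 0) \<Longrightarrow> d * r < 2 * CARD('n)"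
proof -
  obtain e where e: "\<And>i. u i \<le> u e"
    using finite_ex_max[of "UNIV :: 'n set" u] by auto
  define a where "a = u e"
  have a0: "a > 0"
  proof (rule ccontr)
    assume "\<not> a > 0"
    then have "\<And>i. u i \<le> 0" using e by (force simp: a_def not_less intro: order_trans)
    then have "\<forall>i\<in>UNIV. - u i = 0" using s0 by (subst sum_nonneg_eq_0_iff[symmetric]) (auto simp: sum_negf)
    then show False using unz by simp
  qed
  have "\<exists>x\<in>sing_pts d c. \<forall>i. x $ i \<noteq> 0 \<longrightarrow> u i \<ge> a"
  proof (rule ccontr)
    assume no: "\<not> ?thesis"
    \<comment> \<open>At level a the assumption itself excludes singular zeros, so no linear form is
      needed and there is no defect. The other levels use \<open>l\<close>, and K is d - 1 >=
      2.\<close>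
    have "card {i. u i \<ge> a} \<le> card {j. u j \<le> - ((real d - 1) * a)}"
      using no d by (intro card_superlevel_le_sing[of d c u] w) (auto simp: not_le)
    then show False
    proof (rule superlevel_contradiction[where e=e, OF s0 _ _ a0, rotated -1])
      show "card {i. u i \<ge> \<tau>} \<le> card {j. u j \<le> - ((real d - 1) * \<tau>)} + 1" for \<tau>
        using d by (intro card_superlevel_le[of d c u l] w l) auto
    qed (use e d in \<open>auto simp: a_def\<close>)
  qed
  then obtain x where x: "x \<in> sing_pts d c" "\<And>i. x $ i \<noteq> 0 \<Longrightarrow> u i \<ge> a" by blast
  obtain I p where Ip: "card I = rank (hessian d c x)" "p permutes (UNIV :: 'n set)"
    "\<And>i. i \<in> I \<Longrightarrow> hessian d c x $ i $ p i \<noteq> 0" by (rule rank_generalized_diagonal[of "hessian d c x"]) blast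
  have entry: "\<exists>\<alpha>\<in>dmonos d. c \<alpha> \<noteq> 0 \<and> u i + u j + (real d - 2) * a \<le> (\<Sum>i\<in>UNIV. \<alpha> i * u i)"
    if "hessian d c x $ i $ j \<noteq> 0" for i j
  proof -
    have "fderiv_eval d c (\<lambda>k. unitv i k + unitv j k) x \<noteq> 0" using that by (simp add: hessian_def)
    then obtain \<alpha> where \<alpha>: "\<alpha> \<in> dmonos d" "c \<alpha> \<noteq> 0"
      "(\<Sum>k\<in>UNIV. real (unitv i k + unitv j k) * u k) + (real d - real (\<Sum>k\<in>UNIV. unitv i k + unitv j k)) * a
        \<le> (\<Sum>i\<in>UNIV. \<alpha> i * u i)"
      by (rule fderiv_eval_weight[OF _ x(2)])
    have "(\<Sum>k\<in>UNIV. real (unitv j k) * u k) = u j" for j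
      by (simp add: unitv_def if_distrib[of real] if_distrib[of "\<lambda>x. x * _"] cong: if_cong)
    then show ?thesis using \<alpha> by (intro bexI[of _ \<alpha>]) (simp_all add: distrib_right sum.distrib sum_unitv)
  qed
  \<comment> \<open>Distances to the maximal weight: they are nonnegative with sum (n+1)a, and a
    nonzero Hessian entry (i,j) says v_i + v_j >= da. Summing over I and over its image under the
    injective p each uses that total at most once.\<close>
  define v where "v i = a - u i" for i
  have v0: "v i \<ge> 0" for i using e by (simp add: v_def a_def)
  have sv: "sum v UNIV = real CARD('n) * a" using s0 by (simp add: v_def sum_subtractf)
  have "sum v I \<le> sum v UNIV" using v0 by (intro sum_mono2) auto
  moreover have "(\<Sum>i\<in>I. v (p i)) \<le> sum v UNIV"
  proof -
    have "inj_on p I" using Ip(2) by (metis permutes_inj inj_on_subset subset_UNIV)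
    then have "(\<Sum>i\<in>I. v (p i)) = sum v (p ` I)" by (simp add: sum.reindex)
    also have "\<dots> \<le> sum v UNIV" using v0 by (intro sum_mono2) auto
    finally show ?thesis .
  qed
  ultimately have up: "(\<Sum>i\<in>I. v i + v (p i)) \<le> 2 * real CARD('n) * a"
    unfolding sum.distrib sv by linarith
  have cI: "card I \<ge> r" using Ip(1) r(1)[OF x(1)] by simp
  have dr: "real d * real r \<le> real d * real (card I)" using cI by (intro mult_left_mono) auto
  have "v i + v (p i) \<ge> real d * a" if "i \<in> I" for i
    using entry[OF Ip(3)[OF that]] w by (fastforce simp: v_def algebra_simps)
  then have "(\<Sum>i\<in>I. real d * a) \<le> (\<Sum>i\<in>I. v i + v (p i))" by (intro sum_mono)
  then have "real d * real (card I) * a \<le> 2 * real CARD('n) * a" using up by (simp add: mult_ac)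
  then have "real d * real r \<le> 2 * real CARD('n)" using a0 dr by simp
  then show "d * r \<le> 2 * CARD('n)"
    by (metis of_nat_le_iff of_nat_mult of_nat_numeral)
  assume w': "\<And>\<alpha>. \<alpha> \<in> dmonos d \<Longrightarrow> c \<alpha> \<noteq> 0 \<Longrightarrow> (\<Sum>i\<in>UNIV. \<alpha> i * u i) < 0"
  have "v i + v (p i) > real d * a" if "i \<in> I" for i
    using entry[OF Ip(3)[OF that]] w' by (fastforce simp: v_def algebra_simps)
  \<comment> \<open>Strictness survives summation only over a nonempty set, whence the hypothesis r
    > 0.\<close>
  moreover have "I \<noteq> {}" using cI r(2) by auto
  ultimately have "(\<Sum>i\<in>I. real d * a) < (\<Sum>i\<in>I. v i + v (p i))" by (intro sum_strict_mono) auto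
  then have "real d * real (card I) * a < 2 * real CARD('n) * a" using up by (simp add: mult_ac)
  then have "real d * real r < 2 * real CARD('n)" using a0 dr by simp
  then show "d * r < 2 * CARD('n)"
    by (metis of_nat_less_iff of_nat_mult of_nat_numeral)
qed

section \<open>Diagonal decomposition\<close>

text \<open>Bounding the inverse as well makes this a compact set of invertible matrices.\<close>
definition bimat :: "real \<Rightarrow> (complex^'n::finite^'n) set" where
  "bimat M = {k. \<exists>k'. k ** k' = mat 1 \<and> k' ** k = mat 1 \<and>
     (\<forall>i j. norm (k $ i $ j) \<le> M) \<and> (\<forall>i j. norm (k' $ i $ j) \<le> M)}"

lemma matrix_mult_entry_bound:
  fixes A B :: "complex^'n::finite^'n"
  assumes "\<And>i j. norm (A $ i $ j) \<le> M" "\<And>i j. norm (B $ i $ j) \<le> M'"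
  shows "norm ((A ** B) $ i $ j) \<le> real CARD('n) * M * M'"
proof -
  have M: "M \<ge> 0" using assms(1)[of i i] norm_ge_zero order_trans by blast
  have "norm ((A ** B) $ i $ j) \<le> (\<Sum>k\<in>UNIV. norm (A $ i $ k * B $ k $ j))"
    unfolding matrix_matrix_mult_def by (simp add: norm_sum)
  also have "\<dots> \<le> (\<Sum>k\<in>(UNIV::'n set). M * M')"
    unfolding norm_mult using M by (intro sum_mono mult_mono assms) auto
  finally show ?thesis by (simp add: mult_ac)
qed

lemma bimat_mult:
  fixes k l :: "complex^'n::finite^'n"
  assumes "k \<in> bimat M" "l \<in> bimat M'"
  shows "k ** l \<in> bimat (real CARD('n) * M * M')"
proof -
  obtain k' where k: "k ** k' = mat 1" "k' ** k = mat 1" "\<And>i j. norm (k $ i $ j) \<le> M" "\<And>i j. norm (k' $ i $ j) \<le> M"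
    using assms(1) by (auto simp: bimat_def)
  obtain l' where l: "l ** l' = mat 1" "l' ** l = mat 1" "\<And>i j. norm (l $ i $ j) \<le> M'" "\<And>i j. norm (l' $ i $ j) \<le> M'"
    using assms(2) by (auto simp: bimat_def)
  have "k ** l ** (l' ** k') = k ** (l ** l') ** k'" "l' ** k' ** (k ** l) = l' ** (k' ** k) ** l"
    by (simp_all only: matrix_mul_assoc)
  then have "k ** l ** (l' ** k') = mat 1" "l' ** k' ** (k ** l) = mat 1"
    using k l by simp_all
  moreover have "norm ((k ** l) $ i $ j) \<le> real CARD('n) * M * M'" for i j
    using k l by (intro matrix_mult_entry_bound)
  moreover have "norm ((l' ** k') $ i $ j) \<le> real CARD('n) * M * M'" for i j
    using matrix_mult_entry_bound[of l' M' k' M i j] k l by (simp add: mult_ac)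
  ultimately show ?thesis unfolding bimat_def by blast
qed

lemma bimat_inverse: "k \<in> bimat M \<Longrightarrow> \<exists>k'\<in>bimat M. k ** k' = mat 1 \<and> k' ** k = mat 1"
  unfolding bimat_def by blast

lemma bimat_id: "mat 1 \<in> bimat 1"
proof -
  have "norm (mat 1 $ i $ j :: complex) \<le> 1" for i j :: 'a by (simp add: mat_def)
  then show ?thesis unfolding bimat_def by (intro CollectI exI[of _ "mat 1"]) simp
qed

section \<open>Elementary matrices and Gaussian elimination\<close>

definition swap_mat :: "'n \<Rightarrow> 'n \<Rightarrow> complex^'n::finite^'n" where
  "swap_mat p s = (\<chi> i j. if j = Transposition.transpose p s i then 1 else 0)"

lemma swap_mat_left: "(swap_mat p s ** A) $ i $ j = A $ Transposition.transpose p s i $ j"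
  by (simp add: swap_mat_def matrix_matrix_mult_def if_distrib[of "\<lambda>x. x * _"] cong: if_cong)

lemma swap_mat_right: "(A ** swap_mat p s) $ i $ j = A $ i $ Transposition.transpose p s j"
proof -
  have "j = Transposition.transpose p s k \<longleftrightarrow> k = Transposition.transpose p s j" for k
    by (metis transpose_involutory)
  then show ?thesis
    by (simp add: swap_mat_def matrix_matrix_mult_def if_distrib[of "\<lambda>x. _ * x"] cong: if_cong)
qed

lemma swap_mat_bimat: "swap_mat p s \<in> bimat 1"
proof -
  have "swap_mat p s ** swap_mat p s = mat 1"
    unfolding vec_eq_iff swap_mat_left
    by (auto simp: swap_mat_def mat_def)
  then show ?thesis unfolding bimat_def
    by (intro CollectI exI[of _ "swap_mat p s"]) (auto simp: swap_mat_def)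
qed

text \<open>The identity minus v times the row vector e_s. It is used with v_s = 0, when negating v
  gives the inverse, so inverse and matrix obey the same bounds.\<close>

definition elim_mat :: "'n \<Rightarrow> ('n \<Rightarrow> complex) \<Rightarrow> complex^'n::finite^'n" where
  "elim_mat s v = (\<chi> i j. (if i = j then 1 else 0) - (if j = s then v i else 0))"

lemma elim_mat_left: "(elim_mat s v ** A) $ i $ j = A $ i $ j - v i * A $ s $ j"
  by (simp add: elim_mat_def matrix_matrix_mult_def left_diff_distrib sum_subtractf
      if_distrib[of "\<lambda>x. x * _"] cong: if_cong)

lemma elim_mat_right: "(A ** Finite_Cartesian_Product.transpose (elim_mat s v)) $ i $ j = A $ i $ j - A $ i $ s * v j"
  by (simp add: elim_mat_def matrix_matrix_mult_def Finite_Cartesian_Product.transpose_def right_diff_distrib sum_subtractf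
      if_distrib[of "\<lambda>x. _ * x"] cong: if_cong)

lemma elim_mat_bimat:
  assumes v: "v s = 0" "\<And>i. norm (v i) \<le> 1"
  shows "elim_mat s v \<in> bimat 1"
    "Finite_Cartesian_Product.transpose (elim_mat s v) \<in> bimat 1"
proof -
  let ?E = "elim_mat s v" and ?F = "elim_mat s (\<lambda>i. - v i)"
  have 1: "?E ** ?F = mat 1" "?F ** ?E = mat 1"
    unfolding vec_eq_iff elim_mat_left using v(1) by (auto simp: elim_mat_def mat_def)
  have 2: "norm (?E $ i $ j) \<le> 1" "norm (?F $ i $ j) \<le> 1" for i j
    using v by (auto simp: elim_mat_def)
  show "?E \<in> bimat 1" unfolding bimat_def using 1 2 by blast
  have "Finite_Cartesian_Product.transpose ?E ** Finite_Cartesian_Product.transpose ?F = mat 1"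
    "Finite_Cartesian_Product.transpose ?F ** Finite_Cartesian_Product.transpose ?E = mat 1"
    using 1 by (simp_all flip: matrix_transpose_mul)
  then show "Finite_Cartesian_Product.transpose ?E \<in> bimat 1" unfolding bimat_def
    using 2 by (intro CollectI exI[of _ "Finite_Cartesian_Product.transpose ?F"])
      (auto simp: Finite_Cartesian_Product.transpose_def)
qed

text \<open>Moving an entry of maximal modulus to the pivot position keeps all elimination multipliers in
  the unit disc, so the bound does not depend on g.\<close>
lemma complete_pivoting:
  fixes S :: "'n::finite set"
  shows "\<exists>M. \<forall>g::complex^'n^'n. \<exists>k\<in>bimat M. \<exists>l\<in>bimat M.
     \<forall>i j. (i \<in> S \<or> j \<in> S) \<and> i \<noteq> j \<longrightarrow> (k ** g ** l) $ i $ j = 0"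
  using finite[of S]
proof (induction S)
  case empty
  show ?case using bimat_id by auto
next
  case (insert s S)
  then obtain M where M: "\<And>g::complex^'n^'n. \<exists>k\<in>bimat M. \<exists>l\<in>bimat M.
     \<forall>i j. (i \<in> S \<or> j \<in> S) \<and> i \<noteq> j \<longrightarrow> (k ** g ** l) $ i $ j = 0" by blast
  define N where "N = real CARD('n)"
  show ?case
  \<comment> \<open>The swap and the elimination matrix both have bound 1, and each product costs a
    factor N by \<open>bimat_mult\<close>.\<close>
  proof (intro exI[of _ "N * 1 * (N * 1 * M)"] allI)
    fix g :: "complex^'n^'n"
    obtain k l where kl: "k \<in> bimat M" "l \<in> bimat M"
      "\<And>i j. i \<in> S \<or> j \<in> S \<Longrightarrow> i \<noteq> j \<Longrightarrow> (k ** g ** l) $ i $ j = 0" using M[of g] by blast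
    define h where "h = k ** g ** l"
    have fin: "finite ((\<lambda>(i, j). norm (h $ i $ j)) ` ((- S) \<times> (- S)))" (is "finite ?V") by simp
    have "(s, s) \<in> (- S) \<times> (- S)" using insert.hyps(2) by simp
    then have "?V \<noteq> {}" by blast
    then have "Max ?V \<in> ?V" using fin by (rule Max_in[rotated])
    then obtain p q where pq: "p \<notin> S" "q \<notin> S" "norm (h $ p $ q) = Max ?V" by auto
    have max: "norm (h $ i $ j) \<le> norm (h $ p $ q)" if "i \<notin> S" "j \<notin> S" for i j
      unfolding pq(3) using that by (intro Max_ge fin) force
    define h' where "h' = swap_mat p s ** h ** swap_mat q s"
    have h': "h' $ i $ j = h $ Transposition.transpose p s i $ Transposition.transpose q s j" for i j
      by (simp add: h'_def swap_mat_right swap_mat_left)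
    have trS: "Transposition.transpose p s i = i" "Transposition.transpose q s i = i" if "i \<in> S" for i
      using that pq insert.hyps(2) by (metis transpose_apply_other)+
    have trnS: "Transposition.transpose p s i \<notin> S" "Transposition.transpose q s i \<notin> S" if "i \<notin> S" for i
      using that pq insert.hyps(2) by (auto simp: Transposition.transpose_def)
    have h'S: "h' $ i $ j = 0" if "i \<in> S \<or> j \<in> S" "i \<noteq> j" for i j
    proof (cases "i \<in> S")
      case True
      have "i \<noteq> Transposition.transpose q s j" using True that(2) trS(2) by (metis transpose_involutory)
      then show ?thesis using kl(3)[of i "Transposition.transpose q s j"] True trS(1)[of i] by (simp add: h' h_def)
    next
      case False
      then have "j \<in> S" using that by simp
      moreover have "Transposition.transpose p s i \<noteq> j" using \<open>j \<in> S\<close> that(2) trS(1) by (metis transpose_involutory)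
      ultimately show ?thesis using kl(3)[of "Transposition.transpose p s i" j] trS(2)[of j] by (simp add: h' h_def)
    qed
    have h'max: "norm (h' $ i $ j) \<le> norm (h' $ s $ s)" if "i \<notin> S" "j \<notin> S" for i j
      using max[OF trnS(1)[OF that(1)] trnS(2)[OF that(2)]] by (simp add: h')
    \<comment> \<open>If the pivot is 0, the remaining block is 0 by maximality; division by zero
      then gives multiplier 0, and the identities for \<open>v\<close> and \<open>w\<close> still
      hold.\<close>
    define v where "v i = (if i = s then 0 else h' $ i $ s / h' $ s $ s)" for i
    define w where "w j = (if j = s then 0 else h' $ s $ j / h' $ s $ s)" for j
    \<comment> \<open>Maximality speaks only about indices outside S; the entries of row and column
      s with an index in S are 0 already.\<close>
    have hs: "norm (h' $ i $ s) \<le> norm (h' $ s $ s)" "norm (h' $ s $ i) \<le> norm (h' $ s $ s)" for i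
      using h'max[of i s] h'max[of s i] h'S[of i s] h'S[of s i] insert.hyps(2) by (cases "i \<in> S"; cases "i = s"; simp)+
    have v: "v s = 0" "\<And>i. norm (v i) \<le> 1" "\<And>i. i \<noteq> s \<Longrightarrow> v i * h' $ s $ s = h' $ i $ s" "\<And>i. i \<in> S \<Longrightarrow> v i = 0"
      using hs(1) h'S insert.hyps(2) by (auto simp: v_def norm_divide divide_le_eq_1)
    have w: "w s = 0" "\<And>i. norm (w i) \<le> 1" "\<And>i. i \<noteq> s \<Longrightarrow> h' $ s $ s * w i = h' $ s $ i" "\<And>i. i \<in> S \<Longrightarrow> w i = 0"
      using hs(2) h'S insert.hyps(2) by (auto simp: w_def norm_divide divide_le_eq_1)
    define k2 where "k2 = elim_mat s v ** (swap_mat p s ** k)"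
    define l2 where "l2 = (l ** swap_mat q s) ** Finite_Cartesian_Product.transpose (elim_mat s w)"
    have "k2 ** g ** l2 = elim_mat s v ** h' ** Finite_Cartesian_Product.transpose (elim_mat s w)"
      by (simp add: k2_def l2_def h'_def h_def matrix_mul_assoc)
    then have entry: "(k2 ** g ** l2) $ i $ j = (h' $ i $ j - v i * h' $ s $ j) - (h' $ i $ s - v i * h' $ s $ s) * w j" for i j
      by (simp add: elim_mat_right elim_mat_left)
    have "(k2 ** g ** l2) $ i $ j = 0" if ij: "i \<in> insert s S \<or> j \<in> insert s S" "i \<noteq> j" for i j
    proof (cases "i = s")
      case True
      then show ?thesis using entry[of i j] v(1) w(3)[of j] ij by simp
    next
      case False
      then have e: "(k2 ** g ** l2) $ i $ j = h' $ i $ j - v i * h' $ s $ j" using entry[of i j] v(3) by simp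
      show ?thesis
      proof (cases "j = s")
        case True
        then show ?thesis using e v(3) False by simp
      next
        case js: False
        then have "i \<in> S \<or> j \<in> S" using ij False by auto
        then show ?thesis using e h'S[of i j] h'S[of s j] v(4)[of i] js ij by auto
      qed
    qed
    moreover have "k2 \<in> bimat (N * 1 * (N * 1 * M))"
      unfolding k2_def N_def by (intro bimat_mult elim_mat_bimat v swap_mat_bimat kl)
    moreover have "l2 \<in> bimat (N * (N * M * 1) * 1)"
      unfolding l2_def N_def by (intro bimat_mult elim_mat_bimat w swap_mat_bimat kl)
    ultimately show "\<exists>k\<in>bimat (N * 1 * (N * 1 * M)). \<exists>l\<in>bimat (N * 1 * (N * 1 * M)).
       \<forall>i j. (i \<in> insert s S \<or> j \<in> insert s S) \<and> i \<noteq> j \<longrightarrow> (k ** g ** l) $ i $ j = 0"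
      by (intro bexI[of _ k2] bexI[of _ l2]) (auto simp: mult_ac)
  qed
qed

definition diag_mat :: "('n \<Rightarrow> complex) \<Rightarrow> complex^'n::finite^'n" where
  "diag_mat t = (\<chi> i j. if i = j then t i else 0)"

text \<open>Plays the part of the KAK decomposition, with the compact set \<open>bimat M\<close> in
  place of the unitary group.\<close>

lemma diag_decomposition:
  obtains M where "\<And>g :: complex^'n::finite^'n. \<exists>k\<in>bimat M. \<exists>l\<in>bimat M. \<exists>t. g = k ** diag_mat t ** l"
proof -
  obtain M where M: "\<And>g::complex^'n^'n. \<exists>k\<in>bimat M. \<exists>l\<in>bimat M.
     \<forall>i j. (i \<in> UNIV \<or> j \<in> UNIV) \<and> i \<noteq> j \<longrightarrow> (k ** g ** l) $ i $ j = 0"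
    using complete_pivoting[of "UNIV :: 'n set"] by blast
  have "\<exists>k\<in>bimat M. \<exists>l\<in>bimat M. \<exists>t. g = k ** diag_mat t ** l" for g :: "complex^'n^'n"
  proof -
    obtain k l where kl: "k \<in> bimat M" "l \<in> bimat M" "\<And>i j. i \<noteq> j \<Longrightarrow> (k ** g ** l) $ i $ j = 0"
      using M[of g] by blast
    obtain k' where k': "k' \<in> bimat M" "k' ** k = mat 1" using bimat_inverse[OF kl(1)] by blast
    obtain l' where l': "l' \<in> bimat M" "l ** l' = mat 1" using bimat_inverse[OF kl(2)] by blast
    have "k ** g ** l = diag_mat (\<lambda>i. (k ** g ** l) $ i $ i)"
      using kl(3) by (simp add: vec_eq_iff diag_mat_def)
    moreover have "k' ** (k ** g ** l) ** l' = (k' ** k) ** g ** (l ** l')" by (simp only: matrix_mul_assoc)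
    then have "g = k' ** (k ** g ** l) ** l'" using k' l' by simp
    ultimately show ?thesis using k' l' by metis
  qed
  then show ?thesis using that by blast
qed

section \<open>Degeneration of orbits\<close>

lemma tendsto_matrix_mult:
  fixes A B :: "'a \<Rightarrow> complex^'n::finite^'n"
  assumes "(A \<longlongrightarrow> a) F" "(B \<longlongrightarrow> b) F"
  shows "((\<lambda>m. A m ** B m) \<longlongrightarrow> a ** b) F"
  unfolding matrix_matrix_mult_def by (intro tendsto_vec_lambda tendsto_intros assms)

lemma tendsto_det:
  fixes A :: "'a \<Rightarrow> complex^'n::finite^'n"
  assumes "(A \<longlongrightarrow> a) F"
  shows "((\<lambda>m. det (A m)) \<longlongrightarrow> det a) F"
  unfolding det_def by (intro tendsto_intros assms)

lemma norm_matrix_le: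
  fixes A :: "complex^'n::finite^'n"
  assumes "\<And>i j. norm (A $ i $ j) \<le> M"
  shows "norm A \<le> real CARD('n) * (real CARD('n) * M)"
proof -
  have "norm (A $ i) \<le> real CARD('n) * M" for i
  proof -
    have "norm (A $ i) \<le> (\<Sum>j\<in>UNIV. norm (A $ i $ j))" unfolding norm_vec_def by (rule L2_set_le_sum) simp
    also have "\<dots> \<le> (\<Sum>j\<in>(UNIV::'n set). M)" by (intro sum_mono assms)
    finally show ?thesis by simp
  qed
  then have "(\<Sum>i\<in>UNIV. norm (A $ i)) \<le> (\<Sum>i\<in>(UNIV::'n set). real CARD('n) * M)" by (intro sum_mono)
  moreover have "norm A \<le> (\<Sum>i\<in>UNIV. norm (A $ i))" unfolding norm_vec_def[of A] by (rule L2_set_le_sum) simp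
  ultimately show ?thesis by simp
qed

lemma bounded_convergent_subseq:
  fixes X :: "nat \<Rightarrow> 'a::heine_borel"
  assumes "bounded (range X)"
  obtains x \<rho> where "strict_mono (\<rho> :: nat \<Rightarrow> nat)" "(\<lambda>m. X (\<rho> m)) \<longlonglongrightarrow> x"
  using bounded_imp_convergent_subsequence[OF assms] by (auto simp: o_def)

lemma bimat_convergent_subseq:
  fixes k :: "nat \<Rightarrow> complex^'n::finite^'n"
  assumes "\<And>m. k m \<in> bimat M"
  obtains k0 \<rho> where "strict_mono (\<rho> :: nat \<Rightarrow> nat)" "(\<lambda>m. k (\<rho> m)) \<longlonglongrightarrow> k0" "invertible k0"
proof -
  obtain k' where k': "\<And>m. k m ** k' m = mat 1" "\<And>m i j. norm (k m $ i $ j) \<le> M" "\<And>m i j. norm (k' m $ i $ j) \<le> M"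
    using assms unfolding bimat_def by (simp only: mem_Collect_eq) metis
  \<comment> \<open>Passing to the limit with k and its inverse simultaneously makes the limit of k
    invertible.\<close>
  have "bounded (range (\<lambda>m. (k m, k' m)))"
    unfolding bounded_iff
  proof (intro exI ballI)
    let ?B = "real CARD('n) * (real CARD('n) * M)"
    fix x assume "x \<in> range (\<lambda>m. (k m, k' m))"
    then obtain m where "x = (k m, k' m)" by blast
    moreover have "norm (k m, k' m) \<le> norm (k m) + norm (k' m)" by (rule norm_Pair_le)
    ultimately show "norm x \<le> ?B + ?B" using norm_matrix_le[OF k'(2)] norm_matrix_le[OF k'(3)]
      by (smt (verit))
  qed
  then obtain x \<rho> where \<rho>: "strict_mono (\<rho> :: nat \<Rightarrow> nat)" "(\<lambda>m. (k (\<rho> m), k' (\<rho> m))) \<longlonglongrightarrow> x"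
    by (rule bounded_convergent_subseq)
  then have 1: "(\<lambda>m. k (\<rho> m)) \<longlonglongrightarrow> fst x" "(\<lambda>m. k' (\<rho> m)) \<longlonglongrightarrow> snd x"
    using tendsto_fst[OF \<rho>(2)] tendsto_snd[OF \<rho>(2)] by simp_all
  have "(\<lambda>m. k (\<rho> m) ** k' (\<rho> m)) \<longlonglongrightarrow> fst x ** snd x" by (intro tendsto_matrix_mult 1)
  then have "fst x ** snd x = mat 1" using k'(1) LIMSEQ_unique tendsto_const by (metis (no_types, lifting) ext)
  then have "invertible (fst x)" using matrix_left_right_inverse by (auto simp: invertible_def)
  then show ?thesis using that \<rho>(1) 1(1) by blast
qed

lemma fsubst_diag:
  assumes c: "c \<in> hform d" and \<alpha>: "\<alpha> \<in> dmonos d"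
  shows "fsubst d c (diag_mat t) \<alpha> = (\<Prod>i\<in>UNIV. t i ^ \<alpha> i) * c \<alpha>"
proof -
  have "fsubst d c (diag_mat t) = (\<lambda>\<alpha>. (\<Prod>i\<in>UNIV. t i ^ \<alpha> i) * c \<alpha>)"
  proof (rule fsubst_eqI)
    show "(\<lambda>\<alpha>. (\<Prod>i\<in>UNIV. t i ^ \<alpha> i) * c \<alpha>) \<in> hform d" using c by (auto simp: hform_def)
    fix x
    have "(diag_mat t *v x) $ j = t j * x $ j" for j
      by (simp add: diag_mat_def matrix_vector_mult_def if_distrib[of "\<lambda>x. x * _"] cong: if_cong)
    then show "feval d (\<lambda>\<alpha>. (\<Prod>i\<in>UNIV. t i ^ \<alpha> i) * c \<alpha>) x = feval d c (diag_mat t *v x)"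
      by (simp add: feval_def power_mult_distrib prod.distrib mult_ac)
  qed
  then show ?thesis by simp
qed

lemma det_diag_mat: "det (diag_mat t) = (\<Prod>i\<in>UNIV. t i)"
  by (subst det_diagonal) (auto simp: diag_mat_def)

text \<open>After passing to a subsequence the outer factors of the diagonal decomposition converge, so
  only the torus parts $t_m$ can degenerate.  Here $K_m \to k$ are the left factors and $l_m$ the
  inverses of the right ones.\<close>
lemma torus_reduction:
  fixes c :: "('n::finite \<Rightarrow> nat) \<Rightarrow> complex"
  assumes c: "c \<in> hform d" and g: "\<And>m. g m \<in> SL"
  obtains \<rho> k K l L t M where "strict_mono (\<rho> :: nat \<Rightarrow> nat)" "invertible k" "M \<ge> 0"
    "\<And>\<alpha>. (\<lambda>m. fsubst d c (K m) \<alpha>) \<longlonglongrightarrow> fsubst d c k \<alpha>"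
    "l \<longlonglongrightarrow> L" "\<And>m i. t m i \<noteq> 0" "\<And>m i j. norm (g (\<rho> m) $ i $ j) \<le> M * (\<Sum>i\<in>UNIV. norm (t m i))"
    "\<And>m \<alpha>. \<alpha> \<in> dmonos d \<Longrightarrow> fsubst d (fsubst d c (g (\<rho> m))) (l m) \<alpha> = (\<Prod>i\<in>UNIV. t m i ^ \<alpha> i) * fsubst d c (K m) \<alpha>"
    "\<exists>q>0. (\<lambda>m. \<Prod>i\<in>UNIV. norm (t m i)) \<longlonglongrightarrow> q"
proof -
  obtain M where "\<And>g :: complex^'n^'n. \<exists>k\<in>bimat M. \<exists>l\<in>bimat M. \<exists>t. g = k ** diag_mat t ** l"
    by (rule diag_decomposition) blast
  then have "\<forall>m. \<exists>k l t. k \<in> bimat M \<and> l \<in> bimat M \<and> g m = k ** diag_mat t ** l" by blast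
  then obtain k l t where klt: "\<And>m. k m \<in> bimat M" "\<And>m. l m \<in> bimat M" "\<And>m. g m = k m ** diag_mat (t m) ** l m"
    by metis
  have "\<forall>m. \<exists>l'\<in>bimat M. l m ** l' = mat 1" using bimat_inverse klt(2) by blast
  then obtain l' where l': "\<And>m. l' m \<in> bimat M" "\<And>m. l m ** l' m = mat 1" by metis
  obtain k0 \<rho>1 where 1: "strict_mono (\<rho>1 :: nat \<Rightarrow> nat)" "(\<lambda>m. k (\<rho>1 m)) \<longlonglongrightarrow> k0" "invertible k0"
    using bimat_convergent_subseq[of k M] klt(1) by blast
  obtain l0 \<rho>2 where 2: "strict_mono (\<rho>2 :: nat \<Rightarrow> nat)" "(\<lambda>m. l' (\<rho>1 (\<rho>2 m))) \<longlonglongrightarrow> l0" "invertible l0"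
    using bimat_convergent_subseq[of "\<lambda>m. l' (\<rho>1 m)" M] l'(1) by blast
  define \<rho> where "\<rho> m = \<rho>1 (\<rho>2 m)" for m
  have \<rho>: "strict_mono \<rho>" using 1(1) 2(1) by (simp add: \<rho>_def strict_mono_def)
  have kl: "(\<lambda>m. k (\<rho> m)) \<longlonglongrightarrow> k0"
    using LIMSEQ_subseq_LIMSEQ[OF 1(2) 2(1)] by (simp add: \<rho>_def o_def)
  have ll: "(\<lambda>m. l' (\<rho> m)) \<longlonglongrightarrow> l0" using 2(2) by (simp add: \<rho>_def)
  \<comment> \<open>The torus parts need not have determinant 1. Their determinant is the quotient
    of two convergent determinants with nonzero limits, which is as good for taking
    logarithms.\<close>
  have gdet: "det (k m) * (\<Prod>i\<in>UNIV. t m i) = det (l' m)" for m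
  proof -
    have "g m ** l' m = k m ** diag_mat (t m)" by (simp add: klt(3) l'(2) flip: matrix_mul_assoc)
    then have "det (g m) * det (l' m) = det (k m) * det (diag_mat (t m))" by (metis det_mul)
    then show ?thesis using g[of m] by (simp add: SL_def det_diag_mat)
  qed
  have dl: "det (l' m) \<noteq> 0" "det (k m) \<noteq> 0" for m
    using l'(1)[of m] klt(1)[of m] bimat_inverse unfolding invertible_det_nz[symmetric] invertible_def by blast+
  have t0: "t m i \<noteq> 0" for m i
  proof -
    have "(\<Prod>i\<in>UNIV. t m i) \<noteq> 0" using gdet[of m] dl(1)[of m] by (metis mult_zero_right)
    then show ?thesis by simp
  qed
  have "(\<lambda>m. norm (det (l' (\<rho> m)) / det (k (\<rho> m)))) \<longlonglongrightarrow> norm (det l0 / det k0)"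
    using 1(3) by (intro tendsto_intros tendsto_det ll kl) (simp add: invertible_det_nz)
  moreover have "norm (det (l' m) / det (k m)) = (\<Prod>i\<in>UNIV. norm (t m i))" for m
    using gdet[of m] dl by (simp add: prod_norm field_simps norm_divide flip: norm_mult)
  ultimately have "(\<lambda>m. \<Prod>i\<in>UNIV. norm (t (\<rho> m) i)) \<longlonglongrightarrow> norm (det l0 / det k0)" by simp
  moreover have "norm (det l0 / det k0) > 0" using 1(3) 2(3) by (simp add: invertible_det_nz)
  ultimately have q: "\<exists>q>0. (\<lambda>m. \<Prod>i\<in>UNIV. norm (t (\<rho> m) i)) \<longlonglongrightarrow> q" by blast
  have M0: "M \<ge> 0"
  proof -
    have "norm (k 0 $ undefined $ undefined) \<le> M" using klt(1)[of 0] unfolding bimat_def by blast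
    then show ?thesis using norm_ge_zero order_trans by blast
  qed
  define N where "N = real CARD('n)"
  have gb: "norm (g m $ i $ j) \<le> (N * (N * M) * M) * (\<Sum>i\<in>UNIV. norm (t m i))" for m i j
  proof -
    let ?T = "\<Sum>i\<in>UNIV. norm (t m i)"
    have "norm (diag_mat (t m) $ i $ j) \<le> ?T" for i j
      by (auto simp: diag_mat_def intro!: sum_nonneg member_le_sum)
    moreover have "norm (k m $ i $ j) \<le> M" "norm (l m $ i $ j) \<le> M" for i j
      using klt(1,2)[of m] unfolding bimat_def by blast+
    ultimately have "norm ((k m ** diag_mat (t m) ** l m) $ i $ j) \<le> N * (N * M * ?T) * M"
      unfolding N_def by (intro matrix_mult_entry_bound)
    then show ?thesis by (simp add: klt(3) mult_ac)
  qed
  have sub: "fsubst d (fsubst d c (g m)) (l' m) \<alpha> = (\<Prod>i\<in>UNIV. t m i ^ \<alpha> i) * fsubst d c (k m) \<alpha>"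
    if "\<alpha> \<in> dmonos d" for m \<alpha>
  proof -
    have "g m ** l' m = k m ** diag_mat (t m)" by (simp add: klt(3) l'(2) flip: matrix_mul_assoc)
    then have "fsubst d (fsubst d c (g m)) (l' m) = fsubst d (fsubst d c (k m)) (diag_mat (t m))"
      by (simp add: fsubst_fsubst)
    then show ?thesis using fsubst_diag[OF _ that, of "fsubst d c (k m)" "t m"] by simp
  qed
  show ?thesis
    by (rule that[of \<rho> k0 "N * (N * M) * M" "\<lambda>m. k (\<rho> m)" "\<lambda>m. l' (\<rho> m)" l0 "\<lambda>m. t (\<rho> m)"])
      (use \<rho> 1(3) M0 ll t0 gb sub q kl N_def in \<open>auto intro: tendsto_fsubst[OF tendsto_const]\<close>)
qed

section \<open>Instability and non-properness yield weights\<close>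

lemma fsubst_zero: "fsubst d (\<lambda>_. 0) g = (\<lambda>_. 0)"
  by (rule fsubst_eqI) (auto simp: hform_def feval_def)

lemma fsubst_id: "c \<in> hform d \<Longrightarrow> fsubst d c (mat 1) = c"
  by (rule fsubst_eqI) auto

lemma fsubst_nonzero:
  assumes "c \<in> hform d" "c \<noteq> (\<lambda>_. 0)" "invertible k"
  shows "fsubst d c k \<noteq> (\<lambda>_. 0)"
proof
  assume "fsubst d c k = (\<lambda>_. 0)"
  moreover obtain k' where "k ** k' = mat 1" using assms(3) by (auto simp: invertible_def)
  ultimately show False using fsubst_fsubst[of d c k k'] fsubst_id[OF assms(1)] fsubst_zero assms(2) by metis
qed

lemma forbit_fsubst:
  assumes "C \<in> forbit d c" obtains g where "g \<in> SL" "C = fsubst d c g"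
proof -
  obtain g where g: "g \<in> SL" "C \<in> hform d" "\<And>x. feval d C x = feval d c (g *v x)"
    using assms unfolding forbit_def by blast
  then have "fsubst d c g = C" by (intro fsubst_eqI) auto
  then show ?thesis using that g by blast
qed

lemma tendsto_fun_coord:
  fixes X :: "'a \<Rightarrow> 'b::countable \<Rightarrow> complex"
  assumes "(X \<longlongrightarrow> x) F" shows "((\<lambda>m. X m a) \<longlongrightarrow> x a) F"
proof -
  have "continuous_on UNIV (\<lambda>f :: 'b \<Rightarrow> complex. f a)"
    by (rule continuous_on_product_coordinates)
  then have "isCont (\<lambda>f :: 'b \<Rightarrow> complex. f a) x"
    using continuous_on_eq_continuous_at[OF open_UNIV] by blast
  then show ?thesis using assms by (rule isCont_tendsto_compose)
qed

text \<open>One late member of a sequence tending to 0 suffices: all |t^\<alpha>| with nonzero limit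
  coefficient are small there while the product of the |t_i| stays near q > 0. The weights are the
  centred logarithms of the |t_i|.\<close>

lemma semistable_of_weights:
  fixes c :: "('n::finite \<Rightarrow> nat) \<Rightarrow> complex"
  assumes c: "c \<in> hform d" "c \<noteq> (\<lambda>_. 0)"
    and w: "\<And>g u. invertible g \<Longrightarrow> sum u UNIV = 0 \<Longrightarrow> \<exists>i. u i \<noteq> 0 \<Longrightarrow>
      (\<And>\<alpha>. \<alpha> \<in> dmonos d \<Longrightarrow> fsubst d c g \<alpha> \<noteq> 0 \<Longrightarrow> (\<Sum>i\<in>UNIV. \<alpha> i * u i) < (0::real)) \<Longrightarrow> False"
  shows "semistable d c"
proof (rule ccontr)
  assume "\<not> semistable d c"
  then have "(\<lambda>_. 0) \<in> closure (forbit d c)" using c by (simp add: semistable_def)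
  then obtain C where C: "\<And>m. C m \<in> forbit d c" "C \<longlonglongrightarrow> (\<lambda>_. 0)"
    by (auto simp: closure_sequential)
  have "\<forall>m. \<exists>g. g \<in> SL \<and> C m = fsubst d c g" using C(1) forbit_fsubst by metis
  then obtain g where g: "\<And>m. g m \<in> SL" "\<And>m. C m = fsubst d c (g m)" by metis
  obtain \<rho> k K l L t M where R: "strict_mono (\<rho> :: nat \<Rightarrow> nat)" "invertible k"
    "\<And>\<alpha>. (\<lambda>m. fsubst d c (K m) \<alpha>) \<longlonglongrightarrow> fsubst d c k \<alpha>"
    "l \<longlonglongrightarrow> L" "\<And>m i. t m i \<noteq> 0"
    "\<And>m \<alpha>. \<alpha> \<in> dmonos d \<Longrightarrow> fsubst d (fsubst d c (g (\<rho> m))) (l m) \<alpha> = (\<Prod>i\<in>UNIV. t m i ^ \<alpha> i) * fsubst d c (K m) \<alpha>"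
    "\<exists>q>0. (\<lambda>m. \<Prod>i\<in>UNIV. norm (t m i)) \<longlonglongrightarrow> q"
    by (rule torus_reduction[where g=g, OF c(1) g(1)]) blast
  obtain q where q: "q > 0" "(\<lambda>m. \<Prod>i\<in>UNIV. norm (t m i)) \<longlonglongrightarrow> q" using R(7) by blast
  let ?c = "fsubst d c k"
  let ?N = "real CARD('n)"
  \<comment> \<open>This is (q/2)^(d/N). Centring the logarithms shifts the weight of a degree d
    monomial by d/N times the logarithm of the product of the |t_i|, and that product will exceed
    q/2.\<close>
  define \<epsilon> where "\<epsilon> = exp (real d / ?N * ln (q / 2))"
  have \<epsilon>_pos: "\<epsilon> > 0" by (simp add: \<epsilon>_def)
  have small: "(\<lambda>m. norm (\<Prod>i\<in>UNIV. t m i ^ \<alpha> i)) \<longlonglongrightarrow> 0" if \<alpha>: "\<alpha> \<in> dmonos d" "?c \<alpha> \<noteq> 0" for \<alpha>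
  proof -
    have "(\<lambda>m. C (\<rho> m) \<beta>) \<longlonglongrightarrow> (\<lambda>_. 0) \<beta>" for \<beta>
      using LIMSEQ_subseq_LIMSEQ[OF tendsto_fun_coord[OF C(2), of \<beta>] R(1)] by (simp add: o_def)
    then have "(\<lambda>m. fsubst d (C (\<rho> m)) (l m) \<alpha>) \<longlonglongrightarrow> fsubst d (\<lambda>_. 0) L \<alpha>"
      by (rule tendsto_fsubst) (rule R(4))
    then have "(\<lambda>m. fsubst d (C (\<rho> m)) (l m) \<alpha> / fsubst d c (K m) \<alpha>) \<longlonglongrightarrow> 0 / ?c \<alpha>"
      by (intro tendsto_divide R(3) \<alpha>(2)) (simp add: fsubst_zero)
    moreover have "\<forall>\<^sub>F m in sequentially. fsubst d c (K m) \<alpha> \<noteq> 0"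
      using tendsto_imp_eventually_ne[OF R(3) \<alpha>(2)] .
    then have "\<forall>\<^sub>F m in sequentially. fsubst d (C (\<rho> m)) (l m) \<alpha> / fsubst d c (K m) \<alpha> = (\<Prod>i\<in>UNIV. t m i ^ \<alpha> i)"
      by eventually_elim (simp add: g(2) R(6)[OF \<alpha>(1)])
    ultimately have "(\<lambda>m. \<Prod>i\<in>UNIV. t m i ^ \<alpha> i) \<longlonglongrightarrow> 0" by (simp add: tendsto_cong)
    then show ?thesis by (rule tendsto_norm_zero)
  qed
  have "\<forall>\<^sub>F m in sequentially. \<forall>\<alpha>\<in>{\<alpha>\<in>dmonos d. ?c \<alpha> \<noteq> 0}. norm (\<Prod>i\<in>UNIV. t m i ^ \<alpha> i) < \<epsilon>"
  proof (rule eventually_ball_finite)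
    show "\<forall>\<alpha>\<in>{\<alpha>\<in>dmonos d. ?c \<alpha> \<noteq> 0}. \<forall>\<^sub>F m in sequentially. norm (\<Prod>i\<in>UNIV. t m i ^ \<alpha> i) < \<epsilon>"
      using small by (auto intro!: order_tendstoD(2) simp: \<epsilon>_def)
  qed simp
  moreover have "\<forall>\<^sub>F m in sequentially. q / 2 < (\<Prod>i\<in>UNIV. norm (t m i))"
    using q by (intro order_tendstoD(1)[OF q(2)]) simp
  ultimately have "\<forall>\<^sub>F m in sequentially. (\<forall>\<alpha>\<in>{\<alpha>\<in>dmonos d. ?c \<alpha> \<noteq> 0}. norm (\<Prod>i\<in>UNIV. t m i ^ \<alpha> i) < \<epsilon>)
      \<and> q / 2 < (\<Prod>i\<in>UNIV. norm (t m i))" by (rule eventually_conj)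
  then obtain m where m: "\<And>\<alpha>. \<alpha> \<in> dmonos d \<Longrightarrow> ?c \<alpha> \<noteq> 0 \<Longrightarrow> norm (\<Prod>i\<in>UNIV. t m i ^ \<alpha> i) < \<epsilon>"
    "q / 2 < (\<Prod>i\<in>UNIV. norm (t m i))"
    using eventually_happens by fastforce
  define S where "S = (\<Sum>i\<in>UNIV. ln (norm (t m i)))"
  \<comment> \<open>Subtracting the mean makes the sum vanish exactly; the product of the |t_i| only
    converges, not necessarily to 1.\<close>
  define u where "u i = ln (norm (t m i)) - S / ?N" for i
  have lnprod: "ln (\<Prod>i\<in>UNIV. norm (t m i)) = S" unfolding S_def by (rule ln_prod) (simp_all add: R(5))
  have neg: "(\<Sum>i\<in>UNIV. \<alpha> i * u i) < 0" if \<alpha>: "\<alpha> \<in> dmonos d" "?c \<alpha> \<noteq> 0" for \<alpha>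
  proof -
    have pos: "norm (\<Prod>i\<in>UNIV. t m i ^ \<alpha> i) > 0" using R(5) by (simp add: prod_zero_iff)
    have "(\<Sum>i\<in>UNIV. \<alpha> i * ln (norm (t m i))) = ln (norm (\<Prod>i\<in>UNIV. t m i ^ \<alpha> i))"
      using R(5) by (simp add: norm_power ln_realpow ln_prod flip: prod_norm)
    also have "\<dots> < ln \<epsilon>" using m(1)[OF \<alpha>] pos \<epsilon>_pos by (metis ln_less_cancel_iff)
    also have "ln \<epsilon> = real d / ?N * ln (q / 2)" by (simp add: \<epsilon>_def)
    also have "\<dots> \<le> real d / ?N * S"
      unfolding lnprod[symmetric] using m(2) q(1) by (intro mult_left_mono) auto
    finally have "(\<Sum>i\<in>UNIV. \<alpha> i * ln (norm (t m i))) < real d / ?N * S" .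
    moreover have "(\<Sum>i\<in>UNIV. \<alpha> i * u i) = (\<Sum>i\<in>UNIV. \<alpha> i * ln (norm (t m i))) - real (\<Sum>i\<in>UNIV. \<alpha> i) * (S / ?N)"
      unfolding u_def by (simp add: right_diff_distrib sum_subtractf sum_distrib_right sum_divide_distrib)
    moreover have "(\<Sum>i\<in>UNIV. \<alpha> i) = d" using \<alpha>(1) by (simp add: dmonos_def)
    ultimately show ?thesis by simp
  qed
  have "?c \<noteq> (\<lambda>_. 0)" using fsubst_nonzero[OF c R(2)] .
  then obtain \<alpha> where \<alpha>: "?c \<alpha> \<noteq> 0" by auto
  then have "\<alpha> \<in> dmonos d" using fsubst_hform[of d c k] unfolding hform_def by blast
  then have "(\<Sum>i\<in>UNIV. \<alpha> i * u i) < 0" using \<alpha> by (rule neg)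
  \<comment> \<open>The form is nonzero, so it has a monomial, whose strict inequality rules out u =
    0.\<close>
  then have "\<exists>i. u i \<noteq> 0" by (rule contrapos_pp) simp
  moreover have "sum u UNIV = 0" by (simp add: u_def sum_subtractf S_def)
  ultimately show False using w[OF R(2), of u] neg by blast
qed

lemma fsubst_bound:
  obtains B' where "\<And>C l \<alpha>. (\<And>\<alpha>. norm (C \<alpha>) \<le> B) \<Longrightarrow> (\<And>i j. norm (l $ i $ j) \<le> M) \<Longrightarrow>
    norm (fsubst d C (l :: complex^'n::finite^'n) \<alpha>) \<le> B'"
proof -
  define N where "N = real CARD('n)"
  define R where "R = max 1 (N * M)"
  define D where "D = (\<Sum>\<alpha>\<in>(dmonos d :: ('n \<Rightarrow> nat) set). \<bar>B\<bar> * R ^ d)"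
  define E where "E = (\<Sum>s\<in>PiE (UNIV :: 'n set) (\<lambda>_. {..<Suc d}). D) / real (Suc d) ^ CARD('n)"
  have "norm (fsubst d C l \<alpha>) \<le> max 0 E" if C: "\<And>\<alpha>. norm (C \<alpha>) \<le> B" and l: "\<And>i j. norm (l $ i $ j) \<le> M"
    for C and l :: "complex^'n^'n" and \<alpha>
  proof (cases "\<alpha> \<in> dmonos d")
    case True
    have fe: "norm (feval d C (l *v x)) \<le> D" if x: "\<And>i. norm (x $ i) = 1" for x
    proof -
      have y: "norm ((l *v x) $ j) \<le> R" for j
      proof -
        have "norm ((l *v x) $ j) \<le> (\<Sum>i\<in>UNIV. norm (l $ j $ i * x $ i))"
          unfolding matrix_vector_mult_def by (simp add: norm_sum)
        also have "\<dots> \<le> (\<Sum>i\<in>(UNIV :: 'n set). M)" using l x by (intro sum_mono) (simp add: norm_mult)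
        finally show ?thesis by (simp add: R_def N_def)
      qed
      have "norm (feval d C (l *v x)) \<le> (\<Sum>\<alpha>\<in>dmonos d. norm (C \<alpha> * (\<Prod>j\<in>UNIV. ((l *v x) $ j) ^ \<alpha> j)))"
        unfolding feval_def by (rule norm_sum)
      also have "\<dots> \<le> D" unfolding D_def
      proof (rule sum_mono)
        fix \<alpha> :: "'n \<Rightarrow> nat" assume \<alpha>: "\<alpha> \<in> dmonos d"
        have "(\<Prod>j\<in>UNIV. norm ((l *v x) $ j) ^ \<alpha> j) \<le> (\<Prod>j\<in>UNIV. R ^ \<alpha> j)"
          by (intro prod_mono conjI power_mono y) auto
        also have "\<dots> = R ^ d" using \<alpha> by (simp add: dmonos_def flip: power_sum)
        finally show "norm (C \<alpha> * (\<Prod>j\<in>UNIV. ((l *v x) $ j) ^ \<alpha> j)) \<le> \<bar>B\<bar> * R ^ d"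
          unfolding norm_mult prod_norm[symmetric] norm_power
          using C[of \<alpha>] by (intro mult_mono prod_nonneg) auto
      qed
      finally show ?thesis .
    qed
    have rou1: "norm (rou (Suc d)) = 1" by (simp add: rou_def)
    have "norm (fsubst d C l \<alpha>) \<le> (\<Sum>s\<in>PiE (UNIV :: 'n set) (\<lambda>_. {..<Suc d}).
        norm (feval d C (l *v (\<chi> j. rou (Suc d) ^ s j)) * (\<Prod>j\<in>UNIV. (rou (Suc d) ^ s j) ^ (Suc d - \<alpha> j)))) / real (Suc d) ^ CARD('n)"
      using True unfolding fsubst_def coefx_def by (simp add: norm_divide norm_power divide_right_mono norm_sum flip: of_nat_Suc)
    also have "\<dots> \<le> E"
      unfolding E_def
    proof (intro divide_right_mono sum_mono)
      fix s :: "'n \<Rightarrow> nat"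
      have "norm (\<Prod>j\<in>UNIV. (rou (Suc d) ^ s j) ^ (Suc d - \<alpha> j)) = 1"
        by (simp add: norm_power rou1 flip: prod_norm)
      then show "norm (feval d C (l *v (\<chi> j. rou (Suc d) ^ s j)) * (\<Prod>j\<in>UNIV. (rou (Suc d) ^ s j) ^ (Suc d - \<alpha> j))) \<le> D"
        unfolding norm_mult using fe[of "\<chi> j. rou (Suc d) ^ s j"] by (simp add: norm_power rou1)
    qed simp
    finally show ?thesis by simp
  qed (simp add: fsubst_def)
  then show ?thesis using that by blast
qed


text \<open>Properness of the orbit map. Along an unbounded sequence with bounded coefficients the
  vectors of ln |t_i| tend to infinity; the weights are a limit of their directions. Dividing by the
  norm removes every bounded term, so the limit has sum 0 and nonpositive weights, and it is nonzero
  because it has norm 1.\<close>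

lemma bounded_of_weights:
  fixes c :: "('n::finite \<Rightarrow> nat) \<Rightarrow> complex"
  assumes c: "c \<in> hform d"
    and w: "\<And>g u. invertible g \<Longrightarrow> sum u UNIV = 0 \<Longrightarrow> \<exists>i. u i \<noteq> 0 \<Longrightarrow>
      (\<And>\<alpha>. \<alpha> \<in> dmonos d \<Longrightarrow> fsubst d c g \<alpha> \<noteq> 0 \<Longrightarrow> (\<Sum>i\<in>UNIV. \<alpha> i * u i) \<le> (0::real)) \<Longrightarrow> False"
  shows "bounded {g\<in>SL. \<forall>\<alpha>. norm (fsubst d c g \<alpha>) \<le> B}"
proof (rule ccontr)
  assume "\<not> ?thesis"
  then have "\<forall>m::nat. \<exists>g. g \<in> SL \<and> (\<forall>\<alpha>. norm (fsubst d c g \<alpha>) \<le> B) \<and> norm g > real m"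
    unfolding bounded_iff by (auto simp: not_le)
  then obtain g where g: "\<And>m::nat. g m \<in> SL" "\<And>m \<alpha>. norm (fsubst d c (g m) \<alpha>) \<le> B" "\<And>m. norm (g m) > real m"
    by metis
  obtain \<rho> k K l L t M where R: "strict_mono (\<rho> :: nat \<Rightarrow> nat)" "invertible k" "M \<ge> 0"
    "\<And>\<alpha>. (\<lambda>m. fsubst d c (K m) \<alpha>) \<longlonglongrightarrow> fsubst d c k \<alpha>"
    "l \<longlonglongrightarrow> L" "\<And>m i. t m i \<noteq> 0" "\<And>m i j. norm (g (\<rho> m) $ i $ j) \<le> M * (\<Sum>i\<in>UNIV. norm (t m i))"
    "\<And>m \<alpha>. \<alpha> \<in> dmonos d \<Longrightarrow> fsubst d (fsubst d c (g (\<rho> m))) (l m) \<alpha> = (\<Prod>i\<in>UNIV. t m i ^ \<alpha> i) * fsubst d c (K m) \<alpha>"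
    "\<exists>q>0. (\<lambda>m. \<Prod>i\<in>UNIV. norm (t m i)) \<longlonglongrightarrow> q"
    by (rule torus_reduction[where g=g, OF c(1) g(1)]) blast
  obtain q where q: "q > 0" "(\<lambda>m. \<Prod>i\<in>UNIV. norm (t m i)) \<longlonglongrightarrow> q" using R(9) by blast
  let ?c = "fsubst d c k"
  define N where "N = real CARD('n)"
  have N: "N > 0" by (simp add: N_def)
  define u where "u m = (\<chi> i. ln (norm (t m i)))" for m
  obtain Lb where Lb: "\<And>m. norm (l m) \<le> Lb"
    using Bseq_def convergent_imp_Bseq[of l] R(5) convergent_def by blast
  then have "norm (l m $ i $ j) \<le> Lb" for m i j
    by (meson Finite_Cartesian_Product.norm_nth_le order_trans)
  then obtain B' where B': "\<And>m \<alpha>. norm (fsubst d (fsubst d c (g (\<rho> m))) (l m) \<alpha>) \<le> B'"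
    using fsubst_bound[where B=B and M=Lb and d=d and 'n='n] g(2) by metis
  \<comment> \<open>In the denominator, N * N comes from \<open>norm_matrix_le\<close>, the last N
    from bounding the sum of the |t_i| by its largest term, and M + 1 replaces M to be
    positive.\<close>
  have u_ge: "norm (u m) \<ge> ln (real m / (N * (N * (M + 1) * N)))" if "m > 0" for m
  proof -
    obtain i where i: "\<And>j. norm (t m j) \<le> norm (t m i)"
    proof -
      have "Max (range (\<lambda>j. norm (t m j))) \<in> range (\<lambda>j. norm (t m j))" by (intro Max_in) auto
      then obtain i where "norm (t m i) = Max (range (\<lambda>j. norm (t m j)))" by (metis rangeE)
      moreover have "norm (t m j) \<le> Max (range (\<lambda>j. norm (t m j)))" for j by simp
      ultimately have "norm (t m j) \<le> norm (t m i)" for j by simp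
      then show ?thesis by (rule that)
    qed
    have "(\<Sum>i\<in>UNIV. norm (t m i)) \<le> N * norm (t m i)"
      using sum_mono[of UNIV "\<lambda>j. norm (t m j)" "\<lambda>_. norm (t m i)"] i by (simp add: N_def)
    then have "M * (\<Sum>i\<in>UNIV. norm (t m i)) \<le> (M + 1) * (N * norm (t m i))"
      using R(3) by (intro mult_mono) (auto intro: sum_nonneg)
    then have "norm (g (\<rho> m)) \<le> N * (N * ((M + 1) * (N * norm (t m i))))"
      unfolding N_def using R(7)[of m] by (intro norm_matrix_le) (meson order_trans)
    moreover have "real m \<le> real (\<rho> m)" using seq_suble[OF R(1), of m] by simp
    ultimately have "real m \<le> (N * (N * (M + 1) * N)) * norm (t m i)" using g(3)[of "\<rho> m"] by (simp add: mult_ac)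
    then have "real m / (N * (N * (M + 1) * N)) \<le> norm (t m i)"
      using N R(3) by (simp add: divide_le_eq mult_ac)
    then have "ln (real m / (N * (N * (M + 1) * N))) \<le> ln (norm (t m i))"
      using that N R(3,6) by (intro ln_mono) auto
    also have "\<dots> \<le> \<bar>u m $ i\<bar>" by (simp add: u_def)
    also have "\<dots> \<le> norm (u m)" using component_le_norm_cart by blast
    finally show ?thesis .
  qed
  have "filterlim (\<lambda>m. ln (real m / (N * (N * (M + 1) * N)))) at_top sequentially"
  proof -
    have "filterlim (\<lambda>m. real m * (1 / (N * (N * (M + 1) * N)))) at_top sequentially"
      using N R(3) by (intro filterlim_at_top_mult_tendsto_pos[OF tendsto_const] filterlim_real_sequentially) auto
    then show ?thesis by (intro filterlim_compose[OF ln_at_top]) simp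
  qed
  then have u_inf: "filterlim (\<lambda>m. norm (u m)) at_top sequentially"
    by (rule filterlim_at_top_mono) (use u_ge in \<open>auto intro: eventually_mono[OF eventually_gt_at_top[of 0]]\<close>)
  define y where "y m = u m /\<^sub>R norm (u m)" for m
  have "norm (y m) \<le> 1" for m by (cases "u m = 0") (simp_all add: y_def)
  then have "bounded (range y)" unfolding bounded_iff by auto
  then obtain y0 \<sigma> where \<sigma>: "strict_mono (\<sigma> :: nat \<Rightarrow> nat)" "(\<lambda>m. y (\<sigma> m)) \<longlonglongrightarrow> y0"
    by (rule bounded_convergent_subseq)
  have us_inf: "filterlim (\<lambda>m. norm (u (\<sigma> m))) at_top sequentially"
    using filterlim_compose[OF u_inf filterlim_subseq[OF \<sigma>(1)]] .
  have inv0: "(\<lambda>m. X / norm (u (\<sigma> m))) \<longlonglongrightarrow> 0" for X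
    by (rule real_tendsto_divide_at_top[OF tendsto_const us_inf])
  have u_pos: "\<forall>\<^sub>F m in sequentially. norm (u (\<sigma> m)) > 0"
    using us_inf unfolding filterlim_at_top_dense by blast
  have yi: "(\<lambda>m. y (\<sigma> m) $ i) \<longlonglongrightarrow> y0 $ i" for i using \<sigma>(2) by (rule tendsto_vec_nth)
  have "(\<lambda>m. norm (y (\<sigma> m))) \<longlonglongrightarrow> norm y0" using \<sigma>(2) by (rule tendsto_norm)
  moreover have "\<forall>\<^sub>F m in sequentially. norm (y (\<sigma> m)) = 1"
    using u_pos by eventually_elim (simp add: y_def)
  then have "(\<lambda>m. norm (y (\<sigma> m))) \<longlonglongrightarrow> 1" by (rule tendsto_eventually)
  ultimately have "norm y0 = 1" by (rule LIMSEQ_unique)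
  then have "y0 \<noteq> 0" by auto
  then have y0nz: "\<exists>i. y0 $ i \<noteq> 0" by (auto simp: vec_eq_iff)
  have lnprod: "(\<Sum>i\<in>UNIV. u m $ i) = ln (\<Prod>i\<in>UNIV. norm (t m i))" for m
    unfolding u_def using R(6) by (simp add: ln_prod)
  have y0sum: "(\<Sum>i\<in>UNIV. y0 $ i) = 0"
  proof -
    have "(\<lambda>m. ln (\<Prod>i\<in>UNIV. norm (t (\<sigma> m) i))) \<longlonglongrightarrow> ln q"
      using LIMSEQ_subseq_LIMSEQ[OF q(2) \<sigma>(1)] q(1) by (intro tendsto_ln) (auto simp: o_def)
    then have "(\<lambda>m. (\<Sum>i\<in>UNIV. u (\<sigma> m) $ i) / norm (u (\<sigma> m))) \<longlonglongrightarrow> 0"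
      unfolding lnprod by (rule real_tendsto_divide_at_top[OF _ us_inf])
    moreover have "(\<Sum>i\<in>UNIV. u m $ i) / norm (u m) = (\<Sum>i\<in>UNIV. y m $ i)" for m
      by (simp add: y_def divide_inverse sum_distrib_left mult.commute)
    ultimately have "(\<lambda>m. \<Sum>i\<in>UNIV. y (\<sigma> m) $ i) \<longlonglongrightarrow> 0" by simp
    moreover have "(\<lambda>m. \<Sum>i\<in>UNIV. y (\<sigma> m) $ i) \<longlonglongrightarrow> (\<Sum>i\<in>UNIV. y0 $ i)" by (intro tendsto_sum yi)
    ultimately show ?thesis using LIMSEQ_unique by blast
  qed
  have y0le: "(\<Sum>i\<in>UNIV. \<alpha> i * y0 $ i) \<le> 0" if \<alpha>: "\<alpha> \<in> dmonos d" "?c \<alpha> \<noteq> 0" for \<alpha>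
  proof -
    \<comment> \<open>Eventually the coefficient of the left factor exceeds half its limit in
      modulus, so the bound B' on the product bounds |t^\<alpha>|, and X bounds its
      logarithm.\<close>
    define X where "X = ln (B' / (norm (?c \<alpha>) / 2))"
    have "(\<lambda>m. norm (fsubst d c (K m) \<alpha>)) \<longlonglongrightarrow> norm (?c \<alpha>)" by (intro tendsto_norm R(4))
    then have "\<forall>\<^sub>F m in sequentially. norm (fsubst d c (K m) \<alpha>) > norm (?c \<alpha>) / 2"
      by (rule order_tendstoD(1)) (use \<alpha>(2) in simp)
    then have "\<forall>\<^sub>F m in sequentially. (\<Sum>i\<in>UNIV. \<alpha> i * u m $ i) \<le> X"
    proof eventually_elim
      case (elim m)
      have pos: "norm (\<Prod>i\<in>UNIV. t m i ^ \<alpha> i) > 0" using R(6) by simp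
      have "norm (\<Prod>i\<in>UNIV. t m i ^ \<alpha> i) * (norm (?c \<alpha>) / 2) \<le> norm (\<Prod>i\<in>UNIV. t m i ^ \<alpha> i) * norm (fsubst d c (K m) \<alpha>)"
        using elim by (intro mult_left_mono) auto
      also have "\<dots> \<le> B'" using B'[of m \<alpha>] R(8)[OF \<alpha>(1), of m] by (simp add: norm_mult)
      finally have "norm (\<Prod>i\<in>UNIV. t m i ^ \<alpha> i) \<le> B' / (norm (?c \<alpha>) / 2)" using \<alpha>(2) by (simp add: field_simps)
      then have "ln (norm (\<Prod>i\<in>UNIV. t m i ^ \<alpha> i)) \<le> X" unfolding X_def using pos by (intro ln_mono) auto
      moreover have "(\<Sum>i\<in>UNIV. \<alpha> i * u m $ i) = ln (norm (\<Prod>i\<in>UNIV. t m i ^ \<alpha> i))"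
        using R(6) by (simp add: u_def norm_power ln_realpow ln_prod flip: prod_norm)
      ultimately show ?case by simp
    qed
    then have "\<forall>\<^sub>F m in sequentially. (\<Sum>i\<in>UNIV. \<alpha> i * u (\<sigma> m) $ i) \<le> X"
      by (rule eventually_subseq[OF \<sigma>(1)])
    then have "\<forall>\<^sub>F m in sequentially. (\<Sum>i\<in>UNIV. \<alpha> i * y (\<sigma> m) $ i) \<le> X / norm (u (\<sigma> m))"
    proof eventually_elim
      case (elim m)
      have "(\<Sum>i\<in>UNIV. \<alpha> i * y (\<sigma> m) $ i) = (\<Sum>i\<in>UNIV. \<alpha> i * u (\<sigma> m) $ i) / norm (u (\<sigma> m))"
        by (simp add: y_def divide_inverse sum_distrib_left sum_distrib_right mult_ac)
      then show ?case using elim by (simp add: divide_right_mono)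
    qed
    moreover have "(\<lambda>m. \<Sum>i\<in>UNIV. \<alpha> i * y (\<sigma> m) $ i) \<longlonglongrightarrow> (\<Sum>i\<in>UNIV. \<alpha> i * y0 $ i)"
      by (intro tendsto_sum tendsto_mult tendsto_const yi)
    ultimately show ?thesis using tendsto_le[OF _ inv0[of X]] by simp
  qed
  show False using w[OF R(2) y0sum y0nz] y0le by blast
qed

lemma fsubst_bounded_coeffs:
  assumes "\<And>\<alpha>. (\<lambda>m. C m \<alpha>) \<longlonglongrightarrow> h \<alpha>" "\<And>m. C m \<in> hform d"
  obtains B where "\<And>(m::nat) (\<alpha> :: 'n::finite \<Rightarrow> nat). norm (C m \<alpha> :: complex) \<le> B"
proof -
  have "\<forall>\<alpha>. \<exists>b. \<forall>m. norm (C m \<alpha>) \<le> b"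
    using assms(1) convergent_imp_Bseq convergent_def Bseq_def by metis
  then obtain b where b: "\<And>\<alpha> m. norm (C m \<alpha>) \<le> b \<alpha>" by metis
  have b0: "b \<alpha> \<ge> 0" for \<alpha> using b[of 0 \<alpha>] norm_ge_zero order_trans by blast
  have "norm (C m \<alpha>) \<le> (\<Sum>\<alpha>\<in>dmonos d. b \<alpha>)" for m \<alpha>
  proof (cases "\<alpha> \<in> dmonos d")
    case True
    then show ?thesis using b[of m \<alpha>] member_le_sum[of \<alpha> "dmonos d" b] b0 by fastforce
  next
    case False
    then have "C m \<alpha> = 0" using assms(2)[of m] by (simp add: hform_def)
    then show ?thesis using b0 by (simp add: sum_nonneg)
  qed
  then show ?thesis using that by blast
qed

text \<open>A convergent sequence in the orbit has bounded coefficients, so the group elements stay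
  in a bounded set. A limit point of them has determinant 1 and realises the limit form.\<close>

lemma closed_forbit:
  fixes c :: "('n::finite \<Rightarrow> nat) \<Rightarrow> complex"
  assumes bd: "\<And>B. bounded {g\<in>SL. \<forall>\<alpha>. norm (fsubst d c g \<alpha>) \<le> B}"
  shows "closed (forbit d c)"
  unfolding closed_sequential_limits
proof (intro allI impI, elim conjE)
  fix C h assume C: "\<forall>m. C m \<in> forbit d c" "C \<longlonglongrightarrow> h"
  have "\<forall>m. \<exists>g. g \<in> SL \<and> C m = fsubst d c g" using C(1) forbit_fsubst by metis
  then obtain g where g: "\<And>m. g m \<in> SL" "\<And>m. C m = fsubst d c (g m)" by metis
  have lim: "(\<lambda>m. C m \<alpha>) \<longlonglongrightarrow> h \<alpha>" for \<alpha> using C(2) by (rule tendsto_fun_coord)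
  have hf: "C m \<in> hform d" for m by (simp add: g(2))
  obtain B where "\<And>m \<alpha>. norm (C m \<alpha>) \<le> B" using fsubst_bounded_coeffs[OF lim hf] by blast
  then have "range g \<subseteq> {g\<in>SL. \<forall>\<alpha>. norm (fsubst d c g \<alpha>) \<le> B}" using g by auto
  then have "bounded (range g)" using bd bounded_subset by blast
  then obtain g0 \<rho> where \<rho>: "strict_mono (\<rho> :: nat \<Rightarrow> nat)" "(\<lambda>m. g (\<rho> m)) \<longlonglongrightarrow> g0"
    by (rule bounded_convergent_subseq)
  have "(\<lambda>m. det (g (\<rho> m))) \<longlonglongrightarrow> det g0" by (rule tendsto_det[OF \<rho>(2)])
  moreover have "det (g (\<rho> m)) = 1" for m using g(1)[of "\<rho> m"] by (simp add: SL_def)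
  ultimately have g0: "g0 \<in> SL" by (simp add: SL_def LIMSEQ_const_iff)
  have "h \<alpha> = fsubst d c g0 \<alpha>" for \<alpha>
  proof (rule LIMSEQ_unique)
    show "(\<lambda>m. C (\<rho> m) \<alpha>) \<longlonglongrightarrow> h \<alpha>" using LIMSEQ_subseq_LIMSEQ[OF lim \<rho>(1)] by (simp add: o_def)
    show "(\<lambda>m. C (\<rho> m) \<alpha>) \<longlonglongrightarrow> fsubst d c g0 \<alpha>"
      unfolding g(2) by (rule tendsto_fsubst[OF tendsto_const \<rho>(2)])
  qed
  then have "h = fsubst d c g0" by blast
  then show "h \<in> forbit d c" using g0 by (auto simp: forbit_def)
qed

section \<open>Finiteness of the stabiliser\<close>

text \<open>The powers of X and, below, its exponential, written out entrywise because the type of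
  matrices carries no Banach algebra structure.\<close>
primrec mat_pow :: "complex^'n::finite^'n \<Rightarrow> nat \<Rightarrow> complex^'n^'n" where
  "mat_pow X 0 = mat 1"
| "mat_pow X (Suc k) = X ** mat_pow X k"

definition mat_exp :: "complex^'n::finite^'n \<Rightarrow> complex \<Rightarrow> complex^'n^'n" where
  "mat_exp X z = (\<chi> i j. \<Sum>k. mat_pow X k $ i $ j / fact k * z ^ k)"

lemma mat_pow_bound:
  fixes X :: "complex^'n::finite^'n"
  assumes "\<And>i j. norm (X $ i $ j) \<le> C"
  shows "norm (mat_pow X k $ i $ j) \<le> (real CARD('n) * C) ^ k"
proof (induction k arbitrary: i j)
  case 0
  then show ?case by (simp add: mat_def)
next
  case (Suc k)
  show ?case using matrix_mult_entry_bound[OF assms Suc.IH] by simp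
qed

lemma mat_exp_summable:
  fixes X :: "complex^'n::finite^'n"
  shows "summable (\<lambda>k. mat_pow X k $ i $ j / fact k * z ^ k)"
proof -
  have C: "norm (X $ i $ j) \<le> norm X" for i j
    by (meson Finite_Cartesian_Product.norm_nth_le order_trans)
  show ?thesis
  proof (rule summable_comparison_test'[where N=0])
    show "summable (\<lambda>k. inverse (fact k) * (real CARD('n) * norm X * norm z) ^ k)"
      by (rule summable_exp)
    show "norm (mat_pow X k $ i $ j / fact k * z ^ k) \<le> inverse (fact k) * (real CARD('n) * norm X * norm z) ^ k" for k
    proof -
      have "norm (mat_pow X k $ i $ j / fact k * z ^ k) = norm (mat_pow X k $ i $ j) * (inverse (fact k) * norm z ^ k)"
        by (simp add: norm_mult norm_divide norm_power divide_inverse norm_inverse)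
      also have "\<dots> \<le> (real CARD('n) * norm X) ^ k * (inverse (fact k) * norm z ^ k)"
        by (intro mult_right_mono mat_pow_bound C) simp
      finally show ?thesis by (simp add: power_mult_distrib mult_ac)
    qed
  qed
qed

lemma mat_exp_deriv:
  "((\<lambda>z. mat_exp X z $ i $ j) has_field_derivative (X ** mat_exp X z) $ i $ j) (at z)"
proof -
  let ?a = "\<lambda>i j k. mat_pow X k $ i $ j / fact k"
  have "((\<lambda>z. \<Sum>k. ?a i j k * z ^ k) has_field_derivative (\<Sum>k. diffs (?a i j) k * z ^ k)) (at z)"
    by (rule termdiffs_strong_converges_everywhere) (rule mat_exp_summable)
  also have "(\<Sum>k. diffs (?a i j) k * z ^ k) = (\<Sum>k. \<Sum>l\<in>UNIV. X $ i $ l * (?a l j k * z ^ k))"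
  proof (rule suminf_cong)
    fix k
    have "diffs (?a i j) k = mat_pow X (Suc k) $ i $ j / fact k"
      unfolding diffs_def fact_Suc by (simp del: mat_pow.simps of_nat_Suc)
    also have "\<dots> = (\<Sum>l\<in>UNIV. X $ i $ l * ?a l j k)"
      by (simp add: matrix_matrix_mult_def sum_divide_distrib)
    finally show "diffs (?a i j) k * z ^ k = (\<Sum>l\<in>UNIV. X $ i $ l * (?a l j k * z ^ k))"
      by (simp add: sum_distrib_left mult_ac)
  qed
  also have "\<dots> = (\<Sum>l\<in>UNIV. \<Sum>k. X $ i $ l * (?a l j k * z ^ k))"
    by (intro suminf_sum summable_mult mat_exp_summable)
  also have "\<dots> = (\<Sum>l\<in>UNIV. X $ i $ l * (\<Sum>k. ?a l j k * z ^ k))"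
    by (intro sum.cong refl suminf_mult mat_exp_summable)
  finally show ?thesis by (simp add: mat_exp_def matrix_matrix_mult_def)
qed

lemma mat_exp_0: "mat_exp X 0 = mat 1"
proof -
  have "(\<Sum>k. mat_pow X k $ i $ j / fact k * 0 ^ k) = mat_pow X 0 $ i $ j / fact 0" for i j
    by (rule powser_zero)
  then show ?thesis by (simp add: mat_exp_def vec_eq_iff)
qed

text \<open>Invariance is known only along a sequence of small steps, not along a curve;
  differentiability of P suffices to annihilate the limit direction.\<close>

lemma derivative_along_sequence:
  fixes P :: "'a::euclidean_space \<Rightarrow> complex"
  assumes D: "(P has_derivative D) (at A)"
    and \<epsilon>: "\<epsilon> \<longlonglongrightarrow> 0" "\<And>m. \<epsilon> m > (0::real)" and Y: "Y \<longlonglongrightarrow> y"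
    and P: "\<And>m::nat. P (A + \<epsilon> m *\<^sub>R Y m) = P A"
  shows "D y = 0"
proof -
  interpret D: bounded_linear D using D by (rule has_derivative_bounded_linear)
  have v0: "(\<lambda>m. \<epsilon> m *\<^sub>R Y m) \<longlonglongrightarrow> 0" using tendsto_scaleR[OF \<epsilon>(1) Y] by simp
  \<comment> \<open>Division by zero gives this remainder quotient the value 0 at 0, so it is
    continuous there and steps with Y m = 0 need no separate treatment.\<close>
  let ?R = "\<lambda>v. norm (P (A + v) - P A - D v) / norm v"
  have "(?R \<longlongrightarrow> 0) (at 0)" using D by (simp add: has_derivative_at)
  moreover have R0: "?R 0 = 0" by simp
  ultimately have "isCont ?R 0" by (simp add: isCont_def D.zero)
  then have "(\<lambda>m. ?R (\<epsilon> m *\<^sub>R Y m)) \<longlonglongrightarrow> 0"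
    using isCont_tendsto_compose[OF _ v0, of ?R] R0 by simp
  then have "(\<lambda>m. ?R (\<epsilon> m *\<^sub>R Y m) * norm (Y m)) \<longlonglongrightarrow> 0 * norm y"
    by (intro tendsto_mult tendsto_norm Y)
  moreover have "?R (\<epsilon> m *\<^sub>R Y m) * norm (Y m) = norm (D (Y m))" for m
    using \<epsilon>(2)[of m] by (cases "Y m = 0") (simp_all add: P D.scaleR D.zero)
  ultimately have "(\<lambda>m. norm (D (Y m))) \<longlonglongrightarrow> 0" by simp
  moreover have "(\<lambda>m. norm (D (Y m))) \<longlonglongrightarrow> norm (D y)" by (intro tendsto_norm D.tendsto Y)
  ultimately have "norm (D y) = 0" using LIMSEQ_unique by blast
  then show ?thesis by simp
qed

lemma matrix_add_mult: "(A + B) ** C = A ** C + B ** C"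
  for A B :: "complex^'n::finite^'m" and C :: "complex^'k^'n"
  by (vector matrix_matrix_mult_def sum.distrib distrib_right)

lemma has_derivative_vecI:
  fixes f :: "'a::real_normed_vector \<Rightarrow> 'b::euclidean_space^'n::finite"
  assumes "\<And>i. ((\<lambda>x. f x $ i) has_derivative (\<lambda>x. f' x $ i)) (at a)"
  shows "(f has_derivative f') (at a)"
  unfolding has_derivative_componentwise_within[of f f' a UNIV]
proof
  fix b :: "'b^'n" assume "b \<in> Basis"
  then obtain i w where "b = axis i w" by (auto simp: Basis_vec_def)
  then show "((\<lambda>x. f x \<bullet> b) has_derivative (\<lambda>x. f' x \<bullet> b)) (at a)"
    using has_derivative_inner_left[OF assms[of i], of w] by (simp add: inner_axis)
qed

text \<open>Passes from invariance under a sequence tending to the identity to invariance under the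
  one-parameter group of its limit direction: XA is a limit of the steps Y_m A, so P has derivative
  0 along the curve. The generic P is used for the determinant and for evaluation of the
  form.\<close>

lemma mat_exp_invariant:
  fixes P :: "complex^'n::finite^'n \<Rightarrow> complex"
  assumes diff: "\<And>A. P differentiable (at A)"
    and hol: "(\<lambda>z. P (mat_exp X z)) holomorphic_on UNIV"
    and \<epsilon>: "\<epsilon> \<longlonglongrightarrow> 0" "\<And>m. \<epsilon> m > (0::real)" and Y: "Y \<longlonglongrightarrow> X"
    and inv: "\<And>(m::nat) A. P ((mat 1 + \<epsilon> m *\<^sub>R Y m) ** A) = P A"
  shows "P (mat_exp X z) = P (mat 1)"
proof -
  have "((\<lambda>z. P (mat_exp X z)) has_field_derivative 0) (at z)" for z
  proof -
    let ?A = "mat_exp X z"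
    obtain D where D: "(P has_derivative D) (at ?A)" using diff differentiable_def by blast
    obtain F where F: "((\<lambda>z. P (mat_exp X z)) has_field_derivative F) (at z)"
      using hol by (auto simp: holomorphic_on_def field_differentiable_def)
    have "(\<lambda>m. Y m ** ?A) \<longlonglongrightarrow> X ** ?A" by (intro tendsto_matrix_mult Y tendsto_const)
    moreover have "P (?A + \<epsilon> m *\<^sub>R (Y m ** ?A)) = P ?A" for m
    proof -
      have "(mat 1 + \<epsilon> m *\<^sub>R Y m) ** ?A = ?A + \<epsilon> m *\<^sub>R (Y m ** ?A)"
        by (simp add: matrix_add_mult scalar_matrix_assoc)
      then show ?thesis using inv[of m ?A] by simp
    qed
    ultimately have D0: "D (X ** ?A) = 0" by (rule derivative_along_sequence[OF D \<epsilon>])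
    \<comment> \<open>D is a derivative over the reals, so the curve is followed in a real direction
      only; holomorphy then makes this the complex derivative.\<close>
    have "((\<lambda>s::real. mat_exp X (z + of_real s)) has_derivative (\<lambda>s. s *\<^sub>R (X ** ?A))) (at 0)"
    proof -
      have "((\<lambda>s::real. mat_exp X (z + of_real s) $ i $ j) has_derivative (\<lambda>s. s *\<^sub>R (X ** ?A) $ i $ j)) (at 0)" for i j
      proof -
        have "((\<lambda>s::real. z + of_real s) has_vector_derivative 1) (at 0)"
          by (auto intro!: derivative_eq_intros simp: has_vector_derivative_def scaleR_conv_of_real)
        then have "((\<lambda>z. mat_exp X z $ i $ j) \<circ> (\<lambda>s::real. z + of_real s) has_vector_derivative 1 * (X ** ?A) $ i $ j) (at 0)"
          by (rule field_vector_diff_chain_at) (simp add: mat_exp_deriv)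
        then show ?thesis by (simp add: has_vector_derivative_def o_def)
      qed
      then show ?thesis by (intro has_derivative_vecI) simp
    qed
    then have "((\<lambda>s::real. P (mat_exp X (z + of_real s))) has_derivative (\<lambda>s. D (s *\<^sub>R (X ** ?A)))) (at 0)"
      by (rule has_derivative_compose) (use D in simp)
    moreover have "D (s *\<^sub>R (X ** ?A)) = 0" for s
      using D0 has_derivative_bounded_linear[OF D] by (simp add: bounded_linear.linear linear_scale)
    ultimately have 1: "((\<lambda>s::real. P (mat_exp X (z + of_real s))) has_vector_derivative 0) (at 0)"
      by (simp add: has_vector_derivative_def)
    have "((\<lambda>s::real. z + of_real s) has_vector_derivative 1) (at 0)"
      by (auto intro!: derivative_eq_intros simp: has_vector_derivative_def scaleR_conv_of_real)
    then have "((\<lambda>z. P (mat_exp X z)) \<circ> (\<lambda>s::real. z + of_real s) has_vector_derivative 1 * F) (at 0)"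
      by (rule field_vector_diff_chain_at) (use F in simp)
    then have "F = 0" using vector_derivative_unique_at[OF 1] by (simp add: o_def)
    then show ?thesis using F by simp
  qed
  then have "P (mat_exp X z) = P (mat_exp X 0)"
    using has_field_derivative_zero_constant[of UNIV "\<lambda>z. P (mat_exp X z)"] by auto
  then show ?thesis by (simp add: mat_exp_0)
qed

lemma differentiable_entry: "(\<lambda>A :: complex^'n::finite^'n. A $ i $ j) differentiable (at A)"
proof -
  have "bounded_linear (\<lambda>A :: complex^'n^'n. A $ i $ j)"
    by (intro bounded_linear_compose[OF bounded_linear_vec_nth] bounded_linear_vec_nth)
  then show ?thesis by (rule bounded_linear_imp_differentiable)
qed

lemma differentiable_prod:
  fixes f :: "'i \<Rightarrow> 'a::real_normed_vector \<Rightarrow> complex"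
  assumes "\<And>i. i \<in> I \<Longrightarrow> f i differentiable (at x)"
  shows "(\<lambda>x. \<Prod>i\<in>I. f i x) differentiable (at x)"
  using assms by (induction I rule: infinite_finite_induct) (auto intro: differentiable_mult)

lemma det_differentiable: "det differentiable (at (A :: complex^'n::finite^'n))"
  unfolding det_def[abs_def]
  by (intro differentiable_sum differentiable_mult differentiable_const differentiable_prod differentiable_entry ballI finite_permutations) auto

lemma feval_differentiable: "(\<lambda>A :: complex^'n::finite^'n. feval d c (A *v x)) differentiable (at A)"
  unfolding feval_def matrix_vector_mult_def
  by (simp, intro differentiable_sum differentiable_mult differentiable_const differentiable_prod differentiable_power differentiable_entry ballI) auto

lemma mat_exp_holomorphic: "(\<lambda>z. mat_exp X z $ i $ j) holomorphic_on UNIV"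
  unfolding holomorphic_on_def field_differentiable_def
  using has_field_derivative_at_within[OF mat_exp_deriv] by blast

lemma fstab_fsubst:
  assumes "c \<in> hform d" shows "g \<in> fstab d c \<longleftrightarrow> g \<in> SL \<and> fsubst d c g = c"
proof
  assume "g \<in> fstab d c"
  then show "g \<in> SL \<and> fsubst d c g = c" using fsubst_eqI[OF assms, of c g] by (auto simp: fstab_def)
next
  assume g: "g \<in> SL \<and> fsubst d c g = c"
  then have "feval d c x = feval d c (g *v x)" for x using feval_fsubst[of d c g x] by simp
  then show "g \<in> fstab d c" using g by (simp add: fstab_def)
qed

text \<open>If the stabiliser is infinite and bounded, a limit direction X of its elements at the
  identity exponentiates to a bounded entire curve, against Liouville.\<close>
lemma finite_fstab:
  fixes c :: "('n::finite \<Rightarrow> nat) \<Rightarrow> complex"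
  assumes c: "c \<in> hform d" and bd: "bounded (fstab d c)"
  shows "finite (fstab d c)"
proof (rule ccontr)
  assume inf: "infinite (fstab d c)"
  obtain g0 where "g0 islimpt fstab d c"
    using bounded_infinite_imp_islimpt[OF subset_refl bd inf] by blast
  then obtain g where g: "\<And>m::nat. g m \<in> fstab d c - {g0}" "g \<longlonglongrightarrow> g0"
    unfolding islimpt_sequential by blast
  have gd: "det (g m) = 1" "feval d c (g m *v x) = feval d c x" for m x
    using g(1)[of m] by (auto simp: fstab_def SL_def)
  have det0: "det g0 = 1" using tendsto_det[OF g(2)] gd(1) by (simp add: LIMSEQ_const_iff)
  have fe0: "feval d c (g0 *v x) = feval d c x" for x
  proof -
    have "(\<lambda>m. feval d c (g m *v x)) \<longlonglongrightarrow> feval d c (g0 *v x)"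
      unfolding matrix_vector_mult_def
      by (intro tendsto_feval tendsto_const tendsto_vec_lambda tendsto_intros g(2))
    then show ?thesis by (simp add: gd(2) LIMSEQ_const_iff)
  qed
  obtain g1 where g1: "g0 ** g1 = mat 1" "g1 ** g0 = mat 1"
    using det0 by (metis invertible_det_nz invertible_def zero_neq_one)
  have det1: "det g1 = 1" using arg_cong[OF g1(1), of det] by (simp add: det_mul det0)
  \<comment> \<open>Translation by the inverse of g0 moves the accumulation point to the identity
    and stays inside the stabiliser.\<close>
  define h where "h m = g m ** g1" for m
  have hd: "det (h m) = 1" for m by (simp add: h_def det_mul gd det1)
  have hf: "feval d c (h m *v x) = feval d c x" for m x
  proof -
    have "feval d c (h m *v x) = feval d c (g1 *v x)"
      by (simp add: h_def gd(2) flip: matrix_vector_mul_assoc)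
    also have "\<dots> = feval d c (g0 *v (g1 *v x))" by (simp add: fe0)
    finally show ?thesis by (simp add: matrix_vector_mul_assoc g1)
  qed
  have h1: "h m \<noteq> mat 1" for m
  proof
    assume "h m = mat 1"
    then have "g m ** (g1 ** g0) = g0" by (simp add: h_def matrix_mul_assoc)
    then show False using g(1)[of m] g1(2) by simp
  qed
  have hlim: "h \<longlonglongrightarrow> mat 1"
    unfolding h_def g1(1)[symmetric] by (intro tendsto_matrix_mult g(2) tendsto_const)
  define Z where "Z m = (h m - mat 1) /\<^sub>R norm (h m - mat 1)" for m
  have Z1: "norm (Z m) = 1" for m using h1[of m] by (simp add: Z_def)
  then have "bounded (range Z)" unfolding bounded_iff by (auto intro: exI[of _ 1])
  then obtain X \<rho> where \<rho>: "strict_mono (\<rho> :: nat \<Rightarrow> nat)" "(\<lambda>m. Z (\<rho> m)) \<longlonglongrightarrow> X"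
    by (rule bounded_convergent_subseq)
  have X1: "norm X = 1" using tendsto_norm[OF \<rho>(2)] by (simp add: Z1 LIMSEQ_const_iff)
  define \<epsilon> where "\<epsilon> m = norm (h (\<rho> m) - mat 1)" for m
  have \<epsilon>: "\<epsilon> \<longlonglongrightarrow> 0" "\<And>m. \<epsilon> m > 0"
  proof -
    have "(\<lambda>m. norm (h m - mat 1)) \<longlonglongrightarrow> 0"
      using tendsto_norm_zero[OF LIM_zero[OF hlim]] .
    then show "\<epsilon> \<longlonglongrightarrow> 0" unfolding \<epsilon>_def using LIMSEQ_subseq_LIMSEQ[OF _ \<rho>(1)] by (fastforce simp: o_def)
    show "\<epsilon> m > 0" for m using h1 by (simp add: \<epsilon>_def)
  qed
  have hZ: "mat 1 + \<epsilon> m *\<^sub>R Z (\<rho> m) = h (\<rho> m)" for m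
    using \<epsilon>(2)[of m] by (simp add: \<epsilon>_def Z_def)
  have "det (mat_exp X z) = det (mat 1 :: complex^'n^'n)" for z
  proof (rule mat_exp_invariant[where P=det, OF det_differentiable _ \<epsilon> \<rho>(2)])
    show "(\<lambda>z. det (mat_exp X z)) holomorphic_on UNIV"
      unfolding det_def by (intro holomorphic_intros mat_exp_holomorphic)
    show "det ((mat 1 + \<epsilon> m *\<^sub>R Z (\<rho> m)) ** A) = det A" for m A
      by (simp add: hZ det_mul hd)
  qed
  moreover have "feval d c (mat_exp X z *v x) = feval d c (mat 1 *v x)" for z x
  proof (rule mat_exp_invariant[where P="\<lambda>A. feval d c (A *v x)", OF feval_differentiable _ \<epsilon> \<rho>(2)])
    show "(\<lambda>z. feval d c (mat_exp X z *v x)) holomorphic_on UNIV"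
      unfolding feval_def matrix_vector_mult_def by (simp, intro holomorphic_intros mat_exp_holomorphic)
    show "feval d c ((mat 1 + \<epsilon> m *\<^sub>R Z (\<rho> m)) ** A *v x) = feval d c (A *v x)" for m A
      by (simp add: hZ hf flip: matrix_vector_mul_assoc)
  qed
  ultimately have E: "mat_exp X z \<in> fstab d c" for z by (simp add: fstab_def SL_def)
  obtain B where B: "\<And>g. g \<in> fstab d c \<Longrightarrow> norm g \<le> B" using bd by (auto simp: bounded_iff)
  have "X $ i $ j = 0" for i j
  proof -
    have "norm (mat_exp X z $ i $ j) \<le> B" for z
      using B[OF E[of z]] by (meson Finite_Cartesian_Product.norm_nth_le order_trans)
    then have "bounded (range (\<lambda>z. mat_exp X z $ i $ j))" unfolding bounded_iff by auto
    then have "(\<lambda>z. mat_exp X z $ i $ j) constant_on UNIV"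
      by (rule Liouville_theorem[OF mat_exp_holomorphic])
    then obtain k where "\<forall>z\<in>UNIV. mat_exp X z $ i $ j = k"
      unfolding constant_on_def ..
    then have "((\<lambda>_. k) has_field_derivative (X ** mat_exp X 0) $ i $ j) (at 0)"
      using mat_exp_deriv[of X i j 0] by simp
    then have "(X ** mat_exp X 0) $ i $ j = 0" using DERIV_const DERIV_unique by blast
    then show ?thesis by (simp add: mat_exp_0)
  qed
  then have "X = 0" by (simp add: vec_eq_iff)
  then show False using X1 by simp
qed

text \<open>Properness is used twice: for arbitrary B to close the orbit, and for B the sum of the
  moduli of the coefficients, where the bounded set contains the stabiliser.\<close>

lemma stable_of_weights:
  fixes c :: "('n::finite \<Rightarrow> nat) \<Rightarrow> complex"
  assumes c: "c \<in> hform d" "c \<noteq> (\<lambda>_. 0)"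
    and w: "\<And>g u. invertible g \<Longrightarrow> sum u UNIV = 0 \<Longrightarrow> \<exists>i. u i \<noteq> 0 \<Longrightarrow>
      (\<And>\<alpha>. \<alpha> \<in> dmonos d \<Longrightarrow> fsubst d c g \<alpha> \<noteq> 0 \<Longrightarrow> (\<Sum>i\<in>UNIV. \<alpha> i * u i) \<le> (0::real)) \<Longrightarrow> False"
  shows "stable d c"
proof -
  have bd: "bounded {g\<in>SL. \<forall>\<alpha>. norm (fsubst d c g \<alpha>) \<le> B}" for B
    by (rule bounded_of_weights[OF c(1)]) (rule w)
  have "norm (c \<alpha>) \<le> (\<Sum>\<alpha>\<in>dmonos d. norm (c \<alpha>))" for \<alpha>
    using c(1) member_le_sum[of \<alpha> "dmonos d" "\<lambda>\<alpha>. norm (c \<alpha>)"]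
    by (cases "\<alpha> \<in> dmonos d") (auto simp: hform_def intro: sum_nonneg)
  then have "fstab d c \<subseteq> {g\<in>SL. \<forall>\<alpha>. norm (fsubst d c g \<alpha>) \<le> (\<Sum>\<alpha>\<in>dmonos d. norm (c \<alpha>))}"
    using fstab_fsubst[OF c(1)] by auto
  then have "bounded (fstab d c)" using bd bounded_subset by blast
  then show ?thesis using c finite_fstab[OF c(1)] closed_forbit[OF bd] by (simp add: stable_def)
qed

section \<open>Isolated singularities\<close>

lemma continuous_fderiv_eval: "continuous_on UNIV (fderiv_eval d c \<beta>)"
  unfolding fderiv_eval_def[abs_def] by (intro continuous_intros)

lemma sing_pts_scale:
  assumes "x \<in> sing_pts d c" "t \<noteq> 0" shows "t *s x \<in> sing_pts d c"
  using assms by (simp add: sing_pts_def feval_fderiv fderiv_eval_scale)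

text \<open>The singular points on the unit sphere form a compact set, covered by balls in which all
  singular points are multiples of the centre. A finite subcover gives the representatives, and
  scaling reaches all other points.\<close>

lemma sing_pts_finite_reps:
  fixes c :: "('n::finite \<Rightarrow> nat) \<Rightarrow> complex"
  assumes "\<forall>x\<in>sing_pts d c. isolated_sing d c x"
  obtains Z where "finite Z" "0 \<notin> Z" "\<And>x. x \<in> sing_pts d c \<Longrightarrow> \<exists>z\<in>Z. \<exists>t. x = t *s z"
proof -
  define K where "K = sing_pts d c \<inter> sphere 0 1"
  have "K = sphere 0 1 \<inter> (\<Inter>\<beta>\<in>insert (\<lambda>_. 0) (range unitv). {x. fderiv_eval d c \<beta> x = 0})"
    by (auto simp: K_def sing_pts_def feval_fderiv)
  moreover have "closed {x. fderiv_eval d c \<beta> x = 0}" for \<beta>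
    by (intro closed_Collect_eq continuous_fderiv_eval continuous_on_const)
  ultimately have "compact K" by (metis (no_types, lifting) closed_INT compact_Int_closed compact_sphere)
  moreover obtain e where e: "\<And>x. x \<in> sing_pts d c \<Longrightarrow> e x > 0"
    "\<And>x y. x \<in> sing_pts d c \<Longrightarrow> y \<in> sing_pts d c \<Longrightarrow> norm (y - x) < e x \<Longrightarrow> \<exists>t. y = t *s x"
    using assms unfolding isolated_sing_def by metis
  moreover have "K \<subseteq> (\<Union>x\<in>K. ball x (e x))" using e(1) by (auto simp: K_def)
  ultimately obtain Z where Z: "Z \<subseteq> K" "finite Z" "K \<subseteq> (\<Union>x\<in>Z. ball x (e x))"
    using compactE_image[of K K "\<lambda>x. ball x (e x)"] by (metis open_ball)
  have "\<exists>z\<in>Z. \<exists>t. x = t *s z" if x: "x \<in> sing_pts d c" for x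
  proof -
    have x0: "x \<noteq> 0" using x by (simp add: sing_pts_def)
    define y where "y = of_real (inverse (norm x)) *s x"
    have "y = inverse (norm x) *\<^sub>R x"
      unfolding y_def vec_eq_iff vector_smult_component vector_scaleR_component
      by (simp add: scaleR_conv_of_real)
    then have "norm y = 1" using x0 by simp
    moreover have ys: "y \<in> sing_pts d c" unfolding y_def using x0 by (intro sing_pts_scale x) simp
    ultimately have "y \<in> K" by (simp add: K_def)
    then obtain z where z: "z \<in> Z" "norm (y - z) < e z" using Z(3) by (auto simp: dist_norm norm_minus_commute)
    then obtain t where yt: "y = t *s z" using e(2)[of z y] ys Z(1) by (auto simp: K_def)
    define k where "k = complex_of_real (norm x)"
    have "x = k *s y" using x0 by (simp add: y_def k_def vec_eq_iff)
    also have "\<dots> = (k * t) *s z" by (simp add: yt)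
    finally show ?thesis using z(1) by blast
  qed
  moreover have "0 \<notin> Z" using Z(1) by (auto simp: K_def)
  ultimately show ?thesis using that Z(2) by blast
qed

text \<open>Adding t times a coordinate that does not vanish at the new point leaves only finitely
  many bad values of t.\<close>

lemma linear_form_avoiding_zeros:
  fixes Z :: "(complex^'n::finite) set"
  assumes "finite Z" "0 \<notin> Z"
  shows "\<exists>l. \<forall>z\<in>Z. (\<Sum>i\<in>UNIV. l i * z $ i) \<noteq> 0"
  using assms
proof (induction Z)
  case empty
  then show ?case by simp
next
  case (insert z Z)
  then obtain l where l: "\<And>w. w \<in> Z \<Longrightarrow> (\<Sum>i\<in>UNIV. l i * w $ i) \<noteq> 0" by auto
  obtain k where k: "z $ k \<noteq> 0" using insert.prems by (auto simp: vec_eq_iff)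
  \<comment> \<open>For w with w_k = 0 the excluded value is just 0. Such w differ from z, and the
    change from l to l' does not affect them.\<close>
  obtain t where t: "t \<notin> (\<lambda>w. - (\<Sum>i\<in>UNIV. l i * w $ i) / w $ k) ` insert z Z"
    using ex_new_if_finite[OF infinite_UNIV_char_0 finite_imageI[OF finite.insertI[OF insert.hyps(1)]]] by blast
  define l' where "l' i = l i + (if i = k then t else 0)" for i
  have eq: "(\<Sum>i\<in>UNIV. l' i * w $ i) = (\<Sum>i\<in>UNIV. l i * w $ i) + t * w $ k" for w
    by (simp add: l'_def distrib_right sum.distrib if_distrib[of "\<lambda>x. x * _"] cong: if_cong)
  have "(\<Sum>i\<in>UNIV. l' i * w $ i) \<noteq> 0" if w: "w \<in> insert z Z" for w
  proof
    assume 0: "(\<Sum>i\<in>UNIV. l' i * w $ i) = 0"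
    show False
    proof (cases "w $ k = 0")
      case True
      then have "w \<in> Z" using w k by auto
      then show False using 0 l True eq[of w] by simp
    next
      case False
      then have "t = - (\<Sum>i\<in>UNIV. l i * w $ i) / w $ k" using 0 eq[of w]
        by (simp add: field_simps eq_neg_iff_add_eq_0)
      then show False using t w by blast
    qed
  qed
  then show ?case by blast
qed

lemma linear_form_avoiding_sing:
  fixes c :: "('n::finite \<Rightarrow> nat) \<Rightarrow> complex"
  assumes "\<forall>x\<in>sing_pts d c. isolated_sing d c x"
  obtains l where "\<And>x. x \<in> sing_pts d c \<Longrightarrow> (\<Sum>i\<in>UNIV. l i * x $ i) \<noteq> 0"
proof -
  obtain Z where Z: "finite Z" "0 \<notin> Z" "\<And>x. x \<in> sing_pts d c \<Longrightarrow> \<exists>z\<in>Z. \<exists>t. x = t *s z"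
    using sing_pts_finite_reps[OF assms] by blast
  obtain l where l: "\<forall>z\<in>Z. (\<Sum>i\<in>UNIV. l i * z $ i) \<noteq> 0"
    using linear_form_avoiding_zeros[OF Z(1,2)] by blast
  have "(\<Sum>i\<in>UNIV. l i * x $ i) \<noteq> 0" if x: "x \<in> sing_pts d c" for x
  proof -
    obtain z t where zt: "z \<in> Z" "x = t *s z" using Z(3)[OF x] by blast
    have "t \<noteq> 0" using x zt by (auto simp: sing_pts_def)
    moreover have "(\<Sum>i\<in>UNIV. l i * x $ i) = t * (\<Sum>i\<in>UNIV. l i * z $ i)"
      by (simp add: zt(2) sum_distrib_left mult_ac)
    ultimately show ?thesis using l zt(1) by simp
  qed
  then show ?thesis using that by blast
qed

text \<open>The weights live in the coordinates given by g. Singular points, Hessian ranks and the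
  avoiding linear form are transported there, the form by composition with g.\<close>

lemma rank_bound_of_fsubst_weights:
  fixes c :: "('n::finite \<Rightarrow> nat) \<Rightarrow> complex" and u :: "'n \<Rightarrow> real"
  assumes d: "d \<ge> 3" and isol: "\<forall>x\<in>sing_pts d c. isolated_sing d c x"
    and r: "\<And>x. x \<in> sing_pts d c \<Longrightarrow> rank (hessian d c x) \<ge> r" "r > 0"
    and g: "invertible g" and u: "sum u UNIV = 0" "\<exists>i. u i \<noteq> 0"
    and w: "\<And>\<alpha>. \<alpha> \<in> dmonos d \<Longrightarrow> fsubst d c g \<alpha> \<noteq> 0 \<Longrightarrow> (\<Sum>i\<in>UNIV. \<alpha> i * u i) \<le> 0"
  shows "d * r \<le> 2 * CARD('n)"
    "(\<And>\<alpha>. \<alpha> \<in> dmonos d \<Longrightarrow> fsubst d c g \<alpha> \<noteq> 0 \<Longrightarrow> (\<Sum>i\<in>UNIV. \<alpha> i * u i) < 0) \<Longrightarrow> d * r < 2 * CARD('n)"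
proof -
  obtain l where l: "\<And>x. x \<in> sing_pts d c \<Longrightarrow> (\<Sum>i\<in>UNIV. l i * x $ i) \<noteq> 0"
    using linear_form_avoiding_sing[OF isol] by blast
  define l' where "l' i = (\<Sum>k\<in>UNIV. l k * g $ k $ i)" for i
  have l'g: "(\<Sum>i\<in>UNIV. l' i * x $ i) = (\<Sum>k\<in>UNIV. l k * (g *v x) $ k)" for x
    unfolding l'_def matrix_vector_mult_def
    by (simp add: sum_distrib_left sum_distrib_right mult.assoc) (rule sum.swap)
  have l': "(\<Sum>i\<in>UNIV. l' i * x $ i) \<noteq> 0" if "x \<in> sing_pts d (fsubst d c g)" for x
    unfolding l'g using that by (intro l) (simp add: sing_pts_fsubst[OF g])
  have r': "rank (hessian d (fsubst d c g) x) \<ge> r" if "x \<in> sing_pts d (fsubst d c g)" for x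
    unfolding rank_hessian_fsubst[OF g] using that by (intro r) (simp add: sing_pts_fsubst[OF g])
  show "d * r \<le> 2 * CARD('n)"
    by (rule rank_bound_of_weights(1)[OF d u w l' r' r(2)])
  show "(\<And>\<alpha>. \<alpha> \<in> dmonos d \<Longrightarrow> fsubst d c g \<alpha> \<noteq> 0 \<Longrightarrow> (\<Sum>i\<in>UNIV. \<alpha> i * u i) < 0) \<Longrightarrow> d * r < 2 * CARD('n)"
    by (rule rank_bound_of_weights(2)[OF d u w l' r' r(2)])
qed


theorem theorem2p3:
  fixes c :: "('n::finite \<Rightarrow> nat) \<Rightarrow> complex" and d :: nat
  assumes n2: "CARD('n) \<ge> 3"
    and d34: "d \<in> {3, 4}"
    and form: "c \<in> hform d" and nz: "c \<noteq> (\<lambda>_. 0)"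
    and singular: "sing_pts d c \<noteq> {}"
    and isol: "\<forall>x\<in>sing_pts d c. isolated_sing d c x"
    and mult2: "\<forall>x\<in>sing_pts d c. fmult d c x = 2"
  defines "r \<equiv> Min {rank (hessian d c x) | x. x \<in> sing_pts d c}"
  shows "(real r > 2 * real CARD('n) / real d \<longrightarrow> stable d c)
       \<and> (real r \<ge> 2 * real CARD('n) / real d \<longrightarrow> semistable d c)"
proof -
  have d3: "d \<ge> 3" "d > 0" using d34 by auto
  \<comment> \<open>Ranks are bounded by the dimension, so the set is finite and \<open>Min\<close>
    is a true minimum even if there are infinitely many representatives.\<close>
  have "{rank (hessian d c x) | x. x \<in> sing_pts d c} \<subseteq> {..vec.dimension TYPE(complex) TYPE('n)}"
    by (auto simp: row_rank_def_gen vec.dim_subset_UNIV)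
  then have "finite {rank (hessian d c x) | x. x \<in> sing_pts d c}" by (rule finite_subset) simp
  then have r: "rank (hessian d c x) \<ge> r" if "x \<in> sing_pts d c" for x
    unfolding r_def using that by (intro Min_le) blast+
  show ?thesis
  proof (intro conjI impI)
    assume "real r > 2 * real CARD('n) / real d"
    then have "real (d * r) > real (2 * CARD('n))" using d3 by (simp add: divide_less_eq mult.commute)
    then have dr: "d * r > 2 * CARD('n)" by (simp only: of_nat_less_iff)
    then have r0: "r > 0" by (cases r) auto
    show "stable d c"
    proof (rule stable_of_weights[OF form nz])
      fix g :: "complex^'n^'n" and u :: "'n \<Rightarrow> real"
      assume gu: "invertible g" "sum u UNIV = 0" "\<exists>i. u i \<noteq> 0"
        and w: "\<And>\<alpha>. \<alpha> \<in> dmonos d \<Longrightarrow> fsubst d c g \<alpha> \<noteq> 0 \<Longrightarrow> (\<Sum>i\<in>UNIV. \<alpha> i * u i) \<le> 0"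
      have "d * r \<le> 2 * CARD('n)"
        by (rule rank_bound_of_fsubst_weights(1)[OF d3(1) isol r r0 gu w])
      then show False using dr by linarith
    qed
  next
    assume "real r \<ge> 2 * real CARD('n) / real d"
    then have "real (d * r) \<ge> real (2 * CARD('n))" using d3 by (simp add: divide_le_eq mult.commute)
    then have dr: "d * r \<ge> 2 * CARD('n)" by (simp only: of_nat_le_iff)
    then have r0: "r > 0" by (cases r) auto
    show "semistable d c"
    proof (rule semistable_of_weights[OF form nz])
      fix g :: "complex^'n^'n" and u :: "'n \<Rightarrow> real"
      assume gu: "invertible g" "sum u UNIV = 0" "\<exists>i. u i \<noteq> 0"
        and w: "\<And>\<alpha>. \<alpha> \<in> dmonos d \<Longrightarrow> fsubst d c g \<alpha> \<noteq> 0 \<Longrightarrow> (\<Sum>i\<in>UNIV. \<alpha> i * u i) < 0"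
      have "d * r < 2 * CARD('n)"
        by (rule rank_bound_of_fsubst_weights(2)[OF d3(1) isol r r0 gu less_imp_le[OF w] w])
      then show False using dr by linarith
    qed
  qed
qed

end
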